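(* Let $f$ be a Drinfeld modular form of weight $k$ and type $l$ for $\Gamma_0(\mathfrak{p})$ whose $u$-series expansion has coefficients in $A$ and leading coefficient $1$, and suppose $f$ is an eigenform of the Fricke involution $|_{k,l}[W_{\mathfrak{p}}]$. Let $\operatorname{N}(f)=\prod_{\gamma\in\Gamma_0(\mathfrak{p})\backslash\operatorname{GL}_2(A)}f|_{k,l}[\gamma]$, and let $\widetilde{\operatorname{N}(f)}$ be the scalar multiple of $\operatorname{N}(f)$ whose $u$-series has leading coefficient $1$. Then $\widetilde{\operatorname{N}(f)}$ has $u$-series coefficients in $A$ and $\widetilde{\operatorname{N}(f)}\equiv f^2\pmod{\mathfrak{p}}$.
   Context: Let $q$ be a power of a prime $p$, $A=\mathbb{F}_q[T]$, $K=\mathbb{F}_q(T)$, $K_\infty=\mathbb{F}_q((1/T))$, $C$ the completion of an algebraic closure of $K_\infty$, $\Omega=C\setminus K_\infty$. Fix a monic prime $\pi\in A$ of degree $d$, $\mathfrak{p}=\pi A$. Carlitz module: $\rho_T(x)=Tx+x^q$, lattice $L=\tilde\pi A$, exponential $e_L$ with $e_L(az)=\rho_a(e_L(z))$; $u(z)=1/e_L(\tilde\pi z)$. $\Gamma_0(\mathfrak{p})$ is the group of matrices in $\operatorname{GL}_2(A)$ with lower-left entry in $\mathfrak{p}$. A Drinfeld modular form of weight $k$, type $l\in\mathbb{Z}/(q-1)$ for $\Gamma$ is a rigid analytic $f:\Omega\to C$ with $f(\gamma z)=(\det\gamma)^{-l}(cz+d)^kf(z)$ for $\gamma=\begin{pmatrix}a&b\\c&d\end{pmatrix}\in\Gamma$,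 analytic at the cusps; its $u$-series is the expansion in $u$ at $\infty$, and its leading coefficient is the coefficient of the lowest power of $u$ occurring. Slash operator for $\gamma\in\operatorname{GL}_2(K)$: $f|_{k,l}[\gamma]=\zeta_\gamma^l(\det\gamma/\zeta_\gamma)^{k/2}(cz+d)^{-k}f(\gamma z)$, where $\zeta_\gamma\in\mathbb{F}_q^\times$ is the leading coefficient of $\det\gamma$ as a Laurent series in $1/T$. The Fricke involution is $f\mapsto f|_{k,l}[W_{\mathfrak{p}}]=\pi^{k/2}(\pi z)^{-k}f(-1/(\pi z))$, $W_{\mathfrak{p}}=\begin{pmatrix}0&-1\\ \pi&0\end{pmatrix}$. Congruence mod $\mathfrak{p}$ of $u$-series means all coefficients of the difference lie in $\mathfrak{p}$. *)

theory Defs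
  imports
    "HOL-Analysis.Analysis"
    "HOL-Algebra.Coset"
    "HOL-Computational_Algebra.Computational_Algebra"
begin

unbundle no fps_syntax

section \<open>The field C\<close>

text \<open>
  The library's \<^const>\<open>norm\<close> is restricted to real normed vector spaces, hence the separate symbol.
\<close>

class ultrametric_field = field + metric_space +
  fixes absval :: "'a \<Rightarrow> real"
  assumes dist_absval: "dist x y = absval (x - y)"
    and absval_mult: "absval (x * y) = absval x * absval y"
    and absval_add_le_max: "absval (x + y) \<le> max (absval x) (absval y)"

text \<open>
  The finite field \<open>\<F>\<^sub>q\<close> is a type \<open>'a\<close> of sort \<open>{field, finite}\<close>, so \<open>q = CARD('a)\<close>; \<open>A\<close> is
  \<^typ>\<open>'a poly\<close>, and \<open>K\<^sub>\<infinity>\<close> is \<^typ>\<open>'a fls\<close> with the formal variable \<^const>\<open>fls_X\<close> playing the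
  role of \<open>1/T\<close>, so that \<open>T\<close> is \<^const>\<open>fls_X_inv\<close> and \<open>|x| = q\<close> to the power minus the
  subdegree of \<open>x\<close>.

  The completion of an algebraic closure of \<open>K\<^sub>\<infinity>\<close> is characterised up to isometric isomorphism
  over \<open>K\<^sub>\<infinity>\<close>: it is a complete, algebraically closed field with a nonarchimedean absolute value,
  together with an isometric embedding \<open>\<iota>\<close> of \<open>K\<^sub>\<infinity>\<close> such that the elements algebraic over \<open>K\<^sub>\<infinity>\<close>
  are dense.
\<close>

locale C_infinity =
  fixes \<iota> :: "'a::{field,finite} fls \<Rightarrow> 'c::{ultrametric_field,complete_space,alg_closed_field}"
  assumes emb_one: "\<iota> 1 = 1"
    and emb_add: "\<iota> (x + y) = \<iota> x + \<iota> y"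
    and emb_mult: "\<iota> (x * y) = \<iota> x * \<iota> y"
    and absval_emb: "x \<noteq> 0 \<Longrightarrow> absval (\<iota> x) = real CARD('a) powi (- fls_subdegree x)"
    and dense_algebraic:
      "closure {z. \<exists>p :: 'a fls poly. p \<noteq> 0 \<and> poly (map_poly \<iota> p) z = 0} = UNIV"

definition fls_of_A :: "'a::field poly \<Rightarrow> 'a fls" where
  "fls_of_A a = poly (map_poly fls_const a) fls_X_inv"

abbreviation (input) emb_A :: "('a::field fls \<Rightarrow> 'c) \<Rightarrow> 'a poly \<Rightarrow> 'c" where
  "emb_A \<iota> a \<equiv> \<iota> (fls_of_A a)"


section \<open>The half plane and rigid analytic functions\<close>

definition Omega :: "('a::field fls \<Rightarrow> 'c::metric_space) \<Rightarrow> 'c set" where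
  "Omega \<iota> = UNIV - range \<iota>"

abbreviation im_abs :: "('a::field fls \<Rightarrow> 'c::metric_space) \<Rightarrow> 'c \<Rightarrow> real" where
  "im_abs \<iota> z \<equiv> infdist z (range \<iota>)"

text \<open>
  The affinoids \<open>\<Omega>\<^sub>n\<close> form the usual admissible covering of \<open>\<Omega>\<close>. A function on \<open>\<Omega>\<close> is rigid analytic
  if its restriction to each of them is a uniform limit of rational functions without poles there.
\<close>

definition Omega_aff ::
  "('a::{field,finite} fls \<Rightarrow> 'c::ultrametric_field) \<Rightarrow> nat \<Rightarrow> 'c set" where
  "Omega_aff \<iota> n =
     {z. absval z \<le> real CARD('a) ^ n \<and> im_abs \<iota> z \<ge> 1 / real CARD('a) ^ n}"

definition rigid_analytic ::
  "('a::{field,finite} fls \<Rightarrow> 'c::ultrametric_field) \<Rightarrow> ('c \<Rightarrow> 'c) \<Rightarrow> bool" where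
  "rigid_analytic \<iota> f \<longleftrightarrow> (\<forall>n. \<exists>P Q :: nat \<Rightarrow> 'c poly.
     (\<forall>m. \<forall>z\<in>Omega_aff \<iota> n. poly (Q m) z \<noteq> 0) \<and>
     uniform_limit (Omega_aff \<iota> n) (\<lambda>m z. poly (P m) z / poly (Q m) z) f sequentially)"


section \<open>The Carlitz module and its exponential\<close>

definition carlitz_T :: "('a::{field,finite} fls \<Rightarrow> 'c::field) \<Rightarrow> 'c \<Rightarrow> 'c" where
  "carlitz_T \<iota> x = \<iota> fls_X_inv * x + x ^ CARD('a)"

definition carlitz :: "('a::{field,finite} fls \<Rightarrow> 'c::field) \<Rightarrow> 'a poly \<Rightarrow> 'c \<Rightarrow> 'c" where
  "carlitz \<iota> a x = (\<Sum>i\<le>degree a. \<iota> (fls_const (coeff a i)) * (carlitz_T \<iota> ^^ i) x)"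

definition lattice_exp :: "'c::ultrametric_field set \<Rightarrow> 'c \<Rightarrow> 'c" where
  "lattice_exp \<Lambda> z =
     z * Lim (finite_subsets_at_top (\<Lambda> - {0})) (\<lambda>S. \<Prod>x\<in>S. 1 - z / x)"

definition scaled_lattice ::
  "('a::field fls \<Rightarrow> 'c::ultrametric_field) \<Rightarrow> 'c \<Rightarrow> 'a poly set \<Rightarrow> 'c set" where
  "scaled_lattice \<iota> \<omega> I = (\<lambda>a. \<omega> * emb_A \<iota> a) ` I"

text \<open>
  The period \<open>\<omega>\<close> (written \<open>\<pi>\<close> with a tilde in the literature) is any generator of the lattice
  attached to the Carlitz module; it is determined up to a factor in the units of \<open>\<F>\<^sub>q\<close>.
\<close>

definition carlitz_period ::
  "('a::{field,finite} fls \<Rightarrow> 'c::ultrametric_field) \<Rightarrow> 'c \<Rightarrow> bool" where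
  "carlitz_period \<iota> \<omega> \<longleftrightarrow> \<omega> \<noteq> 0 \<and>
     (\<forall>a z. lattice_exp (scaled_lattice \<iota> \<omega> UNIV) (emb_A \<iota> a * z) =
            carlitz \<iota> a (lattice_exp (scaled_lattice \<iota> \<omega> UNIV) z))"

definition ideal_param ::
  "('a::field fls \<Rightarrow> 'c::ultrametric_field) \<Rightarrow> 'c \<Rightarrow> 'a poly set \<Rightarrow> 'c \<Rightarrow> 'c" where
  "ideal_param \<iota> \<omega> I z = 1 / lattice_exp (scaled_lattice \<iota> \<omega> I) (\<omega> * z)"

abbreviation u_param :: "('a::field fls \<Rightarrow> 'c::ultrametric_field) \<Rightarrow> 'c \<Rightarrow> 'c \<Rightarrow> 'c" where
  "u_param \<iota> \<omega> \<equiv> ideal_param \<iota> \<omega> UNIV"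


section \<open>Matrix groups and the slash operator\<close>

definition GL2_A :: "('a::field poly ^ 2 ^ 2) monoid" where
  "GL2_A = \<lparr>carrier = {M. invertible M}, monoid.mult = (**), one = mat 1\<rparr>"

definition Gamma0 :: "'a::field poly \<Rightarrow> ('a poly ^ 2 ^ 2) set" where
  "Gamma0 \<pi> = {M \<in> carrier GL2_A. \<pi> dvd M $ 2 $ 1}"

definition mat2 :: "'b \<Rightarrow> 'b \<Rightarrow> 'b \<Rightarrow> 'b \<Rightarrow> 'b::zero ^ 2 ^ 2" where
  "mat2 a b c d = vector [vector [a, b], vector [c, d]]"

abbreviation fls_mat_of_A :: "'a::field poly ^ 2 ^ 2 \<Rightarrow> 'a fls ^ 2 ^ 2" where
  "fls_mat_of_A \<equiv> map_matrix fls_of_A"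

definition automorphy ::
  "('a::field fls \<Rightarrow> 'c::field) \<Rightarrow> 'a fls ^ 2 ^ 2 \<Rightarrow> 'c \<Rightarrow> 'c" where
  "automorphy \<iota> \<gamma> z = \<iota> (\<gamma> $ 2 $ 1) * z + \<iota> (\<gamma> $ 2 $ 2)"

definition moebius_act ::
  "('a::field fls \<Rightarrow> 'c::field) \<Rightarrow> 'a fls ^ 2 ^ 2 \<Rightarrow> 'c \<Rightarrow> 'c" where
  "moebius_act \<iota> \<gamma> z = (\<iota> (\<gamma> $ 1 $ 1) * z + \<iota> (\<gamma> $ 1 $ 2)) / automorphy \<iota> \<gamma> z"

text \<open>
  \<open>x\<close> to the power \<open>k/2\<close>. The choice of square root matters only for odd \<open>k\<close>; in odd
  characteristic there are no nonzero forms of odd weight, and in characteristic 2 the square root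
  is unique.
\<close>

definition half_powi :: "'c::field \<Rightarrow> int \<Rightarrow> 'c" where
  "half_powi x k = (SOME s. s ^ 2 = x) powi k"

definition leading_const :: "'a::field fls \<Rightarrow> 'a fls" where
  "leading_const x = fls_const (fls_nth x (fls_subdegree x))"

text \<open>
  The formula for the slash operator makes sense for matrices over \<open>K\<^sub>\<infinity>\<close>, which contain those
  over \<open>K\<close>. The type \<open>l\<close> is given by an integer representative modulo \<open>q - 1\<close>, as it occurs only
  in exponents of elements of the units of \<open>\<F>\<^sub>q\<close>.
\<close>

definition slash ::
  "('a::field fls \<Rightarrow> 'c::field) \<Rightarrow> int \<Rightarrow> int \<Rightarrow> ('c \<Rightarrow> 'c) \<Rightarrow> 'a fls ^ 2 ^ 2 \<Rightarrow> 'c \<Rightarrow> 'c" where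
  "slash \<iota> k l f \<gamma> z =
     \<iota> (leading_const (det \<gamma>)) powi l *
     half_powi (\<iota> (det \<gamma> / leading_const (det \<gamma>))) k *
     automorphy \<iota> \<gamma> z powi (- k) * f (moebius_act \<iota> \<gamma> z)"

definition fricke_matrix :: "'a::field poly \<Rightarrow> 'a fls ^ 2 ^ 2" where
  "fricke_matrix \<pi> = mat2 0 (- 1) (fls_of_A \<pi>) 0"

definition fricke_eigenform ::
  "('a::field fls \<Rightarrow> 'c::{field,metric_space}) \<Rightarrow> 'a poly \<Rightarrow> int \<Rightarrow> int \<Rightarrow> ('c \<Rightarrow> 'c) \<Rightarrow> bool" where
  "fricke_eigenform \<iota> \<pi> k l f \<longleftrightarrow>
     (\<exists>z\<in>Omega \<iota>. f z \<noteq> 0) \<and>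
     (\<exists>\<mu>. \<forall>z\<in>Omega \<iota>. slash \<iota> k l f (fricke_matrix \<pi>) z = \<mu> * f z)"


section \<open>Expansions at the cusps and modular forms\<close>

definition has_expansion ::
  "('a::field fls \<Rightarrow> 'c::ultrametric_field) \<Rightarrow> ('c \<Rightarrow> 'c) \<Rightarrow> ('c \<Rightarrow> 'c) \<Rightarrow> 'c fps \<Rightarrow> bool" where
  "has_expansion \<iota> t f F \<longleftrightarrow>
     (\<exists>R. \<forall>z\<in>Omega \<iota>. im_abs \<iota> z \<ge> R \<longrightarrow> (\<lambda>n. fps_nth F n * t z ^ n) sums f z)"

text \<open>
  For \<open>\<delta> \<in> GL\<^sub>2(A)\<close>, the function \<open>f|[\<delta>]\<close> is invariant under the translations by the following
  ideal of \<open>A\<close>, whose exponential gives the uniformiser for the expansion of \<open>f\<close> at the cusp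
  \<open>\<delta>(\<infinity>)\<close>. For \<open>\<delta> = 1\<close> and \<open>\<Gamma> = \<Gamma>\<^sub>0(\<pi>)\<close> the ideal is \<open>A\<close> and the uniformiser is \<open>u\<close>.
\<close>

definition cusp_ideal ::
  "('a::field poly ^ 2 ^ 2) set \<Rightarrow> 'a poly ^ 2 ^ 2 \<Rightarrow> 'a poly set" where
  "cusp_ideal \<Gamma> \<delta> = {b. \<delta> ** mat2 1 b 0 1 ** matrix_inv \<delta> \<in> \<Gamma>}"

definition analytic_at_cusps ::
  "('a::field fls \<Rightarrow> 'c::ultrametric_field) \<Rightarrow> 'c \<Rightarrow> ('a poly ^ 2 ^ 2) set \<Rightarrow> int \<Rightarrow> int \<Rightarrow>
    ('c \<Rightarrow> 'c) \<Rightarrow> bool" where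
  "analytic_at_cusps \<iota> \<omega> \<Gamma> k l f \<longleftrightarrow> (\<forall>\<delta>\<in>carrier GL2_A. \<exists>F.
     has_expansion \<iota> (ideal_param \<iota> \<omega> (cusp_ideal \<Gamma> \<delta>)) (slash \<iota> k l f (fls_mat_of_A \<delta>)) F)"

definition drinfeld_modular_form ::
  "('a::{field,finite} fls \<Rightarrow> 'c::ultrametric_field) \<Rightarrow> 'c \<Rightarrow> ('a poly ^ 2 ^ 2) set \<Rightarrow>
    int \<Rightarrow> int \<Rightarrow> ('c \<Rightarrow> 'c) \<Rightarrow> bool" where
  "drinfeld_modular_form \<iota> \<omega> \<Gamma> k l f \<longleftrightarrow>
     rigid_analytic \<iota> f \<and>
     (\<forall>\<gamma>\<in>\<Gamma>. \<forall>z\<in>Omega \<iota>. f (moebius_act \<iota> (fls_mat_of_A \<gamma>) z) =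
        emb_A \<iota> (det \<gamma>) powi (- l) * automorphy \<iota> (fls_mat_of_A \<gamma>) z powi k * f z) \<and>
     analytic_at_cusps \<iota> \<omega> \<Gamma> k l f"

definition u_series ::
  "('a::field fls \<Rightarrow> 'c::ultrametric_field) \<Rightarrow> 'c \<Rightarrow> ('c \<Rightarrow> 'c) \<Rightarrow> 'c fps" where
  "u_series \<iota> \<omega> f = (THE F. has_expansion \<iota> (u_param \<iota> \<omega>) f F)"

definition leading_coefficient :: "'c::zero fps \<Rightarrow> 'c" where
  "leading_coefficient F = fps_nth F (subdegree F)"

definition coeffs_in_A :: "('a::field fls \<Rightarrow> 'c::zero) \<Rightarrow> 'c fps \<Rightarrow> bool" where
  "coeffs_in_A \<iota> F \<longleftrightarrow> (\<forall>n. fps_nth F n \<in> range (emb_A \<iota>))"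

definition fps_cong_mod ::
  "('a::field fls \<Rightarrow> 'c::ab_group_add) \<Rightarrow> 'a poly \<Rightarrow> 'c fps \<Rightarrow> 'c fps \<Rightarrow> bool" where
  "fps_cong_mod \<iota> \<pi> F G \<longleftrightarrow> (\<forall>n. fps_nth (F - G) n \<in> emb_A \<iota> ` {a. \<pi> dvd a})"


section \<open>The norm\<close>

text \<open>
  The product over the (finitely many) cosets \<open>\<Gamma>\<^sub>0(\<pi>)\<gamma>\<close> in \<open>GL\<^sub>2(A)\<close>; for \<open>f\<close> modular on
  \<open>\<Gamma>\<^sub>0(\<pi>)\<close> and \<open>z \<in> \<Omega>\<close> the factors do not depend on the chosen representatives.
\<close>

definition norm_form ::
  "('a::field fls \<Rightarrow> 'c::field) \<Rightarrow> 'a poly \<Rightarrow> int \<Rightarrow> int \<Rightarrow> ('c \<Rightarrow> 'c) \<Rightarrow> 'c \<Rightarrow> 'c" where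
  "norm_form \<iota> \<pi> k l f z =
     (\<Prod>X\<in>rcosets\<^bsub>GL2_A\<^esub> (Gamma0 \<pi>). slash \<iota> k l f (fls_mat_of_A (SOME \<gamma>. \<gamma> \<in> X)) z)"

definition normalize_form ::
  "('a::field fls \<Rightarrow> 'c::ultrametric_field) \<Rightarrow> 'c \<Rightarrow> ('c \<Rightarrow> 'c) \<Rightarrow> 'c \<Rightarrow> 'c" where
  "normalize_form \<iota> \<omega> f z = f z / leading_coefficient (u_series \<iota> \<omega> f)"

end

theory Submission
  imports Defs "Jordan_Normal_Form.Char_Poly"
begin

text \<open>
  The non-trivial cosets of \<open>\<Gamma>\<^sub>0(\<pp>)\<close> are represented by the matrices with rows \<open>(0, -1)\<close> and
  \<open>(1, b)\<close>, where \<open>b\<close> runs through the residues modulo \<open>\<pi>\<close>. As \<open>f\<close> is an eigenform of the Fricke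
  involution, \<open>N(f)\<close> is a constant multiple of \<open>f(z) \<Prod>\<^sub>b f((z + b) / \<pi>)\<close>. Let \<open>Q\<close> be the number of
  residues. The values \<open>u((z + b) / \<pi>)\<close> are the roots of the monic polynomial
  \<open>Y\<^bsup>Q\<^esup> - u \<Sum>\<^sub>i c\<^sub>i Y\<^bsup>Q - q^i\<^esup>\<close> over \<open>A[u]\<close>, where the \<open>c\<^sub>i\<close> are the coefficients of the Carlitz
  polynomial \<open>\<rho>\<^sub>\<pi>\<close>. Hence the product over \<open>b\<close> is a norm and has a \<open>u\<close>-series over \<open>A\<close>. Since
  \<open>\<rho>\<^sub>\<pi>\<close> is Eisenstein, the polynomial is \<open>Y\<^bsup>Q\<^esup> - u\<close> modulo \<open>\<pi>\<close>, so that the norm of the \<open>u\<close>-series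
  \<open>F\<close> of \<open>f\<close> is \<open>F(u\<^bsup>1/Q\<^esup>)\<^bsup>Q\<^esup>\<close>, which is congruent to \<open>F(u)\<close> because \<open>x\<^bsup>Q\<^esup> = x\<close> in \<open>A/\<pp>\<close>.
\<close>

section \<open>Ultrametric fields\<close>

text \<open>The normalisation discards scalars, so signs, half powers of determinants and the Fricke
  eigenvalue are never computed, only shown to be nonzero. What has to be exact is the product over
  b, and one integral object must be read there in two ways: at the true T and u(z), where it is the
  analytic product, and modulo \<pi>, where it is a Q-th power. For this reason the norm is built as
  a determinant over A[u] before any specialisation, and reduction modulo \<pi> is realised as the
  specialisation of T to a root of \<pi> in C. Both readings then happen in the same field, and
  repeated roots, as they occur modulo \<pi>, do no harm. The obstacle is that such a determinant
  exists only for polynomials, whereas F is a power series; estimates in C have to carry integrality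
  and the congruence over to the limit. Leading coefficient 1 is kept because F is u^n times a
  series with constant term 1, and the product of the values u((z + b) / \<pi>) is u(z) itself: the
  norm again starts with u^n, so that the normalisation never divides by a nonunit of A.\<close>

lemma absval_zero [simp]: "absval (0 :: 'c::ultrametric_field) = 0"
  using dist_absval[of "0 :: 'c" 0] by simp

lemma absval_nonneg [simp]: "absval (x :: 'c::ultrametric_field) \<ge> 0"
  using dist_absval[of x 0] zero_le_dist[of x 0] by simp

lemma absval_eq_0_iff [simp]: "absval (x :: 'c::ultrametric_field) = 0 \<longleftrightarrow> x = 0"
  using dist_absval[of x 0] dist_eq_0_iff[of x 0] by simp

lemma absval_pos_iff [simp]: "absval (x :: 'c::ultrametric_field) > 0 \<longleftrightarrow> x \<noteq> 0"
  using absval_nonneg[of x] by (auto simp: less_le simp del: absval_nonneg)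

lemma absval_one [simp]: "absval (1 :: 'c::ultrametric_field) = 1"
  using absval_mult[of "1 :: 'c" 1] by simp

lemma absval_minus [simp]: "absval (- x :: 'c::ultrametric_field) = absval x"
proof -
  have "absval (- x) = absval (0 - x)" by simp
  also have "\<dots> = dist 0 x" by (simp only: dist_absval)
  also have "\<dots> = dist x 0" by (rule dist_commute)
  also have "\<dots> = absval x" by (simp add: dist_absval)
  finally show ?thesis .
qed

lemma absval_diff_commute: "absval (x - y :: 'c::ultrametric_field) = absval (y - x)"
  using absval_minus[of "x - y"] by simp

lemma absval_power: "absval (x ^ n :: 'c::ultrametric_field) = absval x ^ n"
  by (induction n) (simp_all add: absval_mult)

lemma absval_inverse: "absval (inverse x :: 'c::ultrametric_field) = inverse (absval x)"
proof (cases "x = 0")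
  case False
  hence "absval x * absval (inverse x) = 1" by (simp flip: absval_mult)
  thus ?thesis using False by (simp add: field_simps)
qed simp

lemma absval_divide: "absval (x / y :: 'c::ultrametric_field) = absval x / absval y"
  by (simp add: divide_inverse absval_mult absval_inverse)

lemma absval_prod: "absval (\<Prod>i\<in>A. f i :: 'c::ultrametric_field) = (\<Prod>i\<in>A. absval (f i))"
  by (induction A rule: infinite_finite_induct) (simp_all add: absval_mult)

lemma absval_add_le:
  "\<lbrakk>absval x \<le> B; absval y \<le> B\<rbrakk> \<Longrightarrow> absval (x + y :: 'c::ultrametric_field) \<le> B"
  using absval_add_le_max[of x y] by simp

lemma absval_diff_le:
  "\<lbrakk>absval x \<le> B; absval y \<le> B\<rbrakk> \<Longrightarrow> absval (x - y :: 'c::ultrametric_field) \<le> B"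
  using absval_add_le[of x B "- y"] by simp

lemma absval_sum_le:
  assumes "\<And>i. i \<in> A \<Longrightarrow> absval (f i) \<le> B" and "B \<ge> 0"
  shows "absval (sum f A :: 'c::ultrametric_field) \<le> B"
  using assms by (induction A rule: infinite_finite_induct) (auto intro: absval_add_le)

text \<open>Writing y as (x + y) - x bounds |y| by the larger of |x + y| and |x|, and |x| is
  excluded.\<close>

lemma absval_add_eq:
  assumes "absval x < absval y"
  shows "absval (x + y :: 'c::ultrametric_field) = absval y"
proof -
  have "absval y \<le> max (absval (x + y)) (absval x)"
    using absval_add_le_max[of "x + y" "- x"] by simp
  with absval_add_le_max[of x y] assms show ?thesis by (auto simp: max_def split: if_splits)
qed

lemma absval_eq_if_diff_less:
  assumes "absval (x - y) < absval y"
  shows "absval (x :: 'c::ultrametric_field) = absval y"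
  using absval_add_eq[OF assms] by simp

text \<open>Telescoping, one factor at a time; \<open>B \<ge> 1\<close> allows the full length as
  exponent. Later the factors are partial sums at the roots of a polynomial, so that closeness of
  partial sums becomes closeness of norms.\<close>

lemma absval_prod_list_diff_le:
  fixes f g :: "'b \<Rightarrow> 'c::ultrametric_field"
  assumes "\<And>y. y \<in> set ys \<Longrightarrow> absval (f y) \<le> B" "\<And>y. y \<in> set ys \<Longrightarrow> absval (g y) \<le> B"
    and "\<And>y. y \<in> set ys \<Longrightarrow> absval (f y - g y) \<le> e" and B: "B \<ge> 1" and e: "e \<ge> 0"
  shows "absval ((\<Prod>y\<leftarrow>ys. f y) - (\<Prod>y\<leftarrow>ys. g y)) \<le> e * B ^ length ys"
  using assms(1-3)
proof (induction ys)
  case (Cons y ys)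
  let ?F = "\<Prod>y\<leftarrow>ys. f y" and ?G = "\<Prod>y\<leftarrow>ys. g y"
  have G: "absval ?G \<le> B ^ length ys"
    using Cons.prems(2) B by (induction ys) (auto simp: absval_mult intro!: mult_mono)
  have D: "absval (?F - ?G) \<le> e * B ^ length ys"
    using Cons.IH Cons.prems by auto
  have "f y * ?F - g y * ?G = f y * (?F - ?G) + (f y - g y) * ?G" by (simp add: algebra_simps)
  moreover have "absval (f y * (?F - ?G)) \<le> B * (e * B ^ length ys)"
    unfolding absval_mult using Cons.prems(1)[of y] D B by (intro mult_mono) auto
  moreover have "absval ((f y - g y) * ?G) \<le> B * (e * B ^ length ys)"
  proof -
    have "absval ((f y - g y) * ?G) \<le> e * B ^ length ys"
      unfolding absval_mult using Cons.prems(3)[of y] G B e by (intro mult_mono) auto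
    also have "\<dots> \<le> B * (e * B ^ length ys)" using mult_right_mono[of 1 B "e * B ^ length ys"] B e by simp
    finally show ?thesis .
  qed
  ultimately show ?case by (simp add: absval_add_le mult_ac)
qed (use e in simp)

lemma tendsto_absval_iff:
  "(f \<longlongrightarrow> (L :: 'c::ultrametric_field)) F \<longleftrightarrow> ((\<lambda>x. absval (f x - L)) \<longlongrightarrow> 0) F"
  by (subst tendsto_dist_iff) (simp add: dist_absval)

text \<open>This makes \<open>tendsto_add\<close>, \<open>tendsto_diff\<close> and
  \<open>sums_add\<close> available, although the absolute value is not a
  \<open>norm\<close>.\<close>

instance ultrametric_field \<subseteq> topological_ab_group_add
proof
  fix a b :: 'a
  have "((\<lambda>x. absval (fst x + snd x - (a + b))) \<longlongrightarrow> 0) (nhds a \<times>\<^sub>F nhds b)"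
  proof (rule tendsto_sandwich[OF always_eventually always_eventually tendsto_const])
    show "\<forall>x. absval (fst x + snd x - (a + b)) \<le> max (dist (fst x) a) (dist (snd x) b)"
    proof
      fix x :: "'a \<times> 'a"
      show "absval (fst x + snd x - (a + b)) \<le> max (dist (fst x) a) (dist (snd x) b)"
        using absval_add_le_max[of "fst x - a" "snd x - b"] by (simp add: dist_absval algebra_simps)
    qed
    have "((\<lambda>x. max (dist (fst x) a) (dist (snd x) b)) \<longlongrightarrow> max (dist a a) (dist b b))
        (nhds a \<times>\<^sub>F nhds b)"
      by (intro tendsto_intros filterlim_fst filterlim_snd tendsto_max)
    thus "((\<lambda>x. max (dist (fst x) a) (dist (snd x) b)) \<longlongrightarrow> 0) (nhds a \<times>\<^sub>F nhds b)" by simp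
  qed auto
  thus "((\<lambda>x. fst x + snd x) \<longlongrightarrow> a + b) (nhds a \<times>\<^sub>F nhds b)"
    by (simp add: tendsto_absval_iff)
  have "((\<lambda>x. absval (- x - - a)) \<longlongrightarrow> 0) (nhds a)"
  proof -
    have "((\<lambda>x. dist x a) \<longlongrightarrow> dist a a) (nhds a)" by (intro tendsto_intros filterlim_ident)
    moreover have "(\<lambda>x. absval (- x - - a)) = (\<lambda>x. dist x a)"
      by (auto simp: dist_absval absval_diff_commute)
    ultimately show ?thesis by simp
  qed
  thus "(uminus \<longlongrightarrow> - a) (nhds a)" by (simp add: tendsto_absval_iff[of uminus])
qed

lemma tendsto_absval [tendsto_intros]:
  "(f \<longlongrightarrow> (L :: 'c::ultrametric_field)) F \<Longrightarrow> ((\<lambda>x. absval (f x)) \<longlongrightarrow> absval L) F"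
  using tendsto_dist[of f L F "\<lambda>_. 0" 0] by (simp add: dist_absval)

instance ultrametric_field \<subseteq> topological_semigroup_mult
proof
  fix a b :: 'a
  let ?F = "nhds a \<times>\<^sub>F nhds b"
  have fst: "(fst \<longlongrightarrow> a) ?F" and snd: "(snd \<longlongrightarrow> b) ?F"
    by (rule filterlim_fst filterlim_snd)+
  have "((\<lambda>x. absval (fst x * snd x - a * b)) \<longlongrightarrow> 0) ?F"
  proof (rule tendsto_sandwich[OF always_eventually always_eventually tendsto_const])
    show "\<forall>x. absval (fst x * snd x - a * b) \<le>
        max (absval (fst x) * absval (snd x - b)) (absval (fst x - a) * absval b)"
    proof
      fix x :: "'a \<times> 'a"
      have "fst x * snd x - a * b = fst x * (snd x - b) + (fst x - a) * b"
        by (simp add: algebra_simps)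
      thus "absval (fst x * snd x - a * b) \<le>
          max (absval (fst x) * absval (snd x - b)) (absval (fst x - a) * absval b)"
        using absval_add_le_max[of "fst x * (snd x - b)" "(fst x - a) * b"]
        by (simp add: absval_mult)
    qed
    have "((\<lambda>x. max (absval (fst x) * absval (snd x - b)) (absval (fst x - a) * absval b)) \<longlongrightarrow>
        max (absval a * absval (b - b)) (absval (a - a) * absval b)) ?F"
      by (intro tendsto_intros tendsto_max fst snd tendsto_diff)
    thus "((\<lambda>x. max (absval (fst x) * absval (snd x - b)) (absval (fst x - a) * absval b)) \<longlongrightarrow>
        0) ?F" by simp
  qed auto
  thus "((\<lambda>x. fst x * snd x) \<longlongrightarrow> a * b) ?F"
    by (simp add: tendsto_absval_iff)
qed

section \<open>Limits and series in ultrametric fields\<close>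

lemma absval_tendsto_le:
  assumes "(f \<longlongrightarrow> (L :: 'c::ultrametric_field)) F" "eventually (\<lambda>x. absval (f x) \<le> B) F" "F \<noteq> bot"
  shows "absval L \<le> B"
  using tendsto_upperbound[OF tendsto_absval[OF assms(1)] assms(2,3)] .

lemma sums_absval_le:
  assumes "f sums (s :: 'c::ultrametric_field)" and "\<And>n. absval (f n) \<le> B"
  shows "absval s \<le> B"
proof -
  have "B \<ge> 0" using assms(2)[of 0] absval_nonneg[of "f 0"] by linarith
  show ?thesis
    using assms(1) unfolding sums_def
    by (rule absval_tendsto_le) (use assms(2) \<open>B \<ge> 0\<close> in \<open>auto intro!: always_eventually absval_sum_le\<close>)
qed

lemma Cauchy_if_le:
  fixes f :: "nat \<Rightarrow> 'c::ultrametric_field"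
  assumes "\<And>m n. m \<le> n \<Longrightarrow> absval (f n - f m) \<le> e m" "e \<longlonglongrightarrow> 0"
  shows "Cauchy f"
proof (rule metric_CauchyI)
  fix \<epsilon> :: real assume "\<epsilon> > 0"
  with assms(2) have "eventually (\<lambda>m. e m < \<epsilon>) sequentially" by (auto intro: order_tendstoD)
  then obtain M where M: "e M < \<epsilon>" by (auto simp: eventually_sequentially)
  show "\<exists>M. \<forall>m\<ge>M. \<forall>n\<ge>M. dist (f m) (f n) < \<epsilon>"
  proof (intro exI allI impI)
    fix m n assume "m \<ge> M" "n \<ge> M"
    have "f m - f n = (f m - f M) - (f n - f M)" by simp
    hence "dist (f m) (f n) \<le> e M"
      unfolding dist_absval using assms(1) \<open>m \<ge> M\<close> \<open>n \<ge> M\<close> by (metis absval_diff_le)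
    thus "dist (f m) (f n) < \<epsilon>" using M by simp
  qed
qed

text \<open>A block of consecutive terms is no larger than its largest term, so the partial sums
  belonging to a null sequence are Cauchy.\<close>

lemma summable_ultrametric:
  fixes f :: "nat \<Rightarrow> 'c::{ultrametric_field,complete_space}"
  assumes "f \<longlonglongrightarrow> 0"
  shows "summable f"
proof -
  have "Cauchy (\<lambda>n. sum f {..<n})"
  proof (rule metric_CauchyI)
    fix \<epsilon> :: real assume e: "\<epsilon> > 0"
    have "eventually (\<lambda>n. absval (f n) < \<epsilon> / 2) sequentially"
      using tendsto_absval[OF assms] e by (intro order_tendstoD) auto
    then obtain M where M: "\<And>n. n \<ge> M \<Longrightarrow> absval (f n) < \<epsilon> / 2"
      by (auto simp: eventually_sequentially)
    have *: "absval (sum f {..<n} - sum f {..<M}) \<le> \<epsilon> / 2" if "n \<ge> M" for n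
    proof -
      have "sum f {..<n} - sum f {..<M} = sum f {M..<n}"
        using that by (simp add: sum_diff_nat_ivl[of 0] lessThan_atLeast0)
      also have "absval \<dots> \<le> \<epsilon> / 2" using M e by (intro absval_sum_le) (auto intro: less_imp_le)
      finally show ?thesis .
    qed
    show "\<exists>M. \<forall>m\<ge>M. \<forall>n\<ge>M. dist (sum f {..<m}) (sum f {..<n}) < \<epsilon>"
    proof (intro exI allI impI)
      fix m n assume "m \<ge> M" "n \<ge> M"
      have "sum f {..<m} - sum f {..<n} =
          (sum f {..<m} - sum f {..<M}) - (sum f {..<n} - sum f {..<M})" by simp
      hence "dist (sum f {..<m}) (sum f {..<n}) \<le> \<epsilon> / 2"
        unfolding dist_absval using *[OF \<open>m \<ge> M\<close>] *[OF \<open>n \<ge> M\<close>] by (metis absval_diff_le)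
      thus "dist (sum f {..<m}) (sum f {..<n}) < \<epsilon>" using e by simp
    qed
  qed
  thus ?thesis by (auto simp: summable_iff_convergent Cauchy_convergent)
qed

lemma sums_tendsto_zero:
  fixes f :: "nat \<Rightarrow> 'c::ultrametric_field"
  assumes "f sums s"
  shows "f \<longlonglongrightarrow> 0"
proof -
  have "(\<lambda>n. sum f {..<Suc n} - sum f {..<n}) \<longlonglongrightarrow> s - s"
    using assms unfolding sums_def by (intro tendsto_diff LIMSEQ_Suc)
  thus ?thesis by simp
qed

lemma tendsto_zero_absval_bounded:
  fixes f :: "nat \<Rightarrow> 'c::ultrametric_field"
  assumes "f \<longlonglongrightarrow> 0"
  shows "\<exists>B\<ge>1. \<forall>n. absval (f n) \<le> B"
proof -
  have "Bseq (\<lambda>n. absval (f n))"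
    using tendsto_absval[OF assms] by (intro convergent_imp_Bseq convergentI)
  then obtain K where "\<And>n. \<bar>absval (f n)\<bar> \<le> K" by (auto simp: Bseq_def)
  thus ?thesis by (intro exI[of _ "max 1 K"]) (auto simp: le_max_iff_disj)
qed

lemma sums_mult_ultrametric:
  "f sums s \<Longrightarrow> (\<lambda>n. c * f n) sums (c * s :: 'c::ultrametric_field)"
  by (auto simp: sums_def tendsto_mult simp flip: sum_distrib_left)

text \<open>The square and the triangular partial sums differ by the products with
  \<open>i + j \<ge> N\<close>. One of the two indices is then at least N/2, so one factor is small
  while the other is bounded, and an ultrametric sum is no larger than its largest term.\<close>

lemma Cauchy_product_ultrametric:
  fixes f g :: "nat \<Rightarrow> 'c::ultrametric_field"
  assumes f: "f sums s" and g: "g sums t"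
  shows "(\<lambda>n. \<Sum>i\<le>n. f i * g (n - i)) sums (s * t)"
proof -
  let ?A = "\<lambda>N. (\<Sum>i<N. f i) * (\<Sum>j<N. g j)"
  let ?C = "\<lambda>N. \<Sum>n<N. \<Sum>i\<le>n. f i * g (n - i)"
  obtain B where B: "B \<ge> 1" "\<And>n. absval (f n) \<le> B"
    using tendsto_zero_absval_bounded[OF sums_tendsto_zero[OF f]] by auto
  obtain B' where B': "B' \<ge> 1" "\<And>n. absval (g n) \<le> B'"
    using tendsto_zero_absval_bounded[OF sums_tendsto_zero[OF g]] by auto
  have eq: "?A N - ?C N = (\<Sum>(i,j)\<in>{(i,j). i < N \<and> j < N \<and> i + j \<ge> N}. f i * g j)" for N
  proof -
    have "?C N = (\<Sum>(n,i)\<in>(SIGMA n:{..<N}. {..n}). f i * g (n - i))"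
      by (subst sum.Sigma) auto
    also have "\<dots> = (\<Sum>(i,j)\<in>{(i,j). i + j < N}. f i * g j)"
      by (rule sum.reindex_bij_witness[of _ "\<lambda>(i,j). (i + j, i)" "\<lambda>(n,i). (i, n - i)"]) auto
    finally have C: "?C N = (\<Sum>(i,j)\<in>{(i,j). i + j < N}. f i * g j)" .
    have "?A N = (\<Sum>(i,j)\<in>{..<N} \<times> {..<N}. f i * g j)"
      by (simp add: sum_product sum.cartesian_product)
    also have "\<dots> = (\<Sum>(i,j)\<in>{(i,j). i + j < N}. f i * g j) +
        (\<Sum>(i,j)\<in>{(i,j). i < N \<and> j < N \<and> i + j \<ge> N}. f i * g j)"
    proof (subst sum.union_disjoint [symmetric])
      show "finite {(i, j). i + j < N}"
        by (rule finite_subset[of _ "{..<N} \<times> {..<N}"]) auto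
      show "finite {(i,j). i < N \<and> j < N \<and> i + j \<ge> N}"
        by (rule finite_subset[of _ "{..<N} \<times> {..<N}"]) auto
    qed (auto intro!: sum.cong)
    finally show ?thesis by (simp add: C)
  qed
  have "(\<lambda>N. absval (?C N - ?A N)) \<longlonglongrightarrow> 0"
  proof (rule LIMSEQ_I)
    fix \<epsilon> :: real assume e: "\<epsilon> > 0"
    \<comment> \<open>Chosen so that a factor below \<open>?e\<close> times a factor bounded by
      \<open>max B B'\<close> is at most \<open>\<epsilon> / 2\<close>.\<close>
    let ?e = "\<epsilon> / (2 * max B B')"
    have e': "?e > 0" using e B by auto
    have "eventually (\<lambda>n. absval (f n) < ?e) sequentially"
      using tendsto_absval[OF sums_tendsto_zero[OF f]] e' by (intro order_tendstoD) auto
    moreover have "eventually (\<lambda>n. absval (g n) < ?e) sequentially"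
      using tendsto_absval[OF sums_tendsto_zero[OF g]] e' by (intro order_tendstoD) auto
    ultimately have "eventually (\<lambda>n. absval (f n) < ?e \<and> absval (g n) < ?e) sequentially"
      by eventually_elim auto
    then obtain M where M: "\<And>n. n \<ge> M \<Longrightarrow> absval (f n) < ?e \<and> absval (g n) < ?e"
      by (auto simp: eventually_sequentially)
    show "\<exists>M. \<forall>N\<ge>M. norm (absval (?C N - ?A N) - 0) < \<epsilon>"
    proof (intro exI allI impI)
      fix N assume N: "N \<ge> 2 * M"
      have "absval (?A N - ?C N) \<le> \<epsilon> / 2"
        unfolding eq
      proof (intro absval_sum_le)
        fix p assume "p \<in> {(i,j). i < N \<and> j < N \<and> i + j \<ge> N}"
        then obtain i j where p: "p = (i, j)" "i + j \<ge> N" by auto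
        with N have "i \<ge> M \<or> j \<ge> M" by linarith
        moreover have "absval (f i) \<le> max B B'" "absval (g j) \<le> max B B'"
          using B(2)[of i] B'(2)[of j] by auto
        ultimately have "absval (f i) * absval (g j) \<le> max B B' * ?e"
        proof (elim disjE)
          assume "i \<ge> M"
          hence "absval (g j) * absval (f i) \<le> max B B' * ?e"
            using M[of i] \<open>absval (g j) \<le> max B B'\<close> e' B by (intro mult_mono) auto
          thus ?thesis by (simp add: mult.commute)
        next
          assume "j \<ge> M"
          thus ?thesis
            using M[of j] \<open>absval (f i) \<le> max B B'\<close> e' B by (intro mult_mono) auto
        qed
        also have "max B B' * ?e = \<epsilon> / 2" using B by auto
        finally show "absval (case p of (i, j) \<Rightarrow> f i * g j) \<le> \<epsilon> / 2"
          by (simp add: p absval_mult)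
      qed (use e in auto)
      thus "norm (absval (?C N - ?A N) - 0) < \<epsilon>"
        using e by (simp add: absval_diff_commute)
    qed
  qed
  hence "(\<lambda>N. ?C N - ?A N) \<longlonglongrightarrow> 0" by (subst tendsto_absval_iff) simp
  moreover have "?A \<longlonglongrightarrow> s * t"
    using f g unfolding sums_def by (rule tendsto_mult)
  ultimately have "(\<lambda>N. (?C N - ?A N) + ?A N) \<longlonglongrightarrow> 0 + s * t" by (rule tendsto_add)
  thus ?thesis by (simp add: sums_def)
qed

section \<open>Power series over ultrametric fields\<close>

lemma absval_le_0_iff [simp]: "absval (x :: 'c::ultrametric_field) \<le> 0 \<longleftrightarrow> x = 0"
  using absval_nonneg[of x] absval_eq_0_iff[of x] by linarith

text \<open>Interpolation at nodes with mutual distances 1 divides only by units, so a bound on more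
  values than the degree passes to the coefficients. The induction splits off one node by synthetic
  division.\<close>

lemma poly_coeff_le_if_values_le:
  fixes p :: "'c::ultrametric_field poly"
  assumes "\<And>x. x \<in> set xs \<Longrightarrow> absval x \<le> 1" "distinct xs"
    and "\<And>x y. x \<in> set xs \<Longrightarrow> y \<in> set xs \<Longrightarrow> x \<noteq> y \<Longrightarrow> absval (x - y) = 1"
    and "\<And>x. x \<in> set xs \<Longrightarrow> absval (poly p x) \<le> M"
    and "p = 0 \<or> degree p < length xs" and "M \<ge> 0"
  shows "absval (coeff p i) \<le> M"
  using assms
proof (induction xs arbitrary: p i)
  case (Cons x xs)
  define p1 where "p1 = synthetic_div p x"
  have p: "p = [:poly p x:] + [:- x, 1:] * p1"
    using synthetic_div_correct'[of x p] by (simp add: p1_def add.commute)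
  have deg: "p1 = 0 \<or> degree p1 < length xs"
    using Cons.prems(5) by (auto simp: p1_def degree_synthetic_div synthetic_div_eq_0_iff)
  have "absval (poly p1 y) \<le> M" if y: "y \<in> set xs" for y
  proof -
    have "x \<noteq> y" using Cons.prems(2) y by auto
    hence "absval (y - x) = 1" using Cons.prems(3)[of y x] y by auto
    moreover have "poly p y - poly p x = (y - x) * poly p1 y"
      by (subst (1) p) (simp add: algebra_simps)
    ultimately have "absval (poly p1 y) = absval (poly p y - poly p x)"
      by (simp add: absval_mult)
    thus ?thesis using Cons.prems(4) y by (auto intro: absval_diff_le)
  qed
  hence IH: "absval (coeff p1 i) \<le> M" for i
    using Cons.prems deg by (intro Cons.IH) auto
  have x: "absval (x * coeff p1 j) \<le> M" for j
    using mult_mono[of "absval x" 1 "absval (coeff p1 j)" M] Cons.prems(1)[of x] IH[of j]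
    by (simp add: absval_mult)
  show ?case
  proof (cases i)
    case 0
    have "coeff p 0 = poly p x - x * coeff p1 0" by (subst p) simp
    thus ?thesis using 0 x Cons.prems(4)[of x] by (auto intro: absval_diff_le)
  next
    case (Suc j)
    have "coeff p (Suc j) = coeff p1 j - x * coeff p1 (Suc j)" by (subst p) simp
    thus ?thesis using Suc x IH by (auto intro: absval_diff_le)
  qed
qed auto

text \<open>The residue field of an algebraically closed ultrametric field is infinite.\<close>

lemma ex_list_absval_diff_one:
  "\<exists>xs. length xs = n \<and> distinct xs \<and> (\<forall>x\<in>set xs. absval x \<le> 1) \<and>
     (\<forall>x\<in>set xs. \<forall>y\<in>set xs. x \<noteq> y \<longrightarrow> absval (x - y :: 'c::{ultrametric_field,alg_closed_field}) = 1)"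
proof (induction n)
  case (Suc n)
  then obtain xs :: "'c list" where xs': "length xs = n" "distinct xs" "\<forall>x\<in>set xs. absval x \<le> 1"
    "\<forall>x\<in>set xs. \<forall>y\<in>set xs. x \<noteq> y \<longrightarrow> absval (x - y) = 1"
    by (elim exE conjE)
  note xs = xs'(1,2) xs'(3)[THEN bspec] xs'(4)[rule_format]
  \<comment> \<open>A root x of \<open>P - 1\<close> is a suitable new point: the factors
    \<open>x - s\<close> have absolute value at most 1 and product 1, hence each has absolute value
    1. The point 0 keeps S nonempty, so that \<open>P - 1\<close> is not constant.\<close>
  define S where "S = insert 0 (set xs)"
  define P where "P = (\<Prod>s\<in>S. [:- s, 1:])"
  have S: "finite S" "S \<noteq> {}" "\<And>s. s \<in> S \<Longrightarrow> absval s \<le> 1" using xs by (auto simp: S_def)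
  have "degree P = card S" unfolding P_def by (subst degree_prod_eq_sum_degree) auto
  hence "degree (P - 1) > 0"
    using S(1,2) degree_add_eq_left[of "- 1" P] by (simp add: card_gt_0_iff)
  then obtain x where "poly (P - 1) x = 0" using alg_closed_imp_poly_has_root by blast
  hence "(\<Prod>s\<in>S. x - s) = 1" by (simp add: P_def poly_prod)
  hence prod: "(\<Prod>s\<in>S. absval (x - s)) = 1" by (simp flip: absval_prod)
  have x: "absval x \<le> 1"
  proof (rule ccontr)
    assume "\<not> absval x \<le> 1"
    hence x: "absval x > 1" by simp
    have "absval (x - s) = absval x" if "s \<in> S" for s
      using S(3)[OF that] x by (intro absval_eq_if_diff_less) simp
    hence "(\<Prod>s\<in>S. absval (x - s)) = absval x ^ card S" by simp
    also have "\<dots> > 1" using x S by (simp add: one_less_power card_gt_0_iff)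
    finally show False using prod by simp
  qed
  have one: "absval (x - s) = 1" if s: "s \<in> S" for s
  proof -
    have le: "absval (x - s) \<le> 1" if "s \<in> S" for s
      using x S(3)[OF that] by (rule absval_diff_le)
    have "(\<Prod>s\<in>S. absval (x - s)) = absval (x - s) * (\<Prod>s\<in>S - {s}. absval (x - s))"
      using S(1) s by (rule prod.remove)
    also have "\<dots> \<le> absval (x - s) * 1"
      using le by (intro mult_left_mono prod_le_1) auto
    finally show ?thesis using prod le[OF s] by simp
  qed
  have "x \<notin> S" using one[of x] by auto
  thus ?case
  proof (intro exI[of _ "x # xs"] conjI ballI impI)
    fix y z assume yz: "y \<in> set (x # xs)" "z \<in> set (x # xs)" "y \<noteq> z"
    consider "y = x" "z \<in> set xs" | "z = x" "y \<in> set xs" | "y \<in> set xs" "z \<in> set xs"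
      using yz by auto
    thus "absval (y - z) = 1"
    proof cases
      case 2
      thus ?thesis using one[of y] by (subst absval_diff_commute) (simp add: S_def)
    qed (use yz one[of z] xs(4) in \<open>simp_all add: S_def\<close>)
  qed (use xs x in \<open>auto simp: S_def\<close>)
qed simp

text \<open>The nonarchimedean Cauchy estimate. After the substitution X -> rX the bound holds on
  the unit disc, which contains as many interpolation nodes at mutual distance 1 as the degree
  demands.\<close>

lemma poly_coeff_Cauchy_estimate:
  fixes p :: "'c::{ultrametric_field,alg_closed_field} poly"
  assumes "\<And>v. absval v \<le> absval r \<Longrightarrow> absval (poly p v) \<le> M"
  shows "absval (coeff p i * r ^ i) \<le> M"
proof -
  obtain xs :: "'c list" where xs': "length xs = Suc (degree p)" "distinct xs"
    "\<forall>x\<in>set xs. absval x \<le> 1"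
    "\<forall>x\<in>set xs. \<forall>y\<in>set xs. x \<noteq> y \<longrightarrow> absval (x - y) = 1"
    using ex_list_absval_diff_one[of "Suc (degree p)"] by (elim exE conjE)
  note xs = xs'(1,2) xs'(3)[THEN bspec] xs'(4)[rule_format]
  have M: "M \<ge> 0" using order_trans[OF absval_nonneg assms[of 0]] by simp
  have "absval (coeff (pcompose p [:0, r:]) i) \<le> M"
  proof (rule poly_coeff_le_if_values_le[OF xs(3,2,4)])
    show "absval (poly (pcompose p [:0, r:]) x) \<le> M" if "x \<in> set xs" for x
      using assms[of "r * x"] xs(3)[OF that]
      by (simp add: poly_pcompose absval_mult mult_left_le mult.commute[of x])
    show "pcompose p [:0, r:] = 0 \<or> degree (pcompose p [:0, r:]) < length xs"
      using xs(1) degree_pcompose_le[of p "[:0, r:]"] by (auto split: if_splits)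
  qed (use M in auto)
  thus ?thesis by (simp add: coeff_pcompose_linear mult.commute)
qed

text \<open>The first nonzero term of the series would equal minus the tail behind it, but the tail
  is smaller by a factor of order |t j|, which tends to 0.\<close>

lemma power_series_zero_unique:
  fixes D :: "nat \<Rightarrow> 'c::ultrametric_field"
  assumes t: "t \<longlonglongrightarrow> 0" "\<And>j::nat. t j \<noteq> 0"
    and D: "\<And>j. (\<lambda>n. D n * t j ^ n) sums 0"
  shows "D m = 0"
proof (induction m rule: less_induct)
  case (less m)
  obtain B where B: "B \<ge> 1" "\<And>n. absval (D n * t 0 ^ n) \<le> B"
    using tendsto_zero_absval_bounded[OF sums_tendsto_zero[OF D[of 0]]] by auto
  have "absval (D m) * absval (t 0) ^ Suc m \<le> B * absval (t j)"
    if j: "absval (t j) \<le> absval (t 0)" for j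
  proof -
    define c where "c = absval (t j) / absval (t 0)"
    have c: "0 \<le> c" "c \<le> 1" using j t(2) by (auto simp: c_def divide_le_eq_1)
    \<comment> \<open>Subtracting the m-th term leaves a series whose terms up to m vanish, by the
      induction hypothesis and by cancellation. Only the tail contributes to the bound, and it is
      compared with the terms at \<open>t 0\<close>.\<close>
    have "(\<lambda>n. D n * t j ^ n + (if n = m then - (D m * t j ^ m) else 0)) sums (0 + - (D m * t j ^ m))"
      by (intro sums_add D sums_single)
    hence "(\<lambda>n. D n * t j ^ n + (if n = m then - (D m * t j ^ m) else 0)) sums (- (D m * t j ^ m))"
      by simp
    hence "absval (- (D m * t j ^ m)) \<le> B * c ^ Suc m"
    proof (rule sums_absval_le)
      fix n
      show "absval (D n * t j ^ n + (if n = m then - (D m * t j ^ m) else 0)) \<le> B * c ^ Suc m"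
      proof (cases "n > m")
        case True
        have "absval (D n * t j ^ n) = absval (D n * t 0 ^ n) * c ^ n"
          using t(2)[of 0] by (simp add: absval_mult absval_power c_def power_divide)
        also have "\<dots> \<le> B * c ^ Suc m"
          using B c True by (intro mult_mono power_decreasing) auto
        finally show ?thesis using True by simp
      next
        case False
        thus ?thesis using less c B by (cases "n = m") auto
      qed
    qed
    hence "absval (D m) * absval (t j) ^ m \<le> B * (absval (t j) ^ Suc m / absval (t 0) ^ Suc m)"
      by (simp add: absval_mult absval_power c_def power_divide)
    also have "B * (absval (t j) ^ Suc m / absval (t 0) ^ Suc m) =
        (B * absval (t j) / absval (t 0) ^ Suc m) * absval (t j) ^ m" by simp
    finally have "absval (D m) \<le> B * absval (t j) / absval (t 0) ^ Suc m"
      using t(2)[of j] by (simp only: mult_le_cancel_right_pos zero_less_power absval_pos_iff not_False_eq_True)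
    thus ?thesis using t(2)[of 0]
      by (simp only: pos_le_divide_eq zero_less_power absval_pos_iff not_False_eq_True)
  qed
  moreover have "eventually (\<lambda>j. absval (t j) < absval (t 0)) sequentially"
    using tendsto_absval[OF t(1)] t(2)[of 0] by (intro order_tendstoD) auto
  ultimately have "eventually (\<lambda>j. absval (D m) * absval (t 0) ^ Suc m \<le> B * absval (t j)) sequentially"
    by (auto elim!: eventually_mono)
  moreover have "(\<lambda>j. B * absval (t j)) \<longlonglongrightarrow> B * 0"
    using tendsto_absval[OF t(1)] by (intro tendsto_intros) auto
  ultimately have "absval (D m) * absval (t 0) ^ Suc m \<le> B * 0"
    by (intro tendsto_lowerbound) auto
  hence "absval (D m * t 0 ^ Suc m) \<le> 0" by (simp only: absval_mult absval_power mult_zero_right)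
  hence "D m * t 0 ^ Suc m = 0" by (simp only: absval_le_0_iff)
  thus ?case using t(2)[of 0] by simp
qed

lemma power_series_unique:
  fixes F G :: "'c::ultrametric_field fps"
  assumes t: "t \<longlonglongrightarrow> 0" "\<And>j::nat. t j \<noteq> 0"
    and F: "\<And>j. (\<lambda>n. fps_nth F n * t j ^ n) sums s j"
    and G: "\<And>j. (\<lambda>n. fps_nth G n * t j ^ n) sums s j"
  shows "F = G"
proof (rule fps_ext)
  fix n
  have "fps_nth F n + - fps_nth G n = 0"
  proof (rule power_series_zero_unique[OF t])
    fix j
    have "(\<lambda>n. fps_nth F n * t j ^ n + - (fps_nth G n * t j ^ n)) sums (s j + - s j)"
      using sums_mult_ultrametric[OF G[of j], of "- 1"] by (intro sums_add F) simp
    thus "(\<lambda>n. (fps_nth F n + - fps_nth G n) * t j ^ n) sums 0"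
      by (simp add: left_diff_distrib)
  qed
  thus "fps_nth F n = fps_nth G n" by simp
qed

lemma fps_X_power_sums: "(\<lambda>m. fps_nth (fps_X ^ n) m * t ^ m) sums (t ^ n :: 'c::ultrametric_field)"
proof -
  have "(\<lambda>m. if m = n then t ^ m else 0) sums (t ^ n)" by (rule sums_single)
  moreover have "(\<lambda>m. if m = n then t ^ m else 0) = (\<lambda>m. fps_nth (fps_X ^ n) m * t ^ m)"
    by (rule ext) (simp add: fps_X_power_nth)
  ultimately show ?thesis by simp
qed

lemma fps_mult_sums:
  fixes F G :: "'c::ultrametric_field fps"
  assumes "(\<lambda>n. fps_nth F n * t ^ n) sums s" "(\<lambda>n. fps_nth G n * t ^ n) sums s'"
  shows "(\<lambda>n. fps_nth (F * G) n * t ^ n) sums (s * s')"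
proof -
  have "(\<lambda>n. \<Sum>i\<le>n. (fps_nth F i * t ^ i) * (fps_nth G (n - i) * t ^ (n - i))) sums (s * s')"
    using assms by (rule Cauchy_product_ultrametric)
  moreover have "(\<Sum>i\<le>n. (fps_nth F i * t ^ i) * (fps_nth G (n - i) * t ^ (n - i))) =
      fps_nth (F * G) n * t ^ n" for n
    unfolding fps_mult_nth sum_distrib_right atLeast0AtMost
    by (rule sum.cong) (auto simp: mult_ac simp flip: power_add)
  ultimately show ?thesis by simp
qed

hide_const (open) Module.smult

section \<open>Norms of polynomials modulo a monic polynomial\<close>

lemma degree_prod_list_linear:
  "degree (\<Prod>y\<leftarrow>ys. [:- y, 1 :: 's::field:]) = length ys"
  "lead_coeff (\<Prod>y\<leftarrow>ys. [:- y, 1 :: 's::field:]) = 1"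
proof -
  have "(\<Prod>y\<leftarrow>ys. [:- y, 1 :: 's:]) \<noteq> 0 \<and> degree (\<Prod>y\<leftarrow>ys. [:- y, 1 :: 's:]) = length ys \<and>
      lead_coeff (\<Prod>y\<leftarrow>ys. [:- y, 1 :: 's:]) = 1"
  proof (induction ys)
    case (Cons y ys)
    hence "degree ([:- y, 1:] * (\<Prod>y\<leftarrow>ys. [:- y, 1 :: 's:])) = Suc (length ys)"
      by (subst degree_mult_eq) auto
    moreover have "lead_coeff ([:- y, 1:] * (\<Prod>y\<leftarrow>ys. [:- y, 1 :: 's:])) = 1"
      using conjunct2[OF conjunct2[OF Cons]] by (subst lead_coeff_mult) simp
    ultimately show ?case using Cons by (auto simp del: mult_pCons_left)
  qed simp
  thus "degree (\<Prod>y\<leftarrow>ys. [:- y, 1 :: 's::field:]) = length ys"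
    "lead_coeff (\<Prod>y\<leftarrow>ys. [:- y, 1 :: 's::field:]) = 1" by blast+
qed

text \<open>
  Multiplication by \<open>g\<close> is triangular with respect to the Newton basis
  \<open>\<Prod>\<^sub>m\<^sub><\<^sub>i (X - y\<^sub>m)\<close> of the polynomials modulo \<open>\<Prod>\<^sub>m (X - y\<^sub>m)\<close>.
\<close>

lemma newton_basis_mult:
  fixes ys :: "'s::field list" and g :: "'s poly"
  defines "N \<equiv> \<lambda>i. \<Prod>y\<leftarrow>take i ys. [:- y, 1:]"
  assumes "i \<le> length ys"
  shows "\<exists>l. (\<forall>j<i. l j = 0) \<and> (i < length ys \<longrightarrow> l i = poly g (ys ! i)) \<and>
    N (length ys) dvd g * N i - (\<Sum>j<length ys. smult (l j) (N j))"
  using assms(2)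
proof (induction i arbitrary: g rule: inc_induct)
  case base
  show ?case by (intro exI[of _ "\<lambda>_. 0"]) simp
next
  case (step i)
  let ?y = "ys ! i"
  \<comment> \<open>Multiplied by \<open>N i\<close>, this reads \<open>poly g ?y\<close> times
    \<open>N i\<close> plus \<open>synthetic_div g ?y * N (Suc i)\<close>: the first part is the
    diagonal entry, the second is covered by the downward induction.\<close>
  have g: "g = [:poly g ?y:] + [:- ?y, 1:] * synthetic_div g ?y"
    using synthetic_div_correct'[of ?y g] by (simp add: add.commute)
  have N: "N (Suc i) = N i * [:- ?y, 1:]"
    using step by (simp add: N_def take_Suc_conv_app_nth del: mult_pCons_right)
  obtain l where l: "\<forall>j<Suc i. l j = 0"
    "N (length ys) dvd synthetic_div g ?y * N (Suc i) - (\<Sum>j<length ys. smult (l j) (N j))"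
    using step.IH by blast
  define l' where "l' = l(i := poly g ?y)"
  have "(\<Sum>j<length ys. smult (l' j) (N j)) =
      (\<Sum>j<length ys. smult (l j) (N j) + (if j = i then smult (poly g ?y) (N i) else 0))"
    using l(1) by (intro sum.cong) (auto simp: l'_def)
  also have "\<dots> = (\<Sum>j<length ys. smult (l j) (N j)) + smult (poly g ?y) (N i)"
    using step by (subst sum.distrib) (simp add: sum.delta)
  finally have "g * N i - (\<Sum>j<length ys. smult (l' j) (N j)) =
      synthetic_div g ?y * N (Suc i) - (\<Sum>j<length ys. smult (l j) (N j))"
    by (subst g) (simp add: N algebra_simps)
  thus ?case using l by (intro exI[of _ l']) (auto simp: l'_def)
qed

text \<open>The witness is the determinant of multiplication by h on the polynomials modulo P. It is
  fixed before \<open>\<phi>\<close> is chosen, so a single element of the base ring specialises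
  correctly under every homomorphism, also where the roots of P become multiple.\<close>

lemma ex_poly_norm:
  fixes P h :: "'r::comm_ring_1 poly"
  assumes P: "lead_coeff P = 1"
  shows "\<exists>n. \<forall>(\<phi> :: 'r \<Rightarrow> 's::field) ys. comm_ring_hom \<phi> \<longrightarrow>
    map_poly \<phi> P = (\<Prod>y\<leftarrow>ys. [:- y, 1:]) \<longrightarrow> \<phi> n = (\<Prod>y\<leftarrow>ys. poly (map_poly \<phi> h) y)"
proof -
  define Q where "Q = degree P"
  have "P \<noteq> 0" using P by auto
  \<comment> \<open>Over a mere commutative ring, division with remainder is pseudo-division by the
    monic P.\<close>
  have "\<exists>q r. h * monom 1 k = P * q + r \<and> (r = 0 \<or> degree r < Q)" for k
  proof -
    obtain q r where qr: "pseudo_divmod (h * monom 1 k) P = (q, r)" by force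
    show ?thesis
      using pseudo_divmod[OF \<open>P \<noteq> 0\<close> qr] P unfolding Q_def by auto
  qed
  then obtain q r where qr: "\<And>k. h * monom 1 k = P * q k + r k"
    "\<And>k. r k = 0 \<or> degree (r k) < Q" by metis
  define M where "M = mat Q Q (\<lambda>(i,j). coeff (r j) i)"
  show ?thesis
  proof (intro exI[of _ "Determinant.det M"] allI impI)
    fix \<phi> :: "'r \<Rightarrow> 's" and ys
    assume "comm_ring_hom \<phi>" and \<phi>P: "map_poly \<phi> P = (\<Prod>y\<leftarrow>ys. [:- y, 1:])"
    interpret comm_ring_hom \<phi> by fact
    interpret map_poly_hom: map_poly_comm_ring_hom \<phi> ..
    define N where "N i = (\<Prod>y\<leftarrow>take i ys. [:- y, 1:])" for i
    let ?H = "map_poly \<phi> h" and ?P = "map_poly \<phi> P"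
    have Q: "length ys = Q"
    proof -
      have "degree ?P = Q"
        unfolding Q_def using P \<open>P \<noteq> 0\<close> by (intro degree_map_poly) simp
      thus ?thesis using \<phi>P by (simp add: degree_prod_list_linear)
    qed
    have NQ: "N Q = ?P" by (simp add: N_def \<phi>P flip: Q)
    have degN: "degree (N i) = i" and lcN: "coeff (N i) i = 1" if "i \<le> Q" for i
      using degree_prod_list_linear[of "take i ys"] that Q by (auto simp: N_def)
    have "\<forall>i<Q. \<exists>l. (\<forall>j<i. l j = 0) \<and> l i = poly ?H (ys ! i) \<and>
        ?P dvd ?H * N i - (\<Sum>j<Q. smult (l j) (N j))"
    proof (intro allI impI)
      fix i assume "i < Q"
      thus "\<exists>l. (\<forall>j<i. l j = 0) \<and> l i = poly ?H (ys ! i) \<and>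
          ?P dvd ?H * N i - (\<Sum>j<Q. smult (l j) (N j))"
        using newton_basis_mult[of i ys ?H] Q NQ unfolding N_def by auto
    qed
    then obtain l where l: "\<And>i j. i < Q \<Longrightarrow> j < i \<Longrightarrow> l i j = 0"
      "\<And>i. i < Q \<Longrightarrow> l i i = poly ?H (ys ! i)"
      "\<And>i. i < Q \<Longrightarrow> ?P dvd ?H * N i - (\<Sum>j<Q. smult (l i j) (N j))"
      by metis
    define W where "W = mat Q Q (\<lambda>(k,i). coeff (N i) k)"
    define L where "L = mat Q Q (\<lambda>(j,i). l i j)"
    have WC: "W \<in> carrier_mat Q Q" and LC: "L \<in> carrier_mat Q Q" and MC: "M \<in> carrier_mat Q Q"
      by (auto simp: W_def L_def M_def)
    \<comment> \<open>The columns of W are the Newton basis in monomial coordinates, while M and L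
      describe multiplication by h in the monomial and the Newton basis. Column i of either side
      represents \<open>h * N i\<close> modulo P, and representatives of degree below Q are
      unique.\<close>
    have "map_mat \<phi> M * W = W * L"
    proof (rule eq_matI)
      fix m i assume "m < dim_row (W * L)" "i < dim_col (W * L)"
      hence mi: "m < Q" "i < Q" by (auto simp: W_def L_def)
      define A where "A = (\<Sum>k<Q. smult (coeff (N i) k) (map_poly \<phi> (r k)))"
      define B where "B = (\<Sum>j<Q. smult (l i j) (N j))"
      have N_sum: "N i = (\<Sum>k<Q. monom (coeff (N i) k) k)"
      proof -
        have "N i = (\<Sum>k\<le>degree (N i). monom (coeff (N i) k) k)" by (simp add: poly_as_sum_of_monoms)
        also have "\<dots> = (\<Sum>k<Q. monom (coeff (N i) k) k)"
          using degN[of i] mi by (intro sum.mono_neutral_left) (auto simp: coeff_eq_0)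
        finally show ?thesis .
      qed
      have "?H * N i - A = (\<Sum>k<Q. smult (coeff (N i) k) (?H * monom 1 k - map_poly \<phi> (r k)))"
        unfolding A_def
        by (subst N_sum) (simp add: sum_distrib_left sum_subtractf smult_diff_right smult_monom
              flip: mult_smult_right)
      also have "?P dvd \<dots>"
      proof (intro dvd_sum dvd_smult)
        fix k
        have "map_poly \<phi> (h * monom 1 k) = map_poly \<phi> (P * q k + r k)" by (simp only: qr(1))
        hence "?H * monom 1 k - map_poly \<phi> (r k) = ?P * map_poly \<phi> (q k)"
          by (simp add: map_poly_hom.hom_mult map_poly_hom.hom_add)
        thus "?P dvd ?H * monom 1 k - map_poly \<phi> (r k)" by simp
      qed
      finally have "?P dvd (?H * N i - B) - (?H * N i - A)"
        using l(3)[OF mi(2)] dvd_diff unfolding B_def by blast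
      hence dvd: "?P dvd A - B" by simp
      have "degree (A - B) < Q"
      proof (rule le_less_trans)
        show "degree (A - B) \<le> Q - 1"
          unfolding A_def B_def
        proof (intro degree_diff_le degree_sum_le)
          fix k assume k: "k \<in> {..<Q}"
          have "degree (map_poly \<phi> (r k)) \<le> degree (r k)" by (rule degree_map_poly_le)
          thus "degree (smult (coeff (N i) k) (map_poly \<phi> (r k))) \<le> Q - 1"
            using qr(2)[of k] degree_smult_le[of "coeff (N i) k" "map_poly \<phi> (r k)"] by auto
          show "degree (smult (l i k) (N k)) \<le> Q - 1"
            using degree_smult_le[of "l i k" "N k"] degN[of k] k by auto
        qed auto
      qed (use mi in auto)
      moreover have "degree ?P = Q" using degN[of Q] NQ by simp
      ultimately have "A - B = 0" using dvd_imp_degree_le[OF dvd] by auto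
      hence "coeff A m = coeff B m" by simp
      thus "(map_mat \<phi> M * W) $$ (m, i) = (W * L) $$ (m, i)"
        using mi by (simp add: M_def W_def L_def A_def B_def scalar_prod_def coeff_sum
            lessThan_atLeast0 mult.commute)
    qed (auto simp: M_def W_def L_def)
    hence "Determinant.det (map_mat \<phi> M) * Determinant.det W = Determinant.det W * Determinant.det L"
      using WC LC MC by (metis Determinant.det_mult map_carrier_mat)
    moreover have "Determinant.det W = 1"
    proof -
      have "Determinant.det W = prod_list (diag_mat W)"
        by (rule det_upper_triangular[OF _ WC])
          (auto simp: W_def upper_triangular_def degN intro!: coeff_eq_0)
      thus ?thesis using lcN by (simp add: prod_list_diag_prod W_def)
    qed
    moreover have "Determinant.det L = (\<Prod>y\<leftarrow>ys. poly ?H y)"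
    proof -
      have "Determinant.det L = prod_list (diag_mat L)"
        by (rule det_lower_triangular[OF _ LC]) (auto simp: L_def l(1))
      also have "\<dots> = (\<Prod>i<Q. poly ?H (ys ! i))"
        by (simp add: prod_list_diag_prod L_def l(2) lessThan_atLeast0)
      also have "\<dots> = (\<Prod>y\<leftarrow>ys. poly ?H y)"
        by (simp add: prod.list_conv_set_nth Q lessThan_atLeast0)
      finally show ?thesis .
    qed
    ultimately show "\<phi> (Determinant.det M) = (\<Prod>y\<leftarrow>ys. poly ?H y)" by simp
  qed
qed

section \<open>The embedding of the polynomial ring\<close>

lemma monic_eq_prod_roots:
  fixes P :: "'s::field poly"
  assumes "lead_coeff P = 1" "finite S" "card S = degree P" "\<And>s. s \<in> S \<Longrightarrow> poly P s = 0"
  shows "P = (\<Prod>s\<in>S. [:- s, 1:])"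
proof -
  let ?R = "\<Prod>s\<in>S. [:- s, 1:]"
  have deg: "degree ?R = degree P"
    using assms(3) by (subst degree_prod_eq_sum_degree) auto
  have lc: "lead_coeff ?R = 1" by (subst lead_coeff_prod) simp
  show ?thesis
  proof (rule ccontr)
    assume "P \<noteq> ?R"
    hence nz: "P - ?R \<noteq> 0" by simp
    have "degree (P - ?R) \<le> degree P" using deg by (intro degree_diff_le) auto
    moreover have "coeff (P - ?R) (degree P) = 0" using assms(1) lc deg by simp
    ultimately have "degree (P - ?R) < degree P"
      using nz by (metis le_neq_implies_less leading_coeff_0_iff)
    moreover have "S \<subseteq> {x. poly (P - ?R) x = 0}"
      using assms(2,4) by (auto simp: poly_prod)
    hence "card S \<le> degree (P - ?R)"
      using poly_roots_finite[OF nz] poly_roots_degree[OF nz] by (meson card_mono le_trans)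
    ultimately show False using assms(3) by simp
  qed
qed

text \<open>With P the product of the X - l, the polynomial P(X + y) - P(X) - P(y) has degree below
  \<open>card V\<close>, since the leading terms cancel, and vanishes on V, since V is closed under
  translation by its elements. Applied to finite pieces of the lattice and to the constants.\<close>

lemma additive_prod_subgroup:
  fixes V :: "'s::field set"
  assumes V: "finite V" "0 \<in> V" "\<And>x y. x \<in> V \<Longrightarrow> y \<in> V \<Longrightarrow> x - y \<in> V"
  shows "(\<Prod>l\<in>V. (x + y) - l) = (\<Prod>l\<in>V. x - l) + (\<Prod>l\<in>V. y - l)"
proof -
  define P where "P = (\<Prod>l\<in>V. [:- l, 1:])"
  have P: "poly P z = (\<Prod>l\<in>V. z - l)" for z by (simp add: P_def poly_prod)
  have degP: "degree P = card V" unfolding P_def by (subst degree_prod_eq_sum_degree) auto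
  have lcP: "lead_coeff P = 1" unfolding P_def by (subst lead_coeff_prod) simp
  have card: "card V > 0" using V by (auto simp: card_gt_0_iff)
  define D where "D = pcompose P [:y, 1:] - P - [:poly P y:]"
  have "D = 0"
  proof (rule ccontr)
    assume nz: "D \<noteq> 0"
    have "degree D \<le> card V" unfolding D_def
      by (intro degree_diff_le) (auto simp: degP)
    moreover have "coeff D (card V) = 0"
    proof -
      have "lead_coeff (pcompose P [:y, 1:]) = 1" by (subst lead_coeff_comp) (simp_all add: lcP)
      hence "coeff (pcompose P [:y, 1:]) (card V) = 1" by (simp add: degP)
      moreover have "coeff [:poly P y:] (card V) = 0" using card by (simp add: coeff_eq_0)
      ultimately show ?thesis using lcP by (simp add: D_def degP)
    qed
    ultimately have "degree D < card V"
      using nz by (metis le_neq_implies_less leading_coeff_0_iff)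
    moreover have "V \<subseteq> {x. poly D x = 0}"
    proof
      fix l assume l: "l \<in> V"
      have neg: "- v \<in> V" if "v \<in> V" for v using V(3)[OF V(2) that] by simp
      have "poly P (y + l) = poly P y"
        unfolding P
      proof (rule prod.reindex_bij_witness[of _ "\<lambda>v. v + l" "\<lambda>v. v - l"])
        show "a + l \<in> V" if "a \<in> V" for a using V(3)[OF that neg[OF l]] by simp
      qed (use V(3) l in \<open>auto simp: algebra_simps\<close>)
      moreover have "poly P l = 0" unfolding P using V(1) l by auto
      ultimately show "l \<in> {x. poly D x = 0}" by (simp add: D_def poly_pcompose)
    qed
    hence "card V \<le> degree D"
      using poly_roots_finite[OF nz] poly_roots_degree[OF nz] by (meson card_mono le_trans)
    ultimately show False by simp
  qed
  hence "poly D x = 0" by simp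
  thus ?thesis by (simp add: D_def poly_pcompose P algebra_simps)
qed

section \<open>The ring A inside C\<close>

context C_infinity
begin

lemma q_gt_1: "CARD('a) > 1"
  using card_mono[of "UNIV :: 'a set" "{0, 1}"] by (simp add: numeral_2_eq_2)

sublocale emb: comm_ring_hom \<iota>
proof
  have "\<iota> 0 + \<iota> 0 = \<iota> 0 + 0" by (simp flip: emb_add)
  thus "\<iota> 0 = 0" by (simp only: add_left_cancel)
qed (simp_all add: emb_one emb_add emb_mult)

lemma emb_eq_0_iff [simp]: "\<iota> x = 0 \<longleftrightarrow> x = 0"
proof
  assume "\<iota> x = 0"
  hence "\<not> absval (\<iota> x) > 0" by simp
  moreover have "real CARD('a) powi n > 0" for n using q_gt_1 by simp
  ultimately show "x = 0" using absval_emb[of x] by (cases "x = 0") (simp_all del: absval_pos_iff)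
qed simp

lemma emb_inverse: "\<iota> (inverse x) = inverse (\<iota> x)"
proof (cases "x = 0")
  case False
  have "\<iota> x * \<iota> (inverse x) = 1" using False by (simp flip: emb_mult)
  thus ?thesis using inverse_unique[of "\<iota> x" "\<iota> (inverse x)"] by simp
qed simp

lemma emb_divide: "\<iota> (x / y) = \<iota> x / \<iota> y"
  by (simp add: divide_inverse emb_mult emb_inverse)

text \<open>Evaluation of T at an arbitrary point of C. At \<open>\<iota> fls_X_inv\<close> it is
  the inclusion of A; at a root of \<pi> it is reduction modulo \<pi>.\<close>

definition eval_A :: "'c \<Rightarrow> 'a poly \<Rightarrow> 'c" where
  "eval_A \<theta> a = poly (map_poly (\<lambda>c. \<iota> (fls_const c)) a) \<theta>"

lemma const_hom: "comm_ring_hom (\<lambda>c. \<iota> (fls_const c))"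
  by standard (simp_all add: emb_add emb_mult flip: fls_plus_const fls_const_mult_const)

lemma eval_A_hom: "comm_ring_hom (eval_A \<theta>)"
proof -
  interpret c: comm_ring_hom "\<lambda>c. \<iota> (fls_const c)" by (rule const_hom)
  interpret m: map_poly_comm_ring_hom "\<lambda>c. \<iota> (fls_const c)" ..
  show ?thesis by standard (simp_all add: eval_A_def m.hom_add m.hom_mult)
qed

lemma eval_A_const [simp]: "eval_A \<theta> [:c:] = \<iota> (fls_const c)"
  and eval_A_X [simp]: "eval_A \<theta> [:0, 1:] = \<theta>"
proof -
  interpret c: comm_ring_hom "\<lambda>c. \<iota> (fls_const c)" by (rule const_hom)
  show "eval_A \<theta> [:c:] = \<iota> (fls_const c)" "eval_A \<theta> [:0, 1:] = \<theta>"
    by (simp_all add: eval_A_def c.map_poly_pCons_hom)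
qed

lemma fls_of_A_hom: "comm_ring_hom (fls_of_A :: 'a poly \<Rightarrow> _)"
proof -
  interpret c: comm_ring_hom "fls_const :: 'a \<Rightarrow> _"
    by standard (simp_all flip: fls_plus_const fls_const_mult_const)
  interpret m: map_poly_comm_ring_hom "fls_const :: 'a \<Rightarrow> _" ..
  show ?thesis by standard (simp_all add: fls_of_A_def m.hom_add m.hom_mult)
qed

lemma emb_A_eq_eval_A: "emb_A \<iota> a = eval_A (\<iota> fls_X_inv) a"
  by (simp add: fls_of_A_def eval_A_def map_poly_map_poly o_def flip: emb.poly_map_poly)

sublocale emb_A: comm_ring_hom "emb_A \<iota>"
  unfolding emb_A_eq_eval_A by (rule eval_A_hom)

lemma absval_const: "c \<noteq> 0 \<Longrightarrow> absval (\<iota> (fls_const c)) = 1"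
  by (subst absval_emb) auto

lemma absval_T: "absval (\<iota> fls_X_inv) = CARD('a)"
  by (subst absval_emb) auto

lemma absval_emb_A:
  assumes "a \<noteq> 0"
  shows "absval (emb_A \<iota> a) = real CARD('a) ^ degree a"
proof -
  let ?T = "\<iota> fls_X_inv" and ?n = "degree a"
  let ?t = "\<lambda>i. \<iota> (fls_const (coeff a i)) * ?T ^ i"
  have abs: "absval (?t i) = (if coeff a i = 0 then 0 else real CARD('a) ^ i)" for i
    by (simp add: absval_mult absval_power absval_T absval_const)
  have "emb_A \<iota> a = (\<Sum>i\<le>?n. ?t i)"
  proof -
    have "degree (map_poly (\<lambda>c. \<iota> (fls_const c)) a) = ?n" by (rule degree_map_poly) simp
    thus ?thesis by (simp add: emb_A_eq_eval_A eval_A_def poly_altdef coeff_map_poly)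
  qed
  also have "\<dots> = (\<Sum>i<?n. ?t i) + ?t ?n"
    by (subst lessThan_Suc_atMost[symmetric]) simp
  also have "absval \<dots> = absval (?t ?n)"
  proof (rule absval_add_eq)
    have "absval (?t i) \<le> real CARD('a) ^ ?n / CARD('a)" if "i \<in> {..<?n}" for i
    proof -
      have "real CARD('a) ^ i * CARD('a) \<le> real CARD('a) ^ ?n"
        using that q_gt_1 power_increasing[of "Suc i" ?n "real CARD('a)"] by (simp add: mult.commute)
      thus ?thesis unfolding abs using q_gt_1 by (simp add: field_simps)
    qed
    hence "absval (\<Sum>i<?n. ?t i) \<le> real CARD('a) ^ ?n / CARD('a)" by (intro absval_sum_le) auto
    also have "\<dots> < real CARD('a) ^ ?n" using q_gt_1 by (simp add: field_simps)
    also have "\<dots> = absval (?t ?n)" using assms by (simp only: abs) simp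
    finally show "absval (\<Sum>i<?n. ?t i) < absval (?t ?n)" .
  qed
  also have "\<dots> = real CARD('a) ^ ?n" using assms by (simp only: abs) simp
  finally show ?thesis .
qed

lemma emb_A_eq_0_iff [simp]: "emb_A \<iota> a = 0 \<longleftrightarrow> a = 0"
  using absval_emb_A[of a] q_gt_1 by (cases "a = 0") auto

lemma fls_of_A_eq_0_iff [simp]: "fls_of_A (a :: 'a poly) = 0 \<longleftrightarrow> a = 0"
  using emb_A_eq_0_iff[of a] by simp

lemma emb_A_eq_iff [simp]: "emb_A \<iota> a = emb_A \<iota> b \<longleftrightarrow> a = b"
  using emb_A_eq_0_iff[of "a - b"] by (simp only: emb_A.hom_minus) auto

text \<open>Discreteness of A: elements of A at distance less than 1 are equal. This lets the
  coefficients of approximating norms stabilise inside A.\<close>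

lemma absval_emb_A_ge_1: "a \<noteq> 0 \<Longrightarrow> absval (emb_A \<iota> a) \<ge> 1"
  using q_gt_1 by (simp add: absval_emb_A)

lemma finite_degree_less: "finite {a :: 'a poly. degree a < n}"
proof (rule finite_subset)
  show "{a :: 'a poly. degree a < n} \<subseteq> Poly ` {xs. set xs \<subseteq> UNIV \<and> length xs \<le> n}"
  proof
    fix a :: "'a poly" assume "a \<in> {a. degree a < n}"
    hence "length (coeffs a) \<le> n" by (cases "a = 0") (simp_all add: length_coeffs_degree)
    thus "a \<in> Poly ` {xs. set xs \<subseteq> UNIV \<and> length xs \<le> n}"
      by (intro image_eqI[of _ _ "coeffs a"]) auto
  qed
  show "finite (Poly ` {xs :: 'a list. set xs \<subseteq> UNIV \<and> length xs \<le> n})"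
    by (intro finite_imageI finite_lists_length_le) auto
qed

lemma finite_emb_A_le: "finite {a. absval (emb_A \<iota> a) \<le> c}"
proof -
  obtain n where n: "c < real CARD('a) ^ n" using real_arch_pow[of "real CARD('a)" c] q_gt_1 by auto
  have "degree a < n" if "absval (emb_A \<iota> a) \<le> c" "a \<noteq> 0" for a
  proof (rule power_less_imp_less_exp)
    show "real CARD('a) ^ degree a < real CARD('a) ^ n"
      using that n by (simp add: absval_emb_A)
  qed (use q_gt_1 in simp)
  hence "{a. absval (emb_A \<iota> a) \<le> c} \<subseteq> insert 0 {a. degree a < n}" by auto
  thus ?thesis using finite_degree_less finite_subset by blast
qed

end

section \<open>The exponential of the lattice\<close>

lemma absval_prod_minus_one_le:
  fixes g :: "'b \<Rightarrow> 'c::ultrametric_field"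
  assumes "\<And>x. x \<in> S \<Longrightarrow> absval (g x - 1) \<le> r" "0 \<le> r" "r \<le> 1"
  shows "absval (prod g S - 1) \<le> r"
  using assms(1)
proof (induction S rule: infinite_finite_induct)
  case (insert x S)
  have "absval (g x) \<le> 1"
    using absval_add_le[of "g x - 1" 1 1] insert.prems[of x] assms(3) by simp
  hence "absval (g x) * absval (prod g S - 1) \<le> 1 * r"
    using insert assms by (intro mult_mono) auto
  hence "absval (g x * (prod g S - 1)) \<le> r" by (simp add: absval_mult)
  moreover have "absval (g x - 1) \<le> r" using insert.prems by simp
  ultimately have "absval (g x * (prod g S - 1) + (g x - 1)) \<le> r" by (rule absval_add_le)
  thus ?case using insert.hyps by (simp add: algebra_simps)
qed (use assms in auto)

locale carlitz_module = C_infinity \<iota>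
  for \<iota> :: "'a::{field,finite} fls \<Rightarrow> 'c::{ultrametric_field,complete_space,alg_closed_field}" +
  fixes \<omega> :: 'c
  assumes period: "carlitz_period \<iota> \<omega>"
begin

lemma period_nonzero [simp]: "\<omega> \<noteq> 0"
  using period by (simp add: carlitz_period_def)

definition cexp :: "'c \<Rightarrow> 'c" where
  "cexp = lattice_exp (scaled_lattice \<iota> \<omega> UNIV)"

lemma cexp_carlitz: "cexp (emb_A \<iota> a * z) = carlitz \<iota> a (cexp z)"
  using period by (simp add: carlitz_period_def cexp_def)

text \<open>A finite additive group. The alternative \<open>a = 0\<close> matters for
  \<open>N = 0\<close> only: the zero polynomial has degree 0, and without it the set would be
  empty.\<close>

definition lattice_ball :: "nat \<Rightarrow> 'c set" where
  "lattice_ball N = (\<lambda>a. \<omega> * emb_A \<iota> a) ` {a. a = 0 \<or> degree a < N}"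

text \<open>The least absolute value of a lattice point outside
  \<open>lattice_ball N\<close>.\<close>

definition lattice_radius :: "nat \<Rightarrow> real" where
  "lattice_radius N = absval \<omega> * real CARD('a) ^ N"

lemma lattice_radius_mono: "N \<le> N' \<Longrightarrow> lattice_radius N \<le> lattice_radius N'"
  using q_gt_1 by (auto simp: lattice_radius_def intro!: mult_left_mono power_increasing)

lemma lattice_radius_pos: "lattice_radius N > 0"
  using q_gt_1 by (simp add: lattice_radius_def)

lemma ex_lattice_radius_gt: "\<exists>N. lattice_radius N > c"
proof -
  obtain N where "c / absval \<omega> < real CARD('a) ^ N"
    using real_arch_pow[of "real CARD('a)"] q_gt_1 by auto
  thus ?thesis by (auto simp: lattice_radius_def field_simps)
qed

lemma lattice_radius_inverse_tendsto: "(\<lambda>N. c / lattice_radius N) \<longlonglongrightarrow> 0"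
proof -
  have "(\<lambda>N. (c / absval \<omega>) * (1 / real CARD('a)) ^ N) \<longlonglongrightarrow> (c / absval \<omega>) * 0"
    using q_gt_1 by (intro tendsto_intros LIMSEQ_power_zero) auto
  thus ?thesis by (simp add: lattice_radius_def power_divide)
qed

lemma finite_lattice_ball: "finite (lattice_ball N)"
proof -
  have "{a :: 'a poly. a = 0 \<or> degree a < N} = insert 0 {a. degree a < N}" by auto
  thus ?thesis unfolding lattice_ball_def by (simp add: finite_degree_less)
qed

lemma zero_in_lattice_ball: "0 \<in> lattice_ball N"
  by (auto simp: lattice_ball_def intro!: image_eqI[of _ _ 0])

lemma lattice_ball_subset: "lattice_ball N \<subseteq> scaled_lattice \<iota> \<omega> UNIV"
  by (auto simp: lattice_ball_def scaled_lattice_def)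

lemma lattice_ball_mono: "N \<le> N' \<Longrightarrow> lattice_ball N \<subseteq> lattice_ball N'"
  by (auto simp: lattice_ball_def)

lemma lattice_outside_ball:
  assumes "x \<in> scaled_lattice \<iota> \<omega> UNIV" "x \<notin> lattice_ball N"
  shows "absval x \<ge> lattice_radius N"
proof -
  obtain a where x: "x = \<omega> * emb_A \<iota> a" using assms(1) by (auto simp: scaled_lattice_def)
  hence "a \<noteq> 0" "degree a \<ge> N" using assms(2) by (auto simp: lattice_ball_def)
  thus ?thesis using q_gt_1
    by (auto simp: x lattice_radius_def absval_mult absval_emb_A intro!: mult_left_mono power_increasing)
qed

definition lattice_prod :: "'c \<Rightarrow> 'c set \<Rightarrow> 'c" where
  "lattice_prod z S = (\<Prod>x\<in>S. 1 - z / x)"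

text \<open>Every factor outside the ball differs from 1 by at most |z| divided by the radius, which
  is less than 1; so these factors leave the absolute value alone and move the product only
  slightly. S is an arbitrary finite set because the exponential is a limit over all finite
  subsets.\<close>

lemma lattice_prod_extend:
  assumes "finite S" "lattice_ball N - {0} \<subseteq> S" "S \<subseteq> scaled_lattice \<iota> \<omega> UNIV - {0}"
    and N: "absval z < lattice_radius N"
  shows "absval (lattice_prod z S) = absval (lattice_prod z (lattice_ball N - {0}))" (is ?A)
    and "absval (lattice_prod z S - lattice_prod z (lattice_ball N - {0})) \<le>
      absval (lattice_prod z (lattice_ball N - {0})) * absval z / lattice_radius N" (is ?B)
proof -
  let ?V = "lattice_ball N - {0}"
  have split: "lattice_prod z S = lattice_prod z ?V * lattice_prod z (S - ?V)"
    unfolding lattice_prod_def using prod.subset_diff[OF assms(2,1)] by (simp add: mult.commute)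
  have le: "absval ((1 - z / x) - 1) \<le> absval z / lattice_radius N" if "x \<in> S - ?V" for x
  proof -
    have "x \<noteq> 0" "lattice_radius N \<le> absval x"
      using lattice_outside_ball[of x N] that assms(3) by auto
    hence "absval z / absval x \<le> absval z / lattice_radius N"
      using lattice_radius_pos[of N] by (intro divide_left_mono) auto
    thus ?thesis by (simp add: absval_divide)
  qed
  have lt: "absval z / lattice_radius N < 1" using N lattice_radius_pos[of N] by simp
  have one: "absval (lattice_prod z (S - ?V) - 1) \<le> absval z / lattice_radius N"
    unfolding lattice_prod_def
    using lt lattice_radius_pos[of N] by (intro absval_prod_minus_one_le le) auto
  have "absval (lattice_prod z (S - ?V)) = absval (1 :: 'c)"
    using one lt by (intro absval_eq_if_diff_less) auto
  thus ?A by (simp add: split absval_mult)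
  have eq: "lattice_prod z S - lattice_prod z ?V = lattice_prod z ?V * (lattice_prod z (S - ?V) - 1)"
    by (simp add: split algebra_simps)
  have "absval (lattice_prod z S - lattice_prod z ?V) \<le>
      absval (lattice_prod z ?V) * (absval z / lattice_radius N)"
    unfolding eq absval_mult using one by (intro mult_left_mono) auto
  thus ?B by simp
qed

lemma lattice_prod_ball_extend:
  assumes "N \<le> N'" and N: "absval z < lattice_radius N"
  shows "absval (lattice_prod z (lattice_ball N' - {0})) = absval (lattice_prod z (lattice_ball N - {0}))"
    and "absval (lattice_prod z (lattice_ball N' - {0}) - lattice_prod z (lattice_ball N - {0})) \<le>
      absval (lattice_prod z (lattice_ball N - {0})) * absval z / lattice_radius N"
  using lattice_prod_extend[OF _ _ _ N, of "lattice_ball N' - {0}"] finite_lattice_ball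
    lattice_ball_mono[OF assms(1)] lattice_ball_subset[of N'] by auto

text \<open>Replaces the limit over all finite subsets by the sequence of the finite groups
  \<open>lattice_ball N\<close>, on which additivity can be seen.\<close>

lemma cexp_tendsto: "(\<lambda>N. z * lattice_prod z (lattice_ball N - {0})) \<longlonglongrightarrow> cexp z"
proof -
  let ?L = "scaled_lattice \<iota> \<omega> UNIV" and ?p = "\<lambda>N. lattice_prod z (lattice_ball N - {0})"
  obtain M where M: "absval z < lattice_radius M" using ex_lattice_radius_gt by auto
  define K where "K = absval (?p M)"
  have M': "absval z < lattice_radius N" if "N \<ge> M" for N
    using M lattice_radius_mono[OF that] by linarith
  have K: "absval (?p N) = K" if "N \<ge> M" for N
    using lattice_prod_ball_extend(1)[OF that M] by (simp add: K_def)
  have "Cauchy (\<lambda>N. ?p (N + M))"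
  proof (rule Cauchy_if_le)
    show "absval (?p (n + M) - ?p (m + M)) \<le> K * absval z / lattice_radius (m + M)"
      if "m \<le> n" for m n
      using lattice_prod_ball_extend(2)[of "m + M" "n + M" z] that M'[of "m + M"] K[of "m + M"]
      by simp
    show "(\<lambda>m. K * absval z / lattice_radius (m + M)) \<longlonglongrightarrow> 0"
      using lattice_radius_inverse_tendsto by (rule LIMSEQ_ignore_initial_segment)
  qed
  then obtain l where "(\<lambda>N. ?p (N + M)) \<longlonglongrightarrow> l"
    by (auto simp: convergent_def dest!: Cauchy_convergent)
  hence l: "?p \<longlonglongrightarrow> l" by (rule LIMSEQ_offset)
  \<comment> \<open>The bound depends on N but not on S, which upgrades convergence along the balls
    to convergence over all finite subsets.\<close>
  have close: "absval (lattice_prod z S - l) \<le> K * absval z / lattice_radius N"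
    if S: "finite S" "lattice_ball N - {0} \<subseteq> S" "S \<subseteq> ?L - {0}" and N: "N \<ge> M" for S N
  proof -
    have "(\<lambda>N'. ?p N' - ?p N) \<longlonglongrightarrow> l - ?p N" by (intro tendsto_diff l tendsto_const)
    moreover have "eventually (\<lambda>N'. absval (?p N' - ?p N) \<le> K * absval z / lattice_radius N) sequentially"
      using eventually_ge_at_top[of N]
      by eventually_elim (use lattice_prod_ball_extend(2)[OF _ M'[OF N]] K[OF N] in simp)
    ultimately have l: "absval (l - ?p N) \<le> K * absval z / lattice_radius N"
      by (rule absval_tendsto_le) simp
    have "absval (lattice_prod z S - ?p N) \<le> K * absval z / lattice_radius N"
      using lattice_prod_extend(2)[OF S M'[OF N]] K[OF N] by simp
    hence "absval ((lattice_prod z S - ?p N) - (l - ?p N)) \<le> K * absval z / lattice_radius N"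
      using l by (rule absval_diff_le)
    thus ?thesis by simp
  qed
  have "(lattice_prod z \<longlongrightarrow> l) (finite_subsets_at_top (?L - {0}))"
  proof (rule tendstoI)
    fix \<epsilon> :: real assume "\<epsilon> > 0"
    have "eventually (\<lambda>N. K * absval z / lattice_radius N < \<epsilon> \<and> N \<ge> M) sequentially"
      by (intro eventually_conj eventually_ge_at_top \<open>\<epsilon> > 0\<close>
          order_tendstoD(2)[OF lattice_radius_inverse_tendsto])
    then obtain N where N: "K * absval z / lattice_radius N < \<epsilon>" "N \<ge> M"
      using eventually_happens'[OF sequentially_bot] by blast
    show "\<forall>\<^sub>F S in finite_subsets_at_top (?L - {0}). dist (lattice_prod z S) l < \<epsilon>"
      unfolding eventually_finite_subsets_at_top
    proof (intro exI[of _ "lattice_ball N - {0}"] conjI allI impI)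
      fix S assume "finite S \<and> lattice_ball N - {0} \<subseteq> S \<and> S \<subseteq> ?L - {0}"
      hence "absval (lattice_prod z S - l) \<le> K * absval z / lattice_radius N"
        using close N(2) by blast
      thus "dist (lattice_prod z S) l < \<epsilon>" using N(1) by (simp add: dist_absval)
    qed (use finite_lattice_ball[of N] lattice_ball_subset[of N] in auto)
  qed
  hence "Lim (finite_subsets_at_top (?L - {0})) (lattice_prod z) = l"
    by (intro tendsto_Lim) auto
  hence "cexp z = z * l"
    by (simp add: cexp_def lattice_exp_def lattice_prod_def[abs_def])
  thus ?thesis using l by (simp add: tendsto_mult)
qed

text \<open>The absolute values of the partial products are constant from N on, so the zeros and the
  growth of the exponential can be read off a finite product.\<close>

lemma absval_cexp:
  assumes "absval z < lattice_radius N"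
  shows "absval (cexp z) = absval z * (\<Prod>x\<in>lattice_ball N - {0}. absval (1 - z / x))"
proof -
  let ?p = "\<lambda>N. lattice_prod z (lattice_ball N - {0})"
  have "(\<lambda>N. absval (z * ?p N)) \<longlonglongrightarrow> absval (cexp z)"
    by (intro tendsto_absval cexp_tendsto)
  moreover have "(\<lambda>N. absval (z * ?p N)) \<longlonglongrightarrow> absval (z * ?p N)"
  proof (rule tendsto_eventually)
    show "eventually (\<lambda>N'. absval (z * ?p N') = absval (z * ?p N)) sequentially"
      using eventually_ge_at_top[of N]
      by eventually_elim
        (subst (1 2) absval_mult, subst lattice_prod_ball_extend(1)[OF _ assms], simp_all)
  qed
  ultimately have "absval (cexp z) = absval (z * ?p N)" by (rule LIMSEQ_unique)
  thus ?thesis by (simp add: absval_mult lattice_prod_def absval_prod)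
qed

lemma cexp_eq_0_iff: "cexp z = 0 \<longleftrightarrow> z \<in> scaled_lattice \<iota> \<omega> UNIV"
proof -
  obtain N where N: "absval z < lattice_radius N" using ex_lattice_radius_gt by auto
  have "cexp z = 0 \<longleftrightarrow> absval (cexp z) = 0" by simp
  also have "\<dots> \<longleftrightarrow> z = 0 \<or> (\<exists>x\<in>lattice_ball N - {0}. 1 - z / x = 0)"
    unfolding absval_cexp[OF N] using finite_lattice_ball[of N] by auto
  also have "\<dots> \<longleftrightarrow> z \<in> lattice_ball N"
    using zero_in_lattice_ball[of N] by auto
  also have "\<dots> \<longleftrightarrow> z \<in> scaled_lattice \<iota> \<omega> UNIV"
    using lattice_ball_subset[of N] lattice_outside_ball[of z N] N by auto
  finally show ?thesis .
qed

text \<open>Each partial product times z is a scalar multiple of the product of z - l over a finite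
  additive group, hence additive in z, and the limit inherits this.\<close>

lemma cexp_add: "cexp (x + y) = cexp x + cexp y"
proof -
  let ?e = "\<lambda>N z. z * lattice_prod z (lattice_ball N - {0})"
  have e: "?e N z = (\<Prod>l\<in>lattice_ball N. z - l) * (\<Prod>l\<in>lattice_ball N - {0}. - 1 / l)" for N z
  proof -
    have "(\<Prod>l\<in>lattice_ball N. z - l) = z * (\<Prod>l\<in>lattice_ball N - {0}. z - l)"
      using finite_lattice_ball zero_in_lattice_ball by (subst prod.remove[of _ 0]) auto
    moreover have "lattice_prod z (lattice_ball N - {0}) =
        (\<Prod>l\<in>lattice_ball N - {0}. z - l) * (\<Prod>l\<in>lattice_ball N - {0}. - 1 / l)"
      unfolding lattice_prod_def prod.distrib[symmetric]
      by (intro prod.cong) (auto simp: field_simps)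
    ultimately show ?thesis by (simp only: mult.assoc)
  qed
  have "u - v \<in> lattice_ball N" if uv: "u \<in> lattice_ball N" "v \<in> lattice_ball N" for u v N
  proof -
    obtain a where a: "a \<in> {a. a = 0 \<or> degree a < N}" "u = \<omega> * emb_A \<iota> a"
      using uv(1) unfolding lattice_ball_def by (elim imageE)
    obtain b where b: "b \<in> {a. a = 0 \<or> degree a < N}" "v = \<omega> * emb_A \<iota> b"
      using uv(2) unfolding lattice_ball_def by (elim imageE)
    have "a - b \<in> {a. a = 0 \<or> degree a < N}"
      using a(1) b(1) degree_diff_less[of a N b] by (cases "a = 0"; cases "b = 0") auto
    moreover have "u - v = \<omega> * emb_A \<iota> (a - b)"
      by (simp only: a b emb_A.hom_minus right_diff_distrib)
    ultimately show ?thesis unfolding lattice_ball_def by (intro image_eqI)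
  qed
  hence "?e N (x + y) = ?e N x + ?e N y" for N
    unfolding e distrib_right[symmetric]
    by (subst additive_prod_subgroup[OF finite_lattice_ball zero_in_lattice_ball]) simp_all
  moreover have "(\<lambda>N. ?e N x + ?e N y) \<longlonglongrightarrow> cexp x + cexp y"
    by (intro tendsto_add cexp_tendsto)
  ultimately have "(\<lambda>N. ?e N (x + y)) \<longlonglongrightarrow> cexp x + cexp y" by simp
  thus ?thesis by (rule LIMSEQ_unique[OF cexp_tendsto])
qed

lemma cexp_periodic: "cexp (\<omega> * (z + emb_A \<iota> a)) = cexp (\<omega> * z)"
proof -
  have "cexp (\<omega> * emb_A \<iota> a) = 0" by (auto simp: cexp_eq_0_iff scaled_lattice_def)
  thus ?thesis by (simp add: distrib_left cexp_add)
qed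

text \<open>By periodicity, z may be replaced by its difference w to a nearest element of A. Then
  every factor \<open>1 - \<omega> * w / x\<close> has absolute value at least 1, so the linear
  factor alone gives the bound. It forces u to 0 far away from
  \<open>K\<^sub>\<infinity>\<close>.\<close>

lemma absval_cexp_ge: "absval (cexp (\<omega> * z)) \<ge> absval \<omega> * im_abs \<iota> z"
proof -
  \<comment> \<open>A nearest element can be sought in this finite set: an element b outside it
    satisfies |z - b| = |b| > |z| and loses against 0.\<close>
  define S where "S = {a. absval (emb_A \<iota> a) \<le> absval z}"
  have "finite S" "0 \<in> S" unfolding S_def by (rule finite_emb_A_le) simp
  define a where "a = arg_min_on (\<lambda>a. absval (z - emb_A \<iota> a)) S"
  have a: "a \<in> S" "\<And>b. b \<in> S \<Longrightarrow> absval (z - emb_A \<iota> a) \<le> absval (z - emb_A \<iota> b)"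
    unfolding a_def using \<open>0 \<in> S\<close>
    by (auto intro!: arg_min_if_finite(1)[OF \<open>finite S\<close>] arg_min_least[OF \<open>finite S\<close>])
  have min: "absval (z - emb_A \<iota> a) \<le> absval (z - emb_A \<iota> b)" for b
  proof (cases "b \<in> S")
    case False
    hence lt: "absval z < absval (emb_A \<iota> b)" by (simp add: S_def)
    have "absval (z - emb_A \<iota> b) = absval (emb_A \<iota> b)"
      using absval_add_eq[of z "- emb_A \<iota> b"] lt by simp
    thus ?thesis using a(2)[OF \<open>0 \<in> S\<close>] lt by simp
  qed (use a in simp)
  define w where "w = z - emb_A \<iota> a"
  obtain N where N: "absval (\<omega> * w) < lattice_radius N" using ex_lattice_radius_gt by auto
  have ge1: "absval (1 - \<omega> * w / x) \<ge> 1" if x: "x \<in> lattice_ball N - {0}" for x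
  proof -
    obtain b where b: "x = \<omega> * emb_A \<iota> b" "b \<noteq> 0" using x by (auto simp: lattice_ball_def)
    have eq: "absval (1 - \<omega> * w / x) = absval (w - emb_A \<iota> b) / absval (emb_A \<iota> b)"
    proof -
      have "1 - \<omega> * w / x = (emb_A \<iota> b - w) / emb_A \<iota> b" using b by (simp add: diff_divide_distrib)
      thus ?thesis by (simp add: absval_divide absval_diff_commute[of w])
    qed
    \<comment> \<open>Either b dominates the difference, or minimality of a gives |w - b| \<ge> |w|
      \<ge> |b|.\<close>
    have "absval (w - emb_A \<iota> b) \<ge> absval (emb_A \<iota> b)"
    proof (cases "absval w < absval (emb_A \<iota> b)")
      case True
      thus ?thesis using absval_add_eq[of w "- emb_A \<iota> b"] by simp
    next
      case False
      have "absval w \<le> absval (z - emb_A \<iota> (a + b))" unfolding w_def by (rule min)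
      also have "z - emb_A \<iota> (a + b) = w - emb_A \<iota> b" by (simp add: w_def emb_A.hom_add)
      finally show ?thesis using False by simp
    qed
    moreover have "absval (emb_A \<iota> b) > 0" using b by simp
    ultimately show ?thesis unfolding eq by (simp add: pos_le_divide_eq)
  qed
  have "im_abs \<iota> z \<le> absval w"
    unfolding w_def dist_absval[symmetric] by (rule infdist_le) simp
  hence "absval \<omega> * im_abs \<iota> z \<le> absval (\<omega> * w) * 1"
    by (simp add: absval_mult mult_left_mono)
  also have "\<dots> \<le> absval (\<omega> * w) * (\<Prod>x\<in>lattice_ball N - {0}. absval (1 - \<omega> * w / x))"
    by (intro mult_left_mono prod_ge_1 ge1) auto
  also have "\<dots> = absval (cexp (\<omega> * w))" by (simp add: absval_cexp[OF N])
  also have "cexp (\<omega> * w) = cexp (\<omega> * z)"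
    using cexp_periodic[of z "- a"] by (simp add: w_def emb_A.hom_uminus)
  finally show ?thesis .
qed

lemma u_param_eq: "u_param \<iota> \<omega> z = 1 / cexp (\<omega> * z)"
  by (simp add: ideal_param_def cexp_def)

lemma u_param_bounds:
  assumes "im_abs \<iota> z > 0"
  shows "u_param \<iota> \<omega> z \<noteq> 0"
    and "absval (u_param \<iota> \<omega> z) \<le> 1 / (absval \<omega> * im_abs \<iota> z)"
proof -
  have pos: "0 < absval \<omega> * im_abs \<iota> z" using assms by (intro mult_pos_pos) auto
  hence "0 < absval (cexp (\<omega> * z))" using absval_cexp_ge[of z] by (rule less_le_trans)
  thus "u_param \<iota> \<omega> z \<noteq> 0" by (simp only: u_param_eq absval_pos_iff) simp
  have "1 / absval (cexp (\<omega> * z)) \<le> 1 / (absval \<omega> * im_abs \<iota> z)"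
    using absval_cexp_ge[of z] pos \<open>0 < absval (cexp (\<omega> * z))\<close>
    by (intro divide_left_mono mult_pos_pos[OF pos]) simp_all
  thus "absval (u_param \<iota> \<omega> z) \<le> 1 / (absval \<omega> * im_abs \<iota> z)"
    by (simp only: u_param_eq absval_divide absval_one)
qed

end

section \<open>The Carlitz polynomial of a prime\<close>

text \<open>Fermat's argument: multiplication by a nonzero x permutes the nonzero elements of S. It
  serves for the field of constants as well as for the image of A modulo \<pi>.\<close>

lemma finite_mult_closed_power_card:
  fixes S :: "'s::field set"
  assumes S: "finite S" "0 \<in> S" "\<And>x y. x \<in> S \<Longrightarrow> y \<in> S \<Longrightarrow> x * y \<in> S" and x: "x \<in> S"
  shows "x ^ card S = x"
proof (cases "x = 0")
  case True
  thus ?thesis using S by (auto simp: power_0_left card_eq_0_iff)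
next
  case False
  let ?S = "S - {0}"
  have "(\<lambda>y. x * y) ` ?S = ?S"
    by (rule endo_inj_surj) (use S x False in \<open>auto simp: inj_on_def\<close>)
  hence "\<Prod>?S = (\<Prod>y\<in>(\<lambda>y. x * y) ` ?S. y)" by simp
  also have "\<dots> = (\<Prod>y\<in>?S. x * y)"
    using False by (subst prod.reindex) (auto simp: inj_on_def)
  also have "\<dots> = x ^ card ?S * \<Prod>?S" by (simp add: prod.distrib)
  finally have "(x ^ card ?S - 1) * \<Prod>?S = 0" by (simp add: left_diff_distrib)
  hence "x ^ card ?S = 1" using S(1) by simp
  moreover have "card S = Suc (card ?S)" using S(1,2) by (rule card.remove)
  ultimately show ?thesis by simp
qed

lemma card_poly_degree_less:
  assumes "n > 0"
  shows "card {a :: 'a::{zero,finite} poly. degree a < n} = CARD('a) ^ n"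
proof -
  have "bij_betw (\<lambda>a. map (coeff a) [0..<n]) {a :: 'a poly. degree a < n}
      {xs. set xs \<subseteq> UNIV \<and> length xs = n}"
  proof (rule bij_betwI[where g = Poly])
    show "Poly \<in> {xs. set xs \<subseteq> UNIV \<and> length xs = n} \<rightarrow> {a :: 'a poly. degree a < n}"
    proof
      fix xs :: "'a list" assume "xs \<in> {xs. set xs \<subseteq> UNIV \<and> length xs = n}"
      hence "degree (Poly xs) \<le> n - 1"
        by (intro degree_le) (auto simp: coeff_Poly_eq nth_default_def)
      thus "Poly xs \<in> {a. degree a < n}" using assms by simp
    qed
    show "Poly (map (coeff a) [0..<n]) = a" if "a \<in> {a. degree a < n}" for a
      using that by (auto simp: poly_eq_iff coeff_Poly_eq nth_default_def coeff_eq_0)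
    show "map (coeff (Poly xs)) [0..<n] = xs" if "xs \<in> {xs. set xs \<subseteq> UNIV \<and> length xs = n}" for xs
      using that by (intro nth_equalityI) (auto simp: coeff_Poly_eq nth_default_def)
  qed auto
  hence "card {a :: 'a poly. degree a < n} = card {xs :: 'a list. set xs \<subseteq> UNIV \<and> length xs = n}"
    by (rule bij_betw_same_card)
  also have "\<dots> = CARD('a) ^ n" by (rule card_lists_length_eq) simp
  finally show ?thesis .
qed

text \<open>\<open>carlitz_coeff a j\<close> is the coefficient of \<open>x\<^bsup>q^j\<^esup>\<close> in \<open>\<rho>\<^sub>a(x)\<close>.\<close>

primrec tau_coeff :: "nat \<Rightarrow> nat \<Rightarrow> 'a::{field,finite} poly" where
  "tau_coeff 0 j = (if j = 0 then 1 else 0)"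
| "tau_coeff (Suc i) j = [:0, 1:] * tau_coeff i j + (if j = 0 then 0 else tau_coeff i (j - 1) ^ CARD('a))"

definition carlitz_coeff :: "'a::{field,finite} poly \<Rightarrow> nat \<Rightarrow> 'a poly" where
  "carlitz_coeff a j = (\<Sum>i\<le>degree a. [:coeff a i:] * tau_coeff i j)"

lemma tau_coeff_eq_0: "j > i \<Longrightarrow> tau_coeff i j = (0 :: 'a::{field,finite} poly)"
  by (induction i arbitrary: j) (auto simp: power_0_left)

lemma tau_coeff_self: "tau_coeff i i = (1 :: 'a::{field,finite} poly)"
  by (induction i) (auto simp: tau_coeff_eq_0)

lemma tau_coeff_zero: "tau_coeff i 0 = (monom 1 i :: 'a::{field,finite} poly)"
  by (induction i) (auto simp: monom_Suc)

lemma carlitz_coeff_zero: "carlitz_coeff a 0 = a"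
  unfolding carlitz_coeff_def tau_coeff_zero
  using poly_as_sum_of_monoms[of a] by (simp add: smult_monom)

lemma carlitz_coeff_degree: "carlitz_coeff a (degree a) = [:lead_coeff a:]"
proof -
  have "carlitz_coeff a (degree a) = (\<Sum>i\<in>{degree a}. [:coeff a i:] * tau_coeff i (degree a))"
    unfolding carlitz_coeff_def
    by (intro sum.mono_neutral_right) (auto simp: tau_coeff_eq_0)
  thus ?thesis by (simp add: tau_coeff_self one_pCons)
qed

context C_infinity
begin

lemma const_power_card: "\<iota> (fls_const c) ^ CARD('a) = \<iota> (fls_const c)"
proof -
  interpret c: comm_ring_hom "\<lambda>c. \<iota> (fls_const c)" by (rule const_hom)
  have "c ^ CARD('a) = c" by (rule finite_mult_closed_power_card) auto
  thus ?thesis by (simp flip: c.hom_power)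
qed

text \<open>Derived without writing q as a power of the characteristic: \<open>X^q - X\<close> is
  the product of the X - c over the constants c, which is additive because they form a finite
  group.\<close>

lemma power_card_add: "(x + y :: 'c) ^ CARD('a) = x ^ CARD('a) + y ^ CARD('a)"
proof -
  let ?\<kappa> = "\<lambda>c. \<iota> (fls_const c)" and ?n = "CARD('a)"
  interpret c: comm_ring_hom ?\<kappa> by (rule const_hom)
  define V where "V = range ?\<kappa>"
  have inj: "inj ?\<kappa>"
  proof (rule injI)
    fix a b assume "?\<kappa> a = ?\<kappa> b"
    hence "?\<kappa> (a - b) = 0" by (simp add: c.hom_minus)
    thus "a = b" by simp
  qed
  define P :: "'c poly" where "P = monom 1 ?n - monom 1 1"
  have "degree P = ?n"
    using q_gt_1 degree_add_eq_left[of "- monom 1 1" "monom 1 ?n :: 'c poly"]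
    by (simp add: P_def degree_monom_eq)
  moreover have "coeff P ?n = 1" using q_gt_1 by (simp add: P_def)
  ultimately have P: "lead_coeff P = 1" "card V = degree P"
    using inj by (simp_all add: V_def card_image)
  have "finite V" by (simp add: V_def)
  have PV: "P = (\<Prod>s\<in>V. [:- s, 1:])"
    by (rule monic_eq_prod_roots[OF P(1) \<open>finite V\<close> P(2)])
      (auto simp: V_def P_def poly_monom const_power_card)
  have V: "(\<Prod>l\<in>V. z - l) = z ^ ?n - z" for z
  proof -
    have "(\<Prod>l\<in>V. z - l) = poly P z" by (simp add: PV poly_prod)
    thus ?thesis by (simp add: P_def poly_monom)
  qed
  have "(\<Prod>l\<in>V. (x + y) - l) = (\<Prod>l\<in>V. x - l) + (\<Prod>l\<in>V. y - l)"
  proof (rule additive_prod_subgroup[OF \<open>finite V\<close>])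
    have "?\<kappa> 0 \<in> V" unfolding V_def by (rule rangeI)
    thus "0 \<in> V" by simp
    fix u v assume "u \<in> V" "v \<in> V"
    then obtain a b where "u = ?\<kappa> a" "v = ?\<kappa> b" by (auto simp: V_def)
    hence "u - v = ?\<kappa> (a - b)" by (simp only: c.hom_minus)
    thus "u - v \<in> V" unfolding V_def by (rule range_eqI)
  qed
  hence "(x + y) ^ ?n - (x + y) = (x ^ ?n - x) + (y ^ ?n - y)" by (simp only: V)
  thus ?thesis by (simp add: diff_add_eq add_diff_eq diff_diff_eq)
qed

lemma power_card_sum: "(\<Sum>i\<in>I. f i :: 'c) ^ CARD('a) = (\<Sum>i\<in>I. f i ^ CARD('a))"
  using q_gt_1 by (induction I rule: infinite_finite_induct) (auto simp: power_card_add)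

lemma power_card_add_poly: "(a + b :: 'a poly) ^ CARD('a) = a ^ CARD('a) + b ^ CARD('a)"
proof -
  have "emb_A \<iota> ((a + b) ^ CARD('a)) = emb_A \<iota> (a ^ CARD('a) + b ^ CARD('a))"
    by (simp only: emb_A.hom_power emb_A.hom_add power_card_add)
  thus ?thesis by (simp only: emb_A_eq_iff)
qed

lemma power_card_sum_poly: "(\<Sum>i\<in>I. f i :: 'a poly) ^ CARD('a) = (\<Sum>i\<in>I. f i ^ CARD('a))"
  using q_gt_1 by (induction I rule: infinite_finite_induct) (auto simp: power_card_add_poly)

text \<open>The recursion in the definition expands \<open>\<rho>_T(\<rho>_(T^i)(x))\<close>; this
  one expands \<open>\<rho>_(T^i)(\<rho>_T(x))\<close>.\<close>

lemma tau_coeff_Suc': "tau_coeff (Suc i) j =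
    [:0, 1:] ^ (CARD('a) ^ j) * tau_coeff i j + (if j = 0 then 0 else tau_coeff i (j - 1) :: 'a poly)"
proof (induction i arbitrary: j)
  case 0
  show ?case by (auto simp: power_0_left)
next
  case (Suc i)
  let ?X = "[:0, 1 :: 'a:]"
  show ?case
  proof (cases j)
    case 0
    have "tau_coeff (Suc (Suc i)) 0 = ?X * tau_coeff (Suc i) 0" by simp
    thus ?thesis by (simp add: 0)
  next
    case j: (Suc m)
    have pw: "(?X ^ (CARD('a) ^ m) * t) ^ CARD('a) = ?X ^ (CARD('a) ^ j) * t ^ CARD('a)" for t
      by (simp only: j power_mult_distrib power_mult[symmetric] power_Suc2)
    have A: "tau_coeff (Suc i) m ^ CARD('a) = ?X ^ (CARD('a) ^ j) * tau_coeff i m ^ CARD('a) +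
        (if m = 0 then 0 else tau_coeff i (m - 1) ^ CARD('a))"
      by (subst Suc.IH, subst power_card_add_poly, subst pw) (auto simp: power_0_left)
    have B: "tau_coeff (Suc i) j = ?X ^ (CARD('a) ^ j) * tau_coeff i j + tau_coeff i m"
      by (subst Suc.IH) (simp add: j)
    have C: "tau_coeff (Suc i) j = ?X * tau_coeff i j + tau_coeff i m ^ CARD('a)"
      by (simp add: j)
    have D: "tau_coeff (Suc i) m = ?X * tau_coeff i m + (if m = 0 then 0 else tau_coeff i (m - 1) ^ CARD('a))"
      by simp
    have "tau_coeff (Suc (Suc i)) j = ?X * tau_coeff (Suc i) j + tau_coeff (Suc i) m ^ CARD('a)"
      by (simp only: tau_coeff.simps(2)[of "Suc i"]) (simp add: j)
    also have "\<dots> = ?X * (?X ^ (CARD('a) ^ j) * tau_coeff i j + tau_coeff i m) +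
        (?X ^ (CARD('a) ^ j) * tau_coeff i m ^ CARD('a) +
        (if m = 0 then 0 else tau_coeff i (m - 1) ^ CARD('a)))"
      by (simp only: A B)
    also have "\<dots> = ?X ^ (CARD('a) ^ j) * tau_coeff (Suc i) j + tau_coeff (Suc i) m"
      by (simp only: C D) (simp only: algebra_simps)
    finally show ?thesis by (simp add: j)
  qed
qed

text \<open>Comparison of coefficients in \<rho>_T \<rho>_a = \<rho>_a \<rho>_T, where constants are
  fixed by the q-th power. Starting from the coefficient a of x, it determines all the
  others.\<close>

lemma carlitz_coeff_rec:
  "carlitz_coeff a (Suc j) * ([:0, 1:] ^ (CARD('a) ^ Suc j) - [:0, 1:]) =
     carlitz_coeff a j ^ CARD('a) - carlitz_coeff a j" for a :: "'a poly"
proof -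
  have tau: "tau_coeff i (Suc j) * ([:0, 1:] ^ (CARD('a) ^ Suc j) - [:0, 1:]) =
      tau_coeff i j ^ CARD('a) - (tau_coeff i j :: 'a poly)" for i
    using tau_coeff_Suc'[of i "Suc j"] by (simp only: tau_coeff.simps(2)) (simp add: algebra_simps)
  have pw: "[:c:] ^ CARD('a) = [:c:]" for c :: 'a
    using finite_mult_closed_power_card[of UNIV c] by (simp add: poly_const_pow)
  show ?thesis
    unfolding carlitz_coeff_def power_card_sum_poly sum_distrib_right mult.assoc tau
      power_mult_distrib pw
    by (simp only: right_diff_distrib sum_subtractf)
qed

text \<open>The free upper limit n allows all iterates occurring in \<open>carlitz\<close> to be
  expanded over one common range.\<close>

lemma carlitz_T_iterate:
  "n \<ge> i \<Longrightarrow> (carlitz_T \<iota> ^^ i) x = (\<Sum>j\<le>n. emb_A \<iota> (tau_coeff i j) * x ^ (CARD('a) ^ j))"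
proof (induction i arbitrary: n)
  case 0
  have "(\<Sum>j\<le>n. emb_A \<iota> (tau_coeff 0 j) * x ^ (CARD('a) ^ j)) =
      (\<Sum>j\<in>{0}. emb_A \<iota> (tau_coeff 0 j) * x ^ (CARD('a) ^ j))"
    by (intro sum.mono_neutral_right) auto
  thus ?case by simp
next
  case (Suc i)
  then obtain m where m: "n = Suc m" "i \<le> m" by (cases n) auto
  let ?t = "\<lambda>j. emb_A \<iota> (tau_coeff i j) * x ^ (CARD('a) ^ j)"
  have T: "\<iota> fls_X_inv = emb_A \<iota> [:0, 1:]" by (simp add: emb_A_eq_eval_A)
  have IH: "(carlitz_T \<iota> ^^ i) x = (\<Sum>j\<le>n. ?t j)" "(carlitz_T \<iota> ^^ i) x = (\<Sum>j\<le>m. ?t j)"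
    using m by (intro Suc.IH; simp)+
  have "(carlitz_T \<iota> ^^ Suc i) x =
      \<iota> fls_X_inv * (carlitz_T \<iota> ^^ i) x + (carlitz_T \<iota> ^^ i) x ^ CARD('a)"
    by (simp add: carlitz_T_def)
  also have "\<dots> = \<iota> fls_X_inv * (\<Sum>j\<le>n. ?t j) + (\<Sum>j\<le>m. ?t j) ^ CARD('a)"
    by (simp only: flip: IH)
  also have "(\<Sum>j\<le>m. ?t j) ^ CARD('a) =
      (\<Sum>j\<le>m. emb_A \<iota> (tau_coeff i j ^ CARD('a)) * x ^ (CARD('a) ^ Suc j))"
    unfolding power_card_sum
    by (simp only: emb_A.hom_power power_mult_distrib power_mult[symmetric] power_Suc2)
  also have "\<dots> = (\<Sum>j\<in>{..n}. emb_A \<iota> (if j = 0 then 0 else tau_coeff i (j - 1) ^ CARD('a)) * x ^ (CARD('a) ^ j))"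
    unfolding m(1) sum.atMost_Suc_shift by simp
  also have "\<iota> fls_X_inv * (\<Sum>j\<le>n. ?t j) =
      (\<Sum>j\<le>n. emb_A \<iota> ([:0, 1:] * tau_coeff i j) * x ^ (CARD('a) ^ j))"
    by (simp only: T emb_A.hom_mult sum_distrib_left mult.assoc)
  also have "\<dots> + (\<Sum>j\<in>{..n}. emb_A \<iota> (if j = 0 then 0 else tau_coeff i (j - 1) ^ CARD('a)) * x ^ (CARD('a) ^ j)) =
      (\<Sum>j\<le>n. emb_A \<iota> (tau_coeff (Suc i) j) * x ^ (CARD('a) ^ j))"
    by (simp only: tau_coeff.simps(2) emb_A.hom_add distrib_right sum.distrib)
  finally show ?case .
qed

lemma carlitz_eq:
  "carlitz \<iota> a x = (\<Sum>j\<le>degree a. emb_A \<iota> (carlitz_coeff a j) * x ^ (CARD('a) ^ j))"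
proof -
  have const: "\<iota> (fls_const c) = emb_A \<iota> [:c:]" for c by (simp add: emb_A_eq_eval_A)
  have "carlitz \<iota> a x = (\<Sum>i\<le>degree a. emb_A \<iota> [:coeff a i:] *
      (\<Sum>j\<le>degree a. emb_A \<iota> (tau_coeff i j) * x ^ (CARD('a) ^ j)))"
    unfolding carlitz_def const
    by (intro sum.cong refl arg_cong2[of _ _ _ _ "(*)"] carlitz_T_iterate) auto
  also have "\<dots> = (\<Sum>j\<le>degree a. \<Sum>i\<le>degree a. emb_A \<iota> ([:coeff a i:] * tau_coeff i j) * x ^ (CARD('a) ^ j))"
    unfolding sum_distrib_left by (subst sum.swap) (simp only: emb_A.hom_mult mult.assoc)
  also have "\<dots> = (\<Sum>j\<le>degree a. emb_A \<iota> (carlitz_coeff a j) * x ^ (CARD('a) ^ j))"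
    by (simp only: carlitz_coeff_def emb_A.hom_sum sum_distrib_right)
  finally show ?thesis .
qed

end

section \<open>Reduction modulo the prime\<close>

locale prime_of_A = C_infinity \<iota>
  for \<iota> :: "'a::{field,finite} fls \<Rightarrow> 'c::{ultrametric_field,complete_space,alg_closed_field}" +
  fixes \<pi> :: "'a poly"
  assumes monic: "lead_coeff \<pi> = 1" and prime: "prime_elem \<pi>"
begin

text \<open>
  The residue field \<open>A/\<pp>\<close> is realised inside \<open>C\<close> as the image of the evaluation at a root \<open>\<theta>\<close>
  of \<open>\<pi>\<close>.
\<close>

definition \<theta> :: 'c where
  "\<theta> = (SOME x. eval_A x \<pi> = 0)"

abbreviation red :: "'a poly \<Rightarrow> 'c" where
  "red \<equiv> eval_A \<theta>"

sublocale red: comm_ring_hom red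
  by (rule eval_A_hom)

lemma degree_pos: "degree \<pi> > 0"
proof (rule ccontr)
  assume "\<not> degree \<pi> > 0"
  then obtain c where "\<pi> = [:c:]" by (auto elim: degree_eq_zeroE)
  with monic have "\<pi> = 1" by (simp add: one_pCons)
  thus False using prime by (simp add: prime_elem_def)
qed

lemma red_prime: "red \<pi> = 0"
proof -
  have "degree (map_poly (\<lambda>c. \<iota> (fls_const c)) \<pi>) = degree \<pi>" by (rule degree_map_poly) simp
  then obtain x where "eval_A x \<pi> = 0"
    using alg_closed_imp_poly_has_root degree_pos unfolding eval_A_def by metis
  thus ?thesis unfolding \<theta>_def by (rule someI)
qed

text \<open>The kernel of the evaluation is generated by an element m of least degree. It divides
  \<pi> and is no unit, so irreducibility makes it an associate of \<pi>.\<close>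

lemma red_eq_0_iff: "red a = 0 \<longleftrightarrow> \<pi> dvd a"
proof
  assume "\<pi> dvd a"
  thus "red a = 0" using red_prime by (auto simp: red.hom_mult)
next
  assume a: "red a = 0"
  have "\<pi> \<noteq> 0" using prime by auto
  define m where "m = (ARG_MIN degree b. b \<noteq> 0 \<and> red b = 0)"
  have m: "m \<noteq> 0" "red m = 0"
    and min: "\<And>b. b \<noteq> 0 \<Longrightarrow> red b = 0 \<Longrightarrow> degree m \<le> degree b"
    using arg_min_nat_lemma[of "\<lambda>b. b \<noteq> 0 \<and> red b = 0" \<pi> degree] \<open>\<pi> \<noteq> 0\<close> red_prime
    unfolding m_def by auto
  have dvd: "m dvd b" if b: "red b = 0" for b
  proof -
    have "b mod m = b - b div m * m" by (simp add: minus_div_mult_eq_mod)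
    hence "red (b mod m) = 0" by (simp add: red.hom_minus red.hom_mult b m)
    hence "b mod m = 0" using min[of "b mod m"] degree_mod_less'[OF m(1), of b] by fastforce
    thus ?thesis by auto
  qed
  obtain k where k: "\<pi> = m * k" using dvd[OF red_prime] by (elim dvdE)
  have "\<not> m dvd 1"
  proof
    assume "m dvd 1"
    then obtain c where "1 = m * c" by (elim dvdE)
    hence "red 1 = red m * red c" by (simp flip: red.hom_mult)
    thus False using m by simp
  qed
  hence "k dvd 1"
    using irreducibleD[OF prime_elem_imp_irreducible[OF prime] k] by blast
  hence "\<pi> dvd m" using k by (metis dvd_mult_unit_iff dvd_refl)
  thus "\<pi> dvd a" using dvd[OF a] by (rule dvd_trans)
qed

lemma red_eq_iff: "red a = red b \<longleftrightarrow> \<pi> dvd a - b"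
  using red_eq_0_iff[of "a - b"] by (simp add: red.hom_minus)

lemma inj_on_red: "inj_on red {a. degree a < degree \<pi>}"
proof (rule inj_onI, rule ccontr)
  fix a b assume ab: "a \<in> {a. degree a < degree \<pi>}" "b \<in> {a. degree a < degree \<pi>}"
    "red a = red b" "a \<noteq> b"
  have "degree \<pi> \<le> degree (a - b)"
    using ab by (intro dvd_imp_degree_le) (auto simp: red_eq_iff)
  moreover have "degree (a - b) < degree \<pi>" using ab by (intro degree_diff_less) auto
  ultimately show False by simp
qed

lemma ex_residue: "\<exists>b. degree b < degree \<pi> \<and> \<pi> dvd a - b"
proof (intro exI conjI)
  show "degree (a mod \<pi>) < degree \<pi>"
    using degree_mod_less[of \<pi> a] degree_pos by (cases "\<pi> = 0"; cases "a mod \<pi> = 0") simp_all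
  show "\<pi> dvd a - a mod \<pi>" by (simp add: minus_mod_eq_mult_div)
qed

lemma range_red: "range red = red ` {a. degree a < degree \<pi>}"
proof
  show "range red \<subseteq> red ` {a. degree a < degree \<pi>}"
  proof
    fix x assume "x \<in> range red"
    then obtain a where a: "x = red a" by (elim rangeE)
    obtain b where "degree b < degree \<pi>" "\<pi> dvd a - b" using ex_residue by blast
    thus "x \<in> red ` {a. degree a < degree \<pi>}"
      by (intro image_eqI[of _ _ b]) (simp_all add: a red_eq_iff)
  qed
qed auto

lemma finite_range_red: "finite (range red)"
  unfolding range_red by (intro finite_imageI finite_degree_less)

lemma card_range_red: "card (range red) = CARD('a) ^ degree \<pi>"
  unfolding range_red using inj_on_red degree_pos by (simp add: card_image card_poly_degree_less)

lemma red_power_card: "red a ^ (CARD('a) ^ degree \<pi>) = red a"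
proof -
  have "red a ^ card (range red) = red a"
  proof (rule finite_mult_closed_power_card[OF finite_range_red])
    show "0 \<in> range red" using red.hom_zero by (metis rangeI)
    show "x * y \<in> range red" if "x \<in> range red" "y \<in> range red" for x y
      using that by (auto simp flip: red.hom_mult)
  qed auto
  thus ?thesis by (simp add: card_range_red)
qed

lemma power_card_power_add:
  "(x + y :: 'c) ^ (CARD('a) ^ j) = x ^ (CARD('a) ^ j) + y ^ (CARD('a) ^ j)"
  by (induction j) (simp_all add: power_card_add power_mult power_Suc2 del: power_Suc)

text \<open>Otherwise x -> \<open>x^(q^j)\<close> would fix \<theta> and the constants, hence the
  whole image of A. Its Q elements would all be roots of a polynomial of degree \<open>q^j\<close>,
  which is less than Q.\<close>

lemma theta_power_neq:
  assumes "0 < j" "j < degree \<pi>"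
  shows "\<theta> ^ (CARD('a) ^ j) \<noteq> \<theta>"
proof
  assume eq: "\<theta> ^ (CARD('a) ^ j) = \<theta>"
  have const: "\<iota> (fls_const c) ^ (CARD('a) ^ j) = \<iota> (fls_const c)" for c
    by (induction j) (simp_all add: const_power_card power_mult)
  have fixed: "red a ^ (CARD('a) ^ j) = red a" for a
  proof (induction a)
    case 0
    show ?case using q_gt_1 by simp
  next
    case (pCons c a)
    have "red (pCons c a) = \<iota> (fls_const c) + \<theta> * red a"
    proof -
      have "pCons c a = [:c:] + [:0, 1:] * a" by simp
      thus ?thesis by (simp only: red.hom_add red.hom_mult eval_A_const eval_A_X)
    qed
    thus ?case by (simp add: power_card_power_add power_mult_distrib const eq pCons.IH)
  qed
  define P :: "'c poly" where "P = monom 1 (CARD('a) ^ j) - monom 1 1"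
  have gt: "CARD('a) ^ j > 1" using q_gt_1 assms(1) by (rule one_less_power)
  have deg: "degree P = CARD('a) ^ j"
    using gt degree_add_eq_left[of "- monom 1 1" "monom 1 (CARD('a) ^ j) :: 'c poly"]
    by (simp add: P_def degree_monom_eq)
  hence "P \<noteq> 0" using gt by auto
  have "range red \<subseteq> {x. poly P x = 0}"
    using fixed by (auto simp: P_def poly_monom)
  hence "card (range red) \<le> degree P"
    using poly_roots_finite[OF \<open>P \<noteq> 0\<close>] poly_roots_degree[OF \<open>P \<noteq> 0\<close>] by (meson card_mono le_trans)
  hence "CARD('a) ^ degree \<pi> \<le> CARD('a) ^ j" by (simp add: deg card_range_red)
  moreover have "CARD('a) ^ j < CARD('a) ^ degree \<pi>"
    using q_gt_1 assms by (intro power_strict_increasing) auto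
  ultimately show False by simp
qed

text \<open>
  The Carlitz polynomial of a prime is Eisenstein: by the recursion for its coefficients, this
  reduces to \<open>\<pi>\<close> not dividing \<open>T\<^bsup>q^j\<^esup> - T\<close> for \<open>0 < j < deg \<pi>\<close>.
\<close>

lemma red_carlitz_coeff: "j < degree \<pi> \<Longrightarrow> red (carlitz_coeff \<pi> j) = 0"
proof (induction j)
  case 0
  show ?case by (simp add: carlitz_coeff_zero red_prime)
next
  case (Suc j)
  have "red (carlitz_coeff \<pi> (Suc j)) * (\<theta> ^ (CARD('a) ^ Suc j) - \<theta>) =
      red (carlitz_coeff \<pi> (Suc j) * ([:0, 1:] ^ (CARD('a) ^ Suc j) - [:0, 1:]))"
    by (simp only: red.hom_mult red.hom_minus red.hom_power eval_A_X)
  also have "\<dots> = 0"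
    using Suc q_gt_1 by (simp only: carlitz_coeff_rec red.hom_minus red.hom_power) (simp add: power_0_left)
  finally show ?case using theta_power_neq[of "Suc j"] Suc.prems by simp
qed

end

section \<open>Norms of power series\<close>

context prime_of_A
begin

abbreviation Q :: nat where
  "Q \<equiv> CARD('a) ^ degree \<pi>"

text \<open>
  If \<open>\<rho>\<^sub>\<pi>(X) = 1 / v\<close> has the roots \<open>x\<close>, then \<open>torsion_poly (\<iota> fls_X_inv) v\<close> has the roots \<open>1 / x\<close>.
\<close>

definition torsion_poly :: "'c \<Rightarrow> 'c \<Rightarrow> 'c poly" where
  "torsion_poly x v = monom 1 Q -
     (\<Sum>i\<le>degree \<pi>. monom (eval_A x (carlitz_coeff \<pi> i) * v) (Q - CARD('a) ^ i))"

text \<open>The torsion polynomial with T and u as indeterminates: T is the innermost variable, u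
  the middle one and Y the outermost.\<close>

definition generic_torsion_poly :: "'a poly poly poly" where
  "generic_torsion_poly = monom 1 Q -
     (\<Sum>i\<le>degree \<pi>. monom [:0, carlitz_coeff \<pi> i:] (Q - CARD('a) ^ i))"

lemma monic_minus_lower_terms:
  fixes f :: "nat \<Rightarrow> 'r::comm_ring_1"
  defines "P \<equiv> monom 1 Q - (\<Sum>i\<le>degree \<pi>. monom (f i) (Q - CARD('a) ^ i))"
  shows "degree P = Q" "lead_coeff P = 1"
proof -
  have pos: "Q > 0" "CARD('a) ^ i > 0" for i using q_gt_1 by simp_all
  have "coeff P Q = 1"
  proof -
    have "(\<Sum>i\<le>degree \<pi>. coeff (monom (f i) (Q - CARD('a) ^ i)) Q) = 0"
      using pos by (intro sum.neutral ballI) (simp add: less_imp_neq[OF diff_less])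
    thus ?thesis by (simp add: P_def coeff_sum)
  qed
  moreover have "degree P \<le> Q"
    unfolding P_def by (intro degree_diff_le degree_sum_le) (auto intro: order_trans[OF degree_monom_le])
  ultimately show "degree P = Q" by (metis le_antisym le_degree one_neq_zero)
  thus "lead_coeff P = 1" using \<open>coeff P Q = 1\<close> by simp
qed

lemmas degree_torsion_poly = monic_minus_lower_terms[of "\<lambda>i. eval_A x (carlitz_coeff \<pi> i) * v" for x v,
  folded torsion_poly_def]

lemma poly_torsion_poly:
  "poly (torsion_poly x v) y = y ^ Q - v * (\<Sum>i\<le>degree \<pi>. eval_A x (carlitz_coeff \<pi> i) * y ^ (Q - CARD('a) ^ i))"
  by (simp add: torsion_poly_def poly_sum poly_monom sum_distrib_left mult_ac)

definition eval2 :: "'c \<Rightarrow> 'c \<Rightarrow> 'a poly poly \<Rightarrow> 'c" where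
  "eval2 x v g = poly (map_poly (eval_A x) g) v"

lemma eval2_hom: "comm_ring_hom (eval2 x v)"
proof -
  interpret e: comm_ring_hom "eval_A x" by (rule eval_A_hom)
  interpret m: map_poly_comm_ring_hom "eval_A x" ..
  show ?thesis by standard (simp_all add: eval2_def m.hom_add m.hom_mult)
qed

text \<open>The polynomial n in u over A is chosen before the point x to which T is sent. Taking x
  to be the true T gives the analytic product, taking x = \<theta> gives its reduction, and both
  come from the same n.\<close>

lemma ex_norm_poly:
  "\<exists>n. \<forall>x v ys. torsion_poly x v = (\<Prod>y\<leftarrow>ys. [:- y, 1:]) \<longrightarrow>
     poly (map_poly (eval_A x) n) v = (\<Prod>y\<leftarrow>ys. poly (map_poly (eval_A x) h) y)"
proof -
  \<comment> \<open>The base ring of the norm is A[u], so the coefficients of h are viewed as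
    constants in u.\<close>
  let ?h = "map_poly (\<lambda>a. [:a:]) h"
  have "lead_coeff generic_torsion_poly = 1"
    unfolding generic_torsion_poly_def by (rule monic_minus_lower_terms)
  from ex_poly_norm[OF this, of ?h] obtain n where
    n: "\<And>(\<phi> :: 'a poly poly \<Rightarrow> 'c) ys. comm_ring_hom \<phi> \<Longrightarrow>
      map_poly \<phi> generic_torsion_poly = (\<Prod>y\<leftarrow>ys. [:- y, 1:]) \<Longrightarrow>
      \<phi> n = (\<Prod>y\<leftarrow>ys. poly (map_poly \<phi> ?h) y)" by blast
  show ?thesis
  proof (intro exI allI impI)
    fix x v ys assume T: "torsion_poly x v = (\<Prod>y\<leftarrow>ys. [:- y, 1:])"
    interpret e: comm_ring_hom "eval2 x v" by (rule eval2_hom)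
    interpret m: map_poly_comm_ring_hom "eval2 x v" ..
    interpret a: comm_ring_hom "eval_A x" by (rule eval_A_hom)
    have "map_poly (eval2 x v) generic_torsion_poly = torsion_poly x v"
      unfolding generic_torsion_poly_def torsion_poly_def
      by (simp add: m.hom_minus m.hom_sum eval2_def a.map_poly_pCons_hom mult.commute)
    hence "eval2 x v n = (\<Prod>y\<leftarrow>ys. poly (map_poly (eval2 x v) ?h) y)"
      using T by (intro n eval2_hom) simp
    moreover have "map_poly (eval2 x v) ?h = map_poly (eval_A x) h"
      by (rule poly_eqI) (simp add: coeff_map_poly eval2_def a.map_poly_pCons_hom)
    ultimately show "poly (map_poly (eval_A x) n) v = (\<Prod>y\<leftarrow>ys. poly (map_poly (eval_A x) h) y)"
      by (simp add: eval2_def)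
  qed
qed

definition norm_poly :: "'a poly poly \<Rightarrow> 'a poly poly" where
  "norm_poly h = (SOME n. \<forall>x v ys. torsion_poly x v = (\<Prod>y\<leftarrow>ys. [:- y, 1:]) \<longrightarrow>
     poly (map_poly (eval_A x) n) v = (\<Prod>y\<leftarrow>ys. poly (map_poly (eval_A x) h) y))"

lemma poly_norm_poly:
  "torsion_poly x v = (\<Prod>y\<leftarrow>ys. [:- y, 1:]) \<Longrightarrow>
     poly (map_poly (eval_A x) (norm_poly h)) v = (\<Prod>y\<leftarrow>ys. poly (map_poly (eval_A x) h) y)"
  using someI_ex[OF ex_norm_poly[of h]] unfolding norm_poly_def by blast

lemma ex_torsion_poly_roots:
  "\<exists>ys. torsion_poly x v = (\<Prod>y\<leftarrow>ys. [:- y, 1:])"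
proof -
  have "torsion_poly x v \<noteq> 0" using degree_torsion_poly[of x v] by auto
  from alg_closed_imp_factorization[OF this] obtain A where
    A: "torsion_poly x v = smult (lead_coeff (torsion_poly x v)) (\<Prod>y\<in>#A. [:- y, 1:])" by blast
  obtain ys where "mset ys = A" using ex_mset by blast
  thus ?thesis using A degree_torsion_poly[of x v] by (auto simp: prod_mset_prod_list simp flip: mset_map)
qed

lemma torsion_poly_roots:
  assumes "torsion_poly x v = (\<Prod>y\<leftarrow>ys. [:- y, 1:])"
  shows "length ys = Q" "y \<in> set ys \<Longrightarrow> poly (torsion_poly x v) y = 0"
proof -
  show "length ys = Q"
    using degree_torsion_poly[of x v] degree_prod_list_linear[of ys] assms by simp
  show "poly (torsion_poly x v) y = 0" if "y \<in> set ys"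
    using that unfolding assms by (induction ys) auto
qed

lemma prod_list_const: "(\<And>y. y \<in> set ys \<Longrightarrow> f y = c) \<Longrightarrow> (\<Prod>y\<leftarrow>ys. f y) = c ^ length ys"
  for c :: "'r::comm_monoid_mult"
  by (induction ys) auto

lemma infinite_C: "infinite (UNIV :: 'c set)"
proof
  assume fin: "finite (UNIV :: 'c set)"
  have inj: "inj (\<lambda>n. emb_A \<iota> (monom 1 n))"
    by (rule injI) (simp only: emb_A_eq_iff monom_eq_iff' one_neq_zero, simp)
  have "finite (range (\<lambda>n. emb_A \<iota> (monom 1 n)))" using fin by (rule finite_subset[OF subset_UNIV])
  hence "finite (UNIV :: nat set)" by (rule finite_imageD) (rule inj)
  thus False by simp
qed

lemma power_Q_sum: "(\<Sum>i\<in>I. f i :: 'c) ^ Q = (\<Sum>i\<in>I. f i ^ Q)"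
  using q_gt_1 by (induction I rule: infinite_finite_induct) (auto simp: power_card_power_add)

text \<open>Modulo \<open>\<pi>\<close>, the torsion polynomial is \<open>Y\<^sup>Q - v\<close>, which has a single root.\<close>

lemma red_norm_poly: "red (coeff (norm_poly h) m) = red (coeff h m)"
proof -
  let ?N = "map_poly red (norm_poly h)" and ?H = "map_poly red h"
  have "poly ?N v = poly ?H v" for v
  proof -
    have "(\<Sum>i\<le>degree \<pi>. red (carlitz_coeff \<pi> i) * y ^ (Q - CARD('a) ^ i)) = 1" for y
    proof -
      have "(\<Sum>i\<le>degree \<pi>. red (carlitz_coeff \<pi> i) * y ^ (Q - CARD('a) ^ i)) =
          (\<Sum>i\<in>{degree \<pi>}. red (carlitz_coeff \<pi> i) * y ^ (Q - CARD('a) ^ i))"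
        by (intro sum.mono_neutral_right) (auto simp: red_carlitz_coeff)
      thus ?thesis by (simp add: carlitz_coeff_degree monic)
    qed
    hence root: "poly (torsion_poly \<theta> v) y = y ^ Q - v" for y by (simp add: poly_torsion_poly)
    obtain ys where ys: "torsion_poly \<theta> v = (\<Prod>y\<leftarrow>ys. [:- y, 1:])"
      using ex_torsion_poly_roots by blast
    have "Q > 0" using q_gt_1 by simp
    then obtain y0 where y0: "y0 ^ Q = v" using nth_root_exists by blast
    have "y = y0" if "y \<in> set ys" for y
    proof -
      have "y ^ Q = v" using torsion_poly_roots(2)[OF ys that] by (simp add: root)
      moreover have "y ^ Q = (y - y0) ^ Q + y0 ^ Q" by (simp flip: power_card_power_add)
      ultimately have "(y - y0) ^ Q = 0" using y0 by simp
      thus ?thesis by simp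
    qed
    hence "poly ?N v = poly ?H y0 ^ Q"
      using poly_norm_poly[OF ys, of h] torsion_poly_roots(1)[OF ys]
        prod_list_const[of ys "poly ?H" "poly ?H y0"] by simp
    also have "\<dots> = (\<Sum>i\<le>degree ?H. (coeff ?H i * y0 ^ i) ^ Q)"
      by (simp only: poly_altdef power_Q_sum)
    also have "\<dots> = (\<Sum>i\<le>degree ?H. coeff ?H i * v ^ i)"
      by (intro sum.cong refl)
        (simp add: power_mult_distrib red_power_card flip: y0 power_mult, simp add: mult.commute)
    also have "\<dots> = poly ?H v" by (simp add: poly_altdef)
    finally show ?thesis .
  qed
  hence "UNIV \<subseteq> {v. poly (?N - ?H) v = 0}" by auto
  have "?N - ?H = 0"
  proof (rule ccontr)
    assume "?N - ?H \<noteq> 0"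
    hence "finite {v. poly (?N - ?H) v = 0}" by (rule poly_roots_finite)
    thus False using \<open>UNIV \<subseteq> {v. poly (?N - ?H) v = 0}\<close> infinite_C finite_subset by metis
  qed
  hence "coeff ?N m = coeff ?H m" by simp
  thus ?thesis by simp
qed

text \<open>At u = 0 the torsion polynomial is \<open>Y^Q\<close>, so every root is 0 and the norm
  is a power of the constant term of h.\<close>

lemma coeff_0_norm_poly:
  assumes "coeff h 0 = 1"
  shows "coeff (norm_poly h) 0 = 1"
proof -
  let ?T = "\<iota> fls_X_inv"
  interpret e: comm_ring_hom "eval_A ?T" by (rule eval_A_hom)
  obtain ys where ys: "torsion_poly ?T 0 = (\<Prod>y\<leftarrow>ys. [:- y, 1:])"
    using ex_torsion_poly_roots by blast
  have "y = 0" if "y \<in> set ys" for y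
    using torsion_poly_roots(2)[OF ys that] by (simp add: poly_torsion_poly)
  hence "poly (map_poly (eval_A ?T) h) y = 1" if "y \<in> set ys" for y
  proof -
    have "y = 0" using that \<open>\<And>y. y \<in> set ys \<Longrightarrow> y = 0\<close> by blast
    thus ?thesis using assms by (simp add: poly_0_coeff_0)
  qed
  hence "(\<Prod>y\<leftarrow>ys. poly (map_poly (eval_A ?T) h) y) = 1 ^ length ys"
    by (rule prod_list_const)
  hence "emb_A \<iota> (coeff (norm_poly h) 0) = emb_A \<iota> 1"
    using poly_norm_poly[OF ys, of h] by (simp add: poly_0_coeff_0 emb_A_eq_eval_A)
  thus ?thesis by (simp only: emb_A_eq_iff)
qed

text \<open>The roots tend to 0 with v: in \<open>y^Q = v * (\<dots>)\<close>, a root with |y| >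
  \<rho> would make the right side smaller than the left once v is small. This brings the roots into
  the disc of convergence.\<close>

lemma torsion_poly_roots_small:
  assumes "0 < \<rho>" "\<rho> \<le> 1"
  shows "\<exists>r::'c. r \<noteq> 0 \<and> (\<forall>v y. absval v \<le> absval r \<longrightarrow> poly (torsion_poly (\<iota> fls_X_inv) v) y = 0 \<longrightarrow> absval y \<le> \<rho>)"
proof -
  let ?T = "\<iota> fls_X_inv" and ?c = "\<lambda>i. eval_A (\<iota> fls_X_inv) (carlitz_coeff \<pi> i)"
  define M where "M = Max (insert 1 ((\<lambda>i. absval (?c i)) ` {..degree \<pi>}))"
  have M: "M \<ge> 1" "\<And>i. i \<le> degree \<pi> \<Longrightarrow> absval (?c i) \<le> M"
  proof -
    show "M \<ge> 1" unfolding M_def by (rule Max_ge) simp_all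
    show "absval (?c i) \<le> M" if "i \<le> degree \<pi>" for i
      unfolding M_def using that by (intro Max_ge) simp_all
  qed
  \<comment> \<open>A power of T large enough that its inverse r satisfies |r| M <
    \<open>\<rho>^Q\<close>.\<close>
  obtain n where n: "M / \<rho> ^ Q < real CARD('a) ^ n"
    using real_arch_pow[of "real CARD('a)"] q_gt_1 by auto
  define r where "r = inverse (?T ^ n)"
  have r: "absval r = inverse (real CARD('a) ^ n)"
    by (simp add: r_def absval_inverse absval_power absval_T)
  have small: "absval r * M < \<rho> ^ Q"
  proof -
    have \<rho>: "\<rho> ^ Q > 0" and qn: "real CARD('a) ^ n > 0" using assms q_gt_1 by simp_all
    have "M < real CARD('a) ^ n * \<rho> ^ Q" using n by (simp only: pos_divide_less_eq[OF \<rho>])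
    hence "M / real CARD('a) ^ n < \<rho> ^ Q" by (simp only: pos_divide_less_eq[OF qn] mult.commute)
    thus ?thesis unfolding r by (simp only: divide_inverse mult.commute)
  qed
  have le: "absval y \<le> \<rho>" if v: "absval v \<le> absval r" and y: "poly (torsion_poly ?T v) y = 0" for v y
  proof (rule ccontr)
    assume "\<not> absval y \<le> \<rho>"
    hence y\<rho>: "absval y > \<rho>" by simp
    hence y0: "absval y > 0" using assms by linarith
    \<comment> \<open>Each term is compared with \<open>|y|^Q\<close>; the missing factor
      \<open>|y|^(q^i)\<close> is at least \<open>\<rho>^(q^i)\<close>, and at least
      \<open>\<rho>^Q\<close> because \<rho> \<le> 1.\<close>
    have "absval (?c i * y ^ (Q - CARD('a) ^ i)) \<le> M * absval y ^ Q / \<rho> ^ Q" if i: "i \<in> {..degree \<pi>}" for i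
    proof -
      have le: "CARD('a) ^ i \<le> Q" using i q_gt_1 by (intro power_increasing) simp_all
      have "\<rho> ^ Q \<le> \<rho> ^ (CARD('a) ^ i)" using assms by (intro power_decreasing[OF le]) simp_all
      also have "\<dots> \<le> absval y ^ (CARD('a) ^ i)" using y\<rho> assms by (intro power_mono) auto
      finally have "absval y ^ (Q - CARD('a) ^ i) * \<rho> ^ Q \<le> absval y ^ (Q - CARD('a) ^ i) * absval y ^ (CARD('a) ^ i)"
        by (intro mult_left_mono) auto
      also have "\<dots> = absval y ^ Q" by (simp only: power_add[symmetric] le_add_diff_inverse2[OF le])
      finally have "absval y ^ (Q - CARD('a) ^ i) \<le> absval y ^ Q / \<rho> ^ Q"
        using assms by (simp add: pos_le_divide_eq)
      hence "absval (?c i) * absval y ^ (Q - CARD('a) ^ i) \<le> M * (absval y ^ Q / \<rho> ^ Q)"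
        using M(1) M(2)[of i] i by (intro mult_mono) simp_all
      thus ?thesis by (simp only: absval_mult absval_power times_divide_eq_right)
    qed
    hence le: "absval (\<Sum>i\<le>degree \<pi>. ?c i * y ^ (Q - CARD('a) ^ i)) \<le> M * absval y ^ Q / \<rho> ^ Q"
    proof (rule absval_sum_le)
      show "0 \<le> M * absval y ^ Q / \<rho> ^ Q" using M(1) assms(1) by simp
    qed
    have "y ^ Q = v * (\<Sum>i\<le>degree \<pi>. ?c i * y ^ (Q - CARD('a) ^ i))"
      using y by (simp add: poly_torsion_poly)
    hence "absval (y ^ Q) = absval (v * (\<Sum>i\<le>degree \<pi>. ?c i * y ^ (Q - CARD('a) ^ i)))"
      by (rule arg_cong)
    hence "absval y ^ Q = absval v * absval (\<Sum>i\<le>degree \<pi>. ?c i * y ^ (Q - CARD('a) ^ i))"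
      by (simp only: absval_power absval_mult)
    also have "\<dots> \<le> absval r * (M * absval y ^ Q / \<rho> ^ Q)"
      using le v by (intro mult_mono) auto
    also have "\<dots> = (absval r * M / \<rho> ^ Q) * absval y ^ Q" by simp
    also have "\<dots> < 1 * absval y ^ Q"
    proof (rule mult_strict_right_mono)
      show "absval r * M / \<rho> ^ Q < 1" using small assms(1) by (simp only: pos_divide_less_eq zero_less_power mult_1)
      show "0 < absval y ^ Q" using y0 by (rule zero_less_power)
    qed
    finally show False by simp
  qed
  have "r \<noteq> 0" using r q_gt_1 by auto
  show ?thesis
  proof (intro exI[of _ r] conjI allI impI)
    fix v y assume "absval v \<le> absval r" "poly (torsion_poly ?T v) y = 0"
    thus "absval y \<le> \<rho>" by (rule le)
  qed (rule \<open>r \<noteq> 0\<close>)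
qed

end

context prime_of_A
begin

text \<open>
  The norms of the truncations of the series converge coefficientwise, since by the Cauchy estimates
  their coefficients form Cauchy sequences in the discrete ring \<open>A\<close>.
\<close>

lemma ex_norm_series:
  fixes a :: "nat \<Rightarrow> 'a poly" and y0 :: 'c
  assumes a0: "a 0 = 1" and y0: "y0 \<noteq> 0" "absval y0 \<le> 1"
    and conv: "(\<lambda>n. emb_A \<iota> (a n) * y0 ^ n) \<longlonglongrightarrow> 0"
  shows "\<exists>G (r::'c). G 0 = 1 \<and> (\<forall>m. \<pi> dvd G m - a m) \<and> r \<noteq> 0 \<and>
    (\<forall>v ys s. absval v \<le> absval r \<longrightarrow> torsion_poly (\<iota> fls_X_inv) v = (\<Prod>y\<leftarrow>ys. [:- y, 1:]) \<longrightarrow>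
      (\<forall>y\<in>set ys. (\<lambda>n. emb_A \<iota> (a n) * y ^ n) sums s y) \<longrightarrow>
      (\<lambda>m. emb_A \<iota> (G m) * v ^ m) sums (\<Prod>y\<leftarrow>ys. s y))"
proof -
  let ?T = "\<iota> fls_X_inv"
  interpret e: comm_ring_hom "eval_A ?T" by (rule eval_A_hom)
  interpret em: map_poly_comm_ring_hom "eval_A ?T" ..
  define h where "h N = (\<Sum>n<N. monom (a n) n)" for N
  define g where "g N = map_poly (eval_A ?T) (norm_poly (h N))" for N
  define c where "c N m = coeff (norm_poly (h N)) m" for N m
  have coeff_h: "coeff (h N) m = (if m < N then a m else 0)" for N m
    by (simp add: h_def coeff_sum)
  have coeff_g: "coeff (g N) m = emb_A \<iota> (c N m)" for N m
    by (simp add: g_def c_def emb_A_eq_eval_A)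
  define H where "H N y = (\<Sum>n<N. emb_A \<iota> (a n) * y ^ n)" for N y
  have poly_h: "poly (map_poly (eval_A ?T) (h N)) y = H N y" for N y
    by (simp add: h_def H_def em.hom_sum poly_sum poly_monom emb_A_eq_eval_A)
  have "0 < absval y0" using y0(1) by simp
  from torsion_poly_roots_small[OF this y0(2)] obtain r :: 'c where r0: "r \<noteq> 0"
    "\<forall>v y. absval v \<le> absval r \<longrightarrow> poly (torsion_poly ?T v) y = 0 \<longrightarrow> absval y \<le> absval y0"
    by (elim exE conjE)
  note r = r0(1) r0(2)[rule_format]
  have roots: "absval y \<le> absval y0"
    if "absval v \<le> absval r" "torsion_poly ?T v = (\<Prod>y\<leftarrow>ys. [:- y, 1:])" "y \<in> set ys" for v ys y
    using r(2)[OF that(1)] torsion_poly_roots(2)[OF that(2,3)] by blast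
  obtain B where B: "B \<ge> 1" "\<And>n. absval (emb_A \<iota> (a n) * y0 ^ n) \<le> B"
    using tendsto_zero_absval_bounded[OF conv] by blast
  have BQ: "B ^ Q \<ge> 1" using B(1) by (rule one_le_power)
  have BQ0: "B ^ Q > 0" "B \<noteq> 0" using B(1) by simp_all
  have term_le: "absval (emb_A \<iota> (a n) * y ^ n) \<le> absval (emb_A \<iota> (a n) * y0 ^ n)"
    if "absval y \<le> absval y0" for n y
    using that by (simp only: absval_mult absval_power) (intro mult_left_mono power_mono, auto)
  \<comment> \<open>The tails are measured at the single point \<open>y0\<close>; by
    \<open>term_le\<close> the same bounds hold at every root y for small v, uniformly in v and
    y.\<close>
  define E where "E \<epsilon> N \<longleftrightarrow> (\<forall>n\<ge>N. absval (emb_A \<iota> (a n) * y0 ^ n) \<le> \<epsilon>)" for \<epsilon> N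
  have ex_E: "\<exists>N. E (\<epsilon> / B ^ Q) N" if "\<epsilon> > 0" for \<epsilon>
  proof -
    have "\<epsilon> / B ^ Q > 0" using that BQ0(1) by (rule divide_pos_pos)
    hence "eventually (\<lambda>n. absval (emb_A \<iota> (a n) * y0 ^ n) < \<epsilon> / B ^ Q) sequentially"
      using order_tendstoD(2)[OF tendsto_absval[OF conv], of "\<epsilon> / B ^ Q"] by simp
    then obtain N where "\<And>n. n \<ge> N \<Longrightarrow> absval (emb_A \<iota> (a n) * y0 ^ n) < \<epsilon> / B ^ Q"
      unfolding eventually_sequentially by blast
    thus ?thesis unfolding E_def by (intro exI[of _ N] allI impI less_imp_le)
  qed
  have E_nonneg: "\<epsilon> \<ge> 0" if "E \<epsilon> N" for \<epsilon> N
  proof -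
    have "absval (emb_A \<iota> (a N) * y0 ^ N) \<le> \<epsilon>" using that by (simp add: E_def)
    thus ?thesis by (rule order_trans[OF absval_nonneg])
  qed
  have H_le: "absval (H N y) \<le> B" if "absval y \<le> absval y0" for N y
    unfolding H_def
  proof (rule absval_sum_le)
    show "absval (emb_A \<iota> (a n) * y ^ n) \<le> B" for n using term_le[OF that] B(2) by (rule order_trans)
  qed (use B(1) in simp)
  have H_close: "absval (H N' y - H N y) \<le> \<epsilon>" if "E \<epsilon> N" "N \<le> N'" "absval y \<le> absval y0" for \<epsilon> N N' y
  proof -
    have "H N' y - H N y = (\<Sum>n=N..<N'. emb_A \<iota> (a n) * y ^ n)"
      unfolding H_def using that(2) by (simp add: sum_diff_nat_ivl lessThan_atLeast0)
    also have "absval \<dots> \<le> \<epsilon>"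
    proof (rule absval_sum_le)
      fix n assume "n \<in> {N..<N'}"
      hence "absval (emb_A \<iota> (a n) * y0 ^ n) \<le> \<epsilon>" using that(1) by (simp add: E_def)
      thus "absval (emb_A \<iota> (a n) * y ^ n) \<le> \<epsilon>" using term_le[OF that(3)] by (rule order_trans[rotated])
    qed (rule E_nonneg[OF that(1)])
    finally show ?thesis .
  qed
  have poly_g: "poly (g N) v = (\<Prod>y\<leftarrow>ys. H N y)"
    if "torsion_poly ?T v = (\<Prod>y\<leftarrow>ys. [:- y, 1:])" for v ys N
    unfolding g_def using poly_norm_poly[OF that] by (simp add: poly_h)
  have g_close: "absval (poly (g N' - g N) v) \<le> \<epsilon> * B ^ Q"
    if "E \<epsilon> N" "N \<le> N'" "absval v \<le> absval r" for \<epsilon> N N' v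
  proof -
    obtain ys where ys: "torsion_poly ?T v = (\<Prod>y\<leftarrow>ys. [:- y, 1:])"
      using ex_torsion_poly_roots by blast
    have "absval ((\<Prod>y\<leftarrow>ys. H N' y) - (\<Prod>y\<leftarrow>ys. H N y)) \<le> \<epsilon> * B ^ length ys"
      using roots[OF that(3) ys] E_nonneg[OF that(1)] B(1)
      by (intro absval_prod_list_diff_le H_le H_close[OF that(1,2)])
    thus ?thesis by (simp add: poly_g[OF ys] torsion_poly_roots(1)[OF ys])
  qed
  have coeff_close: "absval ((emb_A \<iota> (c N' m) - emb_A \<iota> (c N m)) * r ^ m) \<le> \<epsilon> * B ^ Q"
    if "E \<epsilon> N" "N \<le> N'" for \<epsilon> N N' m
    using poly_coeff_Cauchy_estimate[of r "g N' - g N" "\<epsilon> * B ^ Q" m] g_close[OF that]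
    by (simp add: coeff_g)
  have "\<exists>N. \<forall>N'\<ge>N. c N' m = c N m" for m
  proof -
    \<comment> \<open>Below \<open>|r|^m\<close>, so the Cauchy estimate puts the m-th coefficients
      at distance less than 1, and by discreteness of A they agree.\<close>
    define \<epsilon> where "\<epsilon> = absval r ^ m / 2"
    have \<epsilon>: "\<epsilon> > 0" "\<epsilon> < absval r ^ m" using r(1) by (auto simp: \<epsilon>_def)
    obtain N where N: "E (\<epsilon> / B ^ Q) N" using ex_E[OF \<epsilon>(1)] by blast
    have "c N' m = c N m" if "N' \<ge> N" for N'
    proof (rule ccontr)
      assume "c N' m \<noteq> c N m"
      hence "absval (emb_A \<iota> (c N' m - c N m)) \<ge> 1" by (intro absval_emb_A_ge_1) simp
      hence "absval r ^ m \<le> absval (emb_A \<iota> (c N' m - c N m)) * absval r ^ m"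
        using mult_right_mono[of 1 _ "absval r ^ m"] by simp
      also have "\<dots> = absval ((emb_A \<iota> (c N' m) - emb_A \<iota> (c N m)) * r ^ m)"
        by (simp only: absval_mult absval_power emb_A.hom_minus)
      also have "\<dots> \<le> \<epsilon> / B ^ Q * B ^ Q" by (rule coeff_close[OF N that])
      also have "\<dots> = \<epsilon>" using BQ0 by simp
      finally show False using \<epsilon> by simp
    qed
    thus ?thesis by blast
  qed
  then obtain S where S: "\<And>m N'. N' \<ge> S m \<Longrightarrow> c N' m = c (S m) m" by metis
  define G where "G m = c (S m) m" for m
  have G: "\<exists>N'\<ge>N. c N' m = G m" for N m
    using S[of m "max N (S m)"] unfolding G_def by (intro exI[of _ "max N (S m)"]) simp
  have G0: "G 0 = 1"
  proof -
    obtain N where "N \<ge> 1" "c N 0 = G 0" using G by blast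
    thus ?thesis using coeff_0_norm_poly[of "h N"] a0 by (simp add: c_def coeff_h)
  qed
  have G\<pi>: "\<pi> dvd G m - a m" for m
  proof -
    obtain N where "N \<ge> Suc m" "c N m = G m" using G by blast
    hence "red (G m) = red (a m)" using red_norm_poly[of "h N" m] by (simp add: c_def coeff_h)
    thus ?thesis by (simp add: red_eq_iff)
  qed
  \<comment> \<open>The index from which the m-th coefficient is final depends on m, but the Cauchy
    estimate does not; comparison with a late truncation chosen for m gives a bound uniform in
    m.\<close>
  have G_close: "absval ((emb_A \<iota> (G m) - emb_A \<iota> (c N m)) * v ^ m) \<le> \<epsilon> * B ^ Q"
    if "E \<epsilon> N" "absval v \<le> absval r" for \<epsilon> N m v
  proof -
    obtain N' where N': "N' \<ge> N" "c N' m = G m" using G by blast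
    have "absval ((emb_A \<iota> (G m) - emb_A \<iota> (c N m)) * v ^ m) \<le>
        absval ((emb_A \<iota> (G m) - emb_A \<iota> (c N m)) * r ^ m)"
      unfolding absval_mult absval_power using that(2) by (intro mult_left_mono power_mono) auto
    also have "\<dots> \<le> \<epsilon> * B ^ Q" using coeff_close[OF that(1) N'(1), of m] by (simp add: N'(2))
    finally show ?thesis .
  qed
  have sums: "(\<lambda>m. emb_A \<iota> (G m) * v ^ m) sums (\<Prod>y\<leftarrow>ys. s y)"
    if v: "absval v \<le> absval r" and ys: "torsion_poly ?T v = (\<Prod>y\<leftarrow>ys. [:- y, 1:])"
      and s: "\<And>y. y \<in> set ys \<Longrightarrow> (\<lambda>n. emb_A \<iota> (a n) * y ^ n) sums s y" for v ys s
  proof -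
    \<comment> \<open>Beyond the degree of one sufficiently late approximating norm, its
      coefficients are 0, so \<open>G_close\<close> bounds the terms themselves.\<close>
    have "(\<lambda>m. emb_A \<iota> (G m) * v ^ m) \<longlonglongrightarrow> 0"
      unfolding tendsto_absval_iff[of _ 0]
    proof (rule LIMSEQ_I)
      fix \<delta> :: real assume \<delta>: "\<delta> > 0"
      then obtain N where N: "E (\<delta> / 2 / B ^ Q) N" using ex_E[of "\<delta> / 2"] by auto
      show "\<exists>M. \<forall>m\<ge>M. norm (absval (emb_A \<iota> (G m) * v ^ m - 0) - 0) < \<delta>"
      proof (intro exI allI impI)
        fix m assume "m \<ge> Suc (degree (norm_poly (h N)))"
        hence "c N m = 0" by (simp add: c_def coeff_eq_0)
        hence "absval (emb_A \<iota> (G m) * v ^ m) \<le> \<delta> / 2"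
          using G_close[OF N v, of m] BQ0 by simp
        thus "norm (absval (emb_A \<iota> (G m) * v ^ m - 0) - 0) < \<delta>" using \<delta> by simp
      qed
    qed
    then obtain z where z: "(\<lambda>m. emb_A \<iota> (G m) * v ^ m) sums z"
      using summable_ultrametric by (auto simp: summable_def)
    \<comment> \<open>Both the sum z and the product of the values s(y) are within \<delta> of the
      norm of a truncation, evaluated at v.\<close>
    have "absval (z - (\<Prod>y\<leftarrow>ys. s y)) \<le> \<delta>" if \<delta>: "\<delta> > 0" for \<delta>
    proof -
      define \<epsilon> where "\<epsilon> = \<delta> / B ^ Q"
      obtain N where N: "E \<epsilon> N" unfolding \<epsilon>_def using ex_E[OF \<delta>] by blast
      have \<epsilon>\<delta>: "\<epsilon> * B ^ Q = \<delta>" using BQ0 by (simp add: \<epsilon>_def)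
      have "(\<lambda>m. coeff (g N) m * v ^ m) sums poly (g N) v"
        unfolding poly_altdef by (rule sums_finite) (auto simp: coeff_eq_0)
      hence "(\<lambda>m. emb_A \<iota> (G m) * v ^ m + (- 1) * (coeff (g N) m * v ^ m)) sums (z + (- 1) * poly (g N) v)"
        by (intro sums_add z sums_mult_ultrametric)
      hence "absval (z + (- 1) * poly (g N) v) \<le> \<delta>"
      proof (rule sums_absval_le)
        show "absval (emb_A \<iota> (G m) * v ^ m + (- 1) * (coeff (g N) m * v ^ m)) \<le> \<delta>" for m
          using G_close[OF N v, of m] by (simp add: \<epsilon>\<delta> coeff_g left_diff_distrib)
      qed
      hence 1: "absval (z - poly (g N) v) \<le> \<delta>" by simp
      have "absval (s y - H N y) \<le> \<epsilon>" if y: "y \<in> set ys" for y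
      proof (rule absval_tendsto_le)
        show "(\<lambda>N'. H N' y - H N y) \<longlonglongrightarrow> s y - H N y"
          using s[OF y] unfolding sums_def H_def by (intro tendsto_diff tendsto_const)
        show "eventually (\<lambda>N'. absval (H N' y - H N y) \<le> \<epsilon>) sequentially"
          using eventually_ge_at_top[of N]
          by eventually_elim (rule H_close[OF N _ roots[OF v ys y]])
      qed simp
      moreover have "absval (s y) \<le> B" if y: "y \<in> set ys" for y
        by (rule sums_absval_le[OF s[OF y]]) (rule order_trans[OF term_le[OF roots[OF v ys y]] B(2)])
      ultimately have "absval ((\<Prod>y\<leftarrow>ys. s y) - (\<Prod>y\<leftarrow>ys. H N y)) \<le> \<epsilon> * B ^ length ys"
        using roots[OF v ys] E_nonneg[OF N] B(1)
        by (intro absval_prod_list_diff_le H_le) auto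
      hence 2: "absval ((\<Prod>y\<leftarrow>ys. s y) - poly (g N) v) \<le> \<delta>"
        by (simp add: poly_g[OF ys] torsion_poly_roots(1)[OF ys] \<epsilon>\<delta>)
      show ?thesis using absval_diff_le[OF 1 2] by simp
    qed
    hence "absval (z - (\<Prod>y\<leftarrow>ys. s y)) \<le> 0" by (rule field_le_epsilon[where y = 0, simplified])
    hence "z = (\<Prod>y\<leftarrow>ys. s y)" by simp
    thus ?thesis using z by simp
  qed
  show ?thesis
  proof (intro exI[of _ G] exI[of _ r] conjI allI impI G0 G\<pi> r(1))
    fix v ys s
    assume v: "absval v \<le> absval r" "torsion_poly ?T v = (\<Prod>y\<leftarrow>ys. [:- y, 1:])"
      "\<forall>y\<in>set ys. (\<lambda>n. emb_A \<iota> (a n) * y ^ n) sums s y"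
    show "(\<lambda>m. emb_A \<iota> (G m) * v ^ m) sums (\<Prod>y\<leftarrow>ys. s y)"
      using v(3) by (intro sums v(1,2)) blast
  qed
qed

end

hide_const (open) Matrix.mat Matrix.vec Determinant.det
no_notation fps_nth (infixl "$" 75)
no_notation Matrix.vec_index (infixl "$" 100)

section \<open>Expansions at infinity\<close>

context C_infinity
begin

text \<open>The affine map permutes \<open>range \<iota>\<close> and multiplies distances by
  |a|.\<close>

lemma im_abs_affine_ge:
  assumes "a \<noteq> 0"
  shows "im_abs \<iota> (\<iota> a * z + \<iota> b) \<ge> absval (\<iota> a) * im_abs \<iota> z"
proof -
  have "absval (\<iota> a) * im_abs \<iota> z \<le> dist (\<iota> a * z + \<iota> b) (\<iota> x)" for x
  proof -
    have "\<iota> a * \<iota> ((x - b) / a) = \<iota> x - \<iota> b"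
      using assms by (simp flip: emb_mult emb.hom_minus)
    hence "\<iota> a * z + \<iota> b - \<iota> x = \<iota> a * (z - \<iota> ((x - b) / a))"
      by (simp add: right_diff_distrib)
    hence "dist (\<iota> a * z + \<iota> b) (\<iota> x) = absval (\<iota> a) * dist z (\<iota> ((x - b) / a))"
      by (simp only: dist_absval absval_mult)
    moreover have "im_abs \<iota> z \<le> dist z (\<iota> ((x - b) / a))" by (rule infdist_le) simp
    ultimately show ?thesis by (simp add: mult_left_mono)
  qed
  thus ?thesis by (subst (2) infdist_notempty) (auto intro!: cINF_greatest)
qed

lemma im_abs_pos_imp_Omega: "im_abs \<iota> z > 0 \<Longrightarrow> z \<in> Omega \<iota>"
  by (auto simp: Omega_def)

text \<open>A square root of \<open>T\<close> has an absolute value outside the value group of \<open>K\<^sub>\<infinity>\<close>.\<close>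

lemma ex_im_abs_ge_1: "\<exists>z. im_abs \<iota> z \<ge> 1"
proof -
  obtain z where z: "z ^ 2 = \<iota> fls_X_inv" using nth_root_exists[of 2 "\<iota> fls_X_inv"] by auto
  hence z2: "absval z ^ 2 = CARD('a)" by (metis absval_power absval_T)
  have "absval z > 1"
  proof (rule ccontr)
    assume "\<not> absval z > 1"
    hence "absval z ^ 2 \<le> 1" by (intro power_le_one) auto
    thus False using z2 q_gt_1 by simp
  qed
  have "dist z (\<iota> x) \<ge> 1" for x
  proof -
    have "absval z \<noteq> absval (\<iota> x)"
    proof
      assume eq: "absval z = absval (\<iota> x)"
      have "x \<noteq> 0" using eq \<open>absval z > 1\<close> by auto
      hence "absval z = real CARD('a) powi (- fls_subdegree x)" using eq absval_emb by simp
      moreover have "real CARD('a) powi (- fls_subdegree x + - fls_subdegree x) =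
          real CARD('a) powi (- fls_subdegree x) * real CARD('a) powi (- fls_subdegree x)"
        by (rule power_int_add) simp
      ultimately have "real CARD('a) powi (- fls_subdegree x + - fls_subdegree x) = real CARD('a)"
        using z2 by (simp only: power2_eq_square)
      moreover have "- fls_subdegree x + - fls_subdegree x < 1 \<or> 1 < - fls_subdegree x + - fls_subdegree x"
        by presburger
      ultimately show False
        using power_int_strict_increasing[of "- fls_subdegree x + - fls_subdegree x" 1 "real CARD('a)"]
          power_int_strict_increasing[of 1 "- fls_subdegree x + - fls_subdegree x" "real CARD('a)"] q_gt_1
        by auto
    qed
    hence "absval z \<le> absval (z - \<iota> x)"
      using absval_add_eq[of z "- \<iota> x"] absval_add_eq[of "- \<iota> x" z]
      by (cases "absval z" "absval (\<iota> x)" rule: linorder_cases) auto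
    thus ?thesis using \<open>absval z > 1\<close> by (simp add: dist_absval)
  qed
  hence "im_abs \<iota> z \<ge> 1" by (subst infdist_notempty) (auto intro!: cINF_greatest)
  thus ?thesis by blast
qed

end

context carlitz_module
begin

text \<open>Supplies the nonzero arguments tending to 0 that the identity theorem for power series
  needs, inside any prescribed neighbourhood of infinity.\<close>

lemma ex_u_sequence:
  "\<exists>z :: nat \<Rightarrow> 'c. (\<forall>n. im_abs \<iota> (z n) \<ge> R \<and> z n \<in> Omega \<iota> \<and> u_param \<iota> \<omega> (z n) \<noteq> 0) \<and>
     (\<lambda>n. u_param \<iota> \<omega> (z n)) \<longlonglongrightarrow> 0"
proof -
  obtain z0 :: 'c where z0: "im_abs \<iota> z0 \<ge> 1" using ex_im_abs_ge_1 by blast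
  obtain M where M: "R < real CARD('a) ^ M" using real_arch_pow[of "real CARD('a)" R] q_gt_1 by auto
  \<comment> \<open>The exponent M lifts all points beyond R, while n drives u to 0.\<close>
  define z where "z n = \<iota> (fls_X_inv ^ (n + M)) * z0 + \<iota> 0" for n
  have im: "im_abs \<iota> (z n) \<ge> real CARD('a) ^ (n + M)" for n
  proof -
    have "real CARD('a) ^ (n + M) * 1 \<le> real CARD('a) ^ (n + M) * im_abs \<iota> z0"
      using z0 by (intro mult_left_mono) auto
    also have "\<dots> = absval (\<iota> (fls_X_inv ^ (n + M))) * im_abs \<iota> z0"
      by (simp add: emb.hom_power absval_power absval_T)
    also have "\<dots> \<le> im_abs \<iota> (z n)" unfolding z_def by (rule im_abs_affine_ge) simp
    finally show ?thesis by simp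
  qed
  have pos: "im_abs \<iota> (z n) > 0" for n
    by (rule less_le_trans[OF _ im[of n]]) simp
  have "im_abs \<iota> (z n) \<ge> R" for n
  proof -
    have "real CARD('a) ^ M \<le> real CARD('a) ^ (n + M)" using q_gt_1 by (intro power_increasing) auto
    thus ?thesis using M im[of n] by linarith
  qed
  moreover have "z n \<in> Omega \<iota>" "u_param \<iota> \<omega> (z n) \<noteq> 0" for n
    by (rule im_abs_pos_imp_Omega[OF pos], rule u_param_bounds(1)[OF pos])
  moreover have "(\<lambda>n. u_param \<iota> \<omega> (z n)) \<longlonglongrightarrow> 0"
    unfolding tendsto_absval_iff[of _ 0]
  proof (rule tendsto_sandwich[OF always_eventually always_eventually tendsto_const])
    show "\<forall>n. absval (u_param \<iota> \<omega> (z n) - 0) \<le> 1 / lattice_radius n"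
    proof
      fix n
      have "real CARD('a) ^ n \<le> real CARD('a) ^ (n + M)" using q_gt_1 by (intro power_increasing) auto
      hence le: "lattice_radius n \<le> absval \<omega> * im_abs \<iota> (z n)"
        unfolding lattice_radius_def using im[of n] by (intro mult_left_mono) auto
      have "absval (u_param \<iota> \<omega> (z n)) \<le> 1 / (absval \<omega> * im_abs \<iota> (z n))"
        by (rule u_param_bounds(2)[OF pos])
      also have "\<dots> \<le> 1 / lattice_radius n"
        using le by (rule divide_left_mono) (simp_all add: mult_pos_pos pos lattice_radius_pos)
      finally show "absval (u_param \<iota> \<omega> (z n) - 0) \<le> 1 / lattice_radius n" by simp
    qed
    show "(\<lambda>n. 1 / lattice_radius n) \<longlonglongrightarrow> 0" by (rule lattice_radius_inverse_tendsto)
  qed auto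
  ultimately show ?thesis by (intro exI[of _ z] conjI allI)
qed

text \<open>This makes the definite description in \<open>u_series\<close> meaningful.\<close>

lemma has_expansion_unique:
  assumes "has_expansion \<iota> (u_param \<iota> \<omega>) f F" "has_expansion \<iota> (u_param \<iota> \<omega>) f G"
  shows "F = G"
proof -
  obtain R R' where
    F: "\<And>z. z \<in> Omega \<iota> \<Longrightarrow> im_abs \<iota> z \<ge> R \<Longrightarrow> (\<lambda>n. fps_nth F n * u_param \<iota> \<omega> z ^ n) sums f z" and
    G: "\<And>z. z \<in> Omega \<iota> \<Longrightarrow> im_abs \<iota> z \<ge> R' \<Longrightarrow> (\<lambda>n. fps_nth G n * u_param \<iota> \<omega> z ^ n) sums f z"
    using assms unfolding has_expansion_def by auto
  obtain z :: "nat \<Rightarrow> 'c" where z: "\<And>n. im_abs \<iota> (z n) \<ge> max R R'" "\<And>n. z n \<in> Omega \<iota>"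
    "\<And>n. u_param \<iota> \<omega> (z n) \<noteq> 0" "(\<lambda>n. u_param \<iota> \<omega> (z n)) \<longlonglongrightarrow> 0"
    using ex_u_sequence[of "max R R'"] by blast
  show ?thesis
  proof (rule power_series_unique[OF z(4,3)])
    show "(\<lambda>n. fps_nth F n * u_param \<iota> \<omega> (z j) ^ n) sums f (z j)" for j
      using z(1)[of j] z(2)[of j] by (intro F) auto
    show "(\<lambda>n. fps_nth G n * u_param \<iota> \<omega> (z j) ^ n) sums f (z j)" for j
      using z(1)[of j] z(2)[of j] by (intro G) auto
  qed
qed

lemma u_series_eq:
  "has_expansion \<iota> (u_param \<iota> \<omega>) f F \<Longrightarrow> u_series \<iota> \<omega> f = F"
  unfolding u_series_def using has_expansion_unique by (intro the_equality)

lemma has_expansion_mult: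
  assumes "has_expansion \<iota> t f F" "has_expansion \<iota> t g G"
  shows "has_expansion \<iota> t (\<lambda>z. f z * g z) (F * G)"
proof -
  obtain R R' where
    F: "\<And>z. z \<in> Omega \<iota> \<Longrightarrow> im_abs \<iota> z \<ge> R \<Longrightarrow> (\<lambda>n. fps_nth F n * t z ^ n) sums f z" and
    G: "\<And>z. z \<in> Omega \<iota> \<Longrightarrow> im_abs \<iota> z \<ge> R' \<Longrightarrow> (\<lambda>n. fps_nth G n * t z ^ n) sums g z"
    using assms unfolding has_expansion_def by auto
  show ?thesis unfolding has_expansion_def
  proof (intro exI[of _ "max R R'"] ballI impI)
    fix z assume "z \<in> Omega \<iota>" "max R R' \<le> im_abs \<iota> z"
    thus "(\<lambda>n. fps_nth (F * G) n * t z ^ n) sums (f z * g z)"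
      by (intro fps_mult_sums F G) auto
  qed
qed

lemma has_expansion_scale:
  assumes "has_expansion \<iota> t f F"
  shows "has_expansion \<iota> t (\<lambda>z. c * f z) (fps_const c * F)"
  using assms sums_mult_ultrametric unfolding has_expansion_def
  by (simp add: mult.assoc) blast

lemma has_expansion_cong:
  assumes "has_expansion \<iota> t f F" "\<And>z. z \<in> Omega \<iota> \<Longrightarrow> g z = f z"
  shows "has_expansion \<iota> t g F"
  using assms unfolding has_expansion_def by auto

end

section \<open>Cosets and the slash operator\<close>

lemma mat2_nth [simp]:
  "mat2 a b c d $ 1 $ 1 = a" "mat2 a b c d $ 1 $ 2 = b"
  "mat2 a b c d $ 2 $ 1 = c" "mat2 a b c d $ 2 $ 2 = d"
  by (simp_all add: mat2_def)

lemma matrix_2_eqI: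
  fixes A B :: "'b ^ 2 ^ 2"
  assumes "A $ 1 $ 1 = B $ 1 $ 1" "A $ 1 $ 2 = B $ 1 $ 2" "A $ 2 $ 1 = B $ 2 $ 1" "A $ 2 $ 2 = B $ 2 $ 2"
  shows "A = B"
  using assms by (simp add: Finite_Cartesian_Product.vec_eq_iff forall_2)

lemma matrix_mult_2_nth:
  fixes A B :: "'b::semiring_1 ^ 2 ^ 2"
  shows "(A ** B) $ i $ j = A $ i $ 1 * B $ 1 $ j + A $ i $ 2 * B $ 2 $ j"
  by (simp add: matrix_matrix_mult_def sum_2)

lemma mat_1_2_nth [simp]:
  "(mat 1 :: 'b::semiring_1 ^ 2 ^ 2) $ 1 $ 1 = 1" "(mat 1 :: 'b ^ 2 ^ 2) $ 1 $ 2 = 0"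
  "(mat 1 :: 'b ^ 2 ^ 2) $ 2 $ 1 = 0" "(mat 1 :: 'b ^ 2 ^ 2) $ 2 $ 2 = 1"
  by (simp_all add: Finite_Cartesian_Product.mat_def)

lemma map_matrix_nth [simp]: "map_matrix h A $ i $ j = h (A $ i $ j)"
  by (simp add: map_matrix_def)

lemma carrier_GL2_A [simp]: "carrier GL2_A = {M. invertible M}"
  and mult_GL2_A [simp]: "M \<otimes>\<^bsub>GL2_A\<^esub> M' = M ** M'"
  and one_GL2_A [simp]: "\<one>\<^bsub>GL2_A\<^esub> = mat 1"
  by (simp_all add: GL2_A_def)

lemma group_GL2_A: "group (GL2_A :: ('a::field poly ^ 2 ^ 2) monoid)"
proof (rule groupI)
  fix x :: "'a poly ^ 2 ^ 2" assume "x \<in> carrier GL2_A"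
  then obtain y where "x ** y = mat 1" "y ** x = mat 1" by (auto simp: invertible_def)
  thus "\<exists>y\<in>carrier GL2_A. y \<otimes>\<^bsub>GL2_A\<^esub> x = \<one>\<^bsub>GL2_A\<^esub>"
    by (intro bexI[of _ y]) (auto simp: invertible_def)
next
  show "\<one>\<^bsub>GL2_A\<^esub> \<in> carrier (GL2_A :: ('a poly ^ 2 ^ 2) monoid)"
    by (auto simp: invertible_def intro!: exI[of _ "mat 1"])
qed (simp_all add: invertible_mult matrix_mul_assoc)

lemma is_unit_det_GL2_A:
  fixes M :: "'a::field poly ^ 2 ^ 2"
  assumes "invertible M"
  shows "det M dvd 1"
proof -
  obtain M' where "M ** M' = mat 1" using assms by (auto simp: invertible_def)
  hence "det M * det M' = 1" by (metis det_mul det_I)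
  thus ?thesis by (metis dvd_triv_left)
qed

lemma subgroup_Gamma0:
  assumes "prime_elem (\<pi> :: 'a::field poly)"
  shows "subgroup (Gamma0 \<pi>) GL2_A"
proof -
  interpret group "GL2_A :: ('a poly ^ 2 ^ 2) monoid" by (rule group_GL2_A)
  show ?thesis
  proof (rule subgroupI)
    show "Gamma0 \<pi> \<subseteq> carrier GL2_A" by (auto simp: Gamma0_def)
    have "mat 1 \<in> Gamma0 \<pi>" using one_closed by (simp add: Gamma0_def)
    thus "Gamma0 \<pi> \<noteq> {}" by auto
    show "a \<otimes>\<^bsub>GL2_A\<^esub> b \<in> Gamma0 \<pi>" if "a \<in> Gamma0 \<pi>" "b \<in> Gamma0 \<pi>" for a b
      using that by (auto simp: Gamma0_def invertible_mult matrix_mult_2_nth)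
    fix a assume a: "a \<in> Gamma0 \<pi>"
    hence ac: "a \<in> carrier GL2_A" by (simp add: Gamma0_def)
    let ?b = "inv\<^bsub>GL2_A\<^esub> a"
    have "?b ** a = mat 1" using l_inv[OF ac] by simp
    \<comment> \<open>This entry shows that \<pi> divides \<open>?b $ 2 $ 1 * a $ 1 $ 1\<close>. The
      second factor is prime to \<pi>, as otherwise \<pi> would divide the unit
      \<open>det a\<close>.\<close>
    hence "(?b ** a) $ 2 $ 1 = 0" by simp
    hence "?b $ 2 $ 1 * a $ 1 $ 1 = - (?b $ 2 $ 2 * a $ 2 $ 1)"
      by (simp add: matrix_mult_2_nth eq_neg_iff_add_eq_0)
    moreover have \<pi>: "\<pi> dvd a $ 2 $ 1" using a by (simp add: Gamma0_def)
    ultimately have "\<pi> dvd ?b $ 2 $ 1 * a $ 1 $ 1" by simp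
    moreover have "\<not> \<pi> dvd a $ 1 $ 1"
    proof
      assume "\<pi> dvd a $ 1 $ 1"
      hence "\<pi> dvd det a" using \<pi> by (simp add: det_2)
      moreover have "det a dvd 1" using ac by (intro is_unit_det_GL2_A) simp
      ultimately have "\<pi> dvd 1" by (rule dvd_trans)
      with prime_elem_not_unit[OF assms] show False by contradiction
    qed
    ultimately have "\<pi> dvd ?b $ 2 $ 1" using prime_elem_dvd_multD[OF assms] by blast
    thus "?b \<in> Gamma0 \<pi>" using inv_closed[OF ac] by (simp add: Gamma0_def)
  qed
qed

definition coset_rep :: "'a::field poly \<Rightarrow> 'a poly ^ 2 ^ 2" where
  "coset_rep b = mat2 0 (- 1) 1 b"

lemma coset_rep_inverse:
  "coset_rep b ** mat2 b 1 (- 1) 0 = mat 1" "mat2 b 1 (- 1) 0 ** coset_rep b = mat 1"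
  by (auto simp: coset_rep_def matrix_mult_2_nth intro!: matrix_2_eqI)

lemma invertible_coset_rep: "invertible (coset_rep b)"
  using coset_rep_inverse[of b] unfolding invertible_def by blast

lemma inj_coset_rep: "inj coset_rep"
  by (rule injI) (metis coset_rep_def mat2_nth(4))

lemma mat_1_not_coset_rep: "mat 1 \<noteq> coset_rep b"
proof
  assume "mat 1 = coset_rep b"
  hence "(mat 1 :: 'a poly ^ 2 ^ 2) $ 1 $ 1 = coset_rep b $ 1 $ 1" by simp
  thus False by (simp add: coset_rep_def)
qed

text \<open>Left multiplication by \<Gamma>_0 scales the bottom row modulo \<pi>, so cosets
  correspond to points of the projective line over A/\<pi>: (0 : 1) belongs to \<open>mat 1\<close>
  and (1 : b) to \<open>coset_rep b\<close>.\<close>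

lemma (in prime_of_A) rcosets_Gamma0:
  defines "R \<equiv> insert (mat 1) (coset_rep ` {b. degree b < degree \<pi>})"
  shows "rcosets\<^bsub>GL2_A\<^esub> (Gamma0 \<pi>) = (\<lambda>r. Gamma0 \<pi> #>\<^bsub>GL2_A\<^esub> r) ` R"
    and "inj_on (\<lambda>r. Gamma0 \<pi> #>\<^bsub>GL2_A\<^esub> r) R"
proof -
  interpret group "GL2_A :: ('a poly ^ 2 ^ 2) monoid" by (rule group_GL2_A)
  have sub: "subgroup (Gamma0 \<pi>) GL2_A" by (rule subgroup_Gamma0[OF prime])
  have R: "R \<subseteq> carrier GL2_A"
    using one_closed invertible_coset_rep by (auto simp: R_def)
  have coset: "Gamma0 \<pi> #>\<^bsub>GL2_A\<^esub> a = Gamma0 \<pi> #>\<^bsub>GL2_A\<^esub> r"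
    if "g \<in> Gamma0 \<pi>" "a = g ** r" "r \<in> R" for a g r
  proof -
    have "a \<in> Gamma0 \<pi> #>\<^bsub>GL2_A\<^esub> r" using that by (auto simp: r_coset_def)
    thus ?thesis using repr_independence[OF _ _ sub] that(3) R by blast
  qed
  have "\<exists>r\<in>R. Gamma0 \<pi> #>\<^bsub>GL2_A\<^esub> a = Gamma0 \<pi> #>\<^bsub>GL2_A\<^esub> r" if a: "a \<in> carrier GL2_A" for a
  proof (cases "\<pi> dvd a $ 2 $ 1")
    case True
    hence "a \<in> Gamma0 \<pi>" using a by (simp add: Gamma0_def)
    thus ?thesis using coset[of a a "mat 1"] by (intro bexI[of _ "mat 1"]) (auto simp: R_def matrix_mul_rid)
  next
    case False
    let ?c = "a $ 2 $ 1" and ?e = "a $ 2 $ 2"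
    have "CARD('a) ^ 1 \<le> Q" using q_gt_1 degree_pos by (intro power_increasing) auto
    \<comment> \<open>The residue b is to be e/c modulo \<pi>. As \<open>c^Q = c\<close> there, the
      inverse of c is \<open>c^(Q - 2)\<close>; since Q \<ge> 2, the truncated subtraction is
      exact.\<close>
    hence Q: "Q = Suc (Suc (Q - 2))" using q_gt_1 by simp
    obtain b where b: "degree b < degree \<pi>" "\<pi> dvd ?e * ?c ^ (Q - 2) - b" using ex_residue by blast
    have "red ?c \<noteq> 0" using False by (simp add: red_eq_0_iff)
    moreover have "red ?c * (red ?c * red ?c ^ (Q - 2)) = red ?c"
    proof -
      have "red ?c * (red ?c * red ?c ^ (Q - 2)) = red ?c ^ Suc (Suc (Q - 2))" by simp
      also have "\<dots> = red ?c" by (simp only: Q[symmetric] red_power_card)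
      finally show ?thesis .
    qed
    ultimately have inv: "red ?c * red ?c ^ (Q - 2) = 1" by simp
    have "red b = red ?e * red ?c ^ (Q - 2)"
      using b(2) by (simp add: red.hom_mult red.hom_power flip: red_eq_iff)
    hence "red (?c * b) = red ?e * (red ?c * red ?c ^ (Q - 2))"
      by (simp only: red.hom_mult mult_ac)
    hence "red (?c * b) = red ?e" by (simp only: inv mult_1_right)
    hence dvd: "\<pi> dvd ?c * b - ?e" by (simp only: red_eq_iff)
    define g where "g = a ** mat2 b 1 (- 1) 0"
    have "invertible (mat2 b 1 (- 1) 0)" using coset_rep_inverse[of b] unfolding invertible_def by blast
    hence "g \<in> Gamma0 \<pi>"
      using a dvd by (simp add: Gamma0_def g_def invertible_mult matrix_mult_2_nth)
    moreover have "a = g ** coset_rep b"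
      by (simp add: g_def coset_rep_inverse matrix_mul_rid flip: matrix_mul_assoc)
    moreover have "coset_rep b \<in> R" using b by (simp add: R_def)
    ultimately show ?thesis using coset by blast
  qed
  thus "rcosets\<^bsub>GL2_A\<^esub> (Gamma0 \<pi>) = (\<lambda>r. Gamma0 \<pi> #>\<^bsub>GL2_A\<^esub> r) ` R"
    using R unfolding RCOSETS_def by fastforce
  show "inj_on (\<lambda>r. Gamma0 \<pi> #>\<^bsub>GL2_A\<^esub> r) R"
  proof (rule inj_onI)
    have no_one: False if "Gamma0 \<pi> #>\<^bsub>GL2_A\<^esub> mat 1 = Gamma0 \<pi> #>\<^bsub>GL2_A\<^esub> coset_rep b" for b
    proof -
      have "coset_rep b \<in> Gamma0 \<pi> #>\<^bsub>GL2_A\<^esub> mat 1"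
        using rcos_self[OF _ sub, of "coset_rep b"] invertible_coset_rep[of b] that by simp
      hence "coset_rep b \<in> Gamma0 \<pi>" by (auto simp: r_coset_def matrix_mul_rid)
      hence "\<pi> dvd 1" unfolding Gamma0_def coset_rep_def mem_Collect_eq mat2_nth by (rule conjunct2)
      with prime_elem_not_unit[OF prime] show False by contradiction
    qed
    have reps: "b = b'" if b: "degree b < degree \<pi>" "degree b' < degree \<pi>"
      and eq: "Gamma0 \<pi> #>\<^bsub>GL2_A\<^esub> coset_rep b = Gamma0 \<pi> #>\<^bsub>GL2_A\<^esub> coset_rep b'" for b b'
    proof -
      have "coset_rep b \<in> Gamma0 \<pi> #>\<^bsub>GL2_A\<^esub> coset_rep b'"
        using rcos_self[OF _ sub, of "coset_rep b"] invertible_coset_rep[of b] eq by simp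
      then obtain g where g: "g \<in> Gamma0 \<pi>" "coset_rep b = g ** coset_rep b'"
        by (auto simp: r_coset_def)
      hence "coset_rep b ** mat2 b' 1 (- 1) 0 = g"
        by (simp add: coset_rep_inverse matrix_mul_rid flip: matrix_mul_assoc)
      moreover have "(coset_rep b ** mat2 b' 1 (- 1) 0) $ 2 $ 1 = b' - b"
        by (simp add: matrix_mult_2_nth coset_rep_def)
      ultimately have "\<pi> dvd b' - b" using g(1) by (auto simp: Gamma0_def)
      hence "red b' = red b" by (simp add: red_eq_iff)
      thus "b = b'" using inj_onD[OF inj_on_red, of b' b] b by simp
    qed
    fix r r' assume "r \<in> R" "r' \<in> R" "Gamma0 \<pi> #>\<^bsub>GL2_A\<^esub> r = Gamma0 \<pi> #>\<^bsub>GL2_A\<^esub> r'"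
    thus "r = r'"
      unfolding R_def using no_one reps by (elim insertE imageE) (simp, metis, metis, auto)
  qed
qed

section \<open>Values of u at the translates (z + b) / \<pi>\<close>

locale carlitz_prime = carlitz_module \<iota> \<omega> + prime_of_A \<iota> \<pi>
  for \<iota> :: "'a::{field,finite} fls \<Rightarrow> 'c::{ultrametric_field,complete_space,alg_closed_field}"
    and \<omega> :: 'c and \<pi> :: "'a poly"
begin

abbreviation residues :: "'a poly set" where
  "residues \<equiv> {b. degree b < degree \<pi>}"

abbreviation translate :: "'c \<Rightarrow> 'a poly \<Rightarrow> 'c" where
  "translate z b \<equiv> (z + emb_A \<iota> b) / emb_A \<iota> \<pi>"

lemma prime_nonzero [simp]: "\<pi> \<noteq> 0"
  using degree_pos by auto

lemma translate_eq: "translate z b = \<iota> (inverse (fls_of_A \<pi>)) * z + \<iota> (fls_of_A b / fls_of_A \<pi>)"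
  by (simp only: emb_inverse emb_divide divide_inverse distrib_left distrib_right emb_mult mult.commute)

lemma im_abs_translate: "im_abs \<iota> (translate z b) \<ge> im_abs \<iota> z / absval (emb_A \<iota> \<pi>)"
proof -
  have "absval (\<iota> (inverse (fls_of_A \<pi>))) * im_abs \<iota> z \<le> im_abs \<iota> (translate z b)"
    unfolding translate_eq by (rule im_abs_affine_ge) simp
  thus ?thesis by (simp add: emb_inverse absval_inverse divide_inverse mult.commute)
qed

lemma im_abs_translate_pos: "im_abs \<iota> z > 0 \<Longrightarrow> im_abs \<iota> (translate z b) > 0"
  by (rule less_le_trans[OF _ im_abs_translate]) simp

context
  fixes z :: 'c
  assumes z: "im_abs \<iota> z > 0"
begin

private abbreviation y where "y b \<equiv> u_param \<iota> \<omega> (translate z b)"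

lemma u_translate_inj: "inj_on y residues"
proof (rule inj_onI)
  fix b b' assume b: "b \<in> residues" "b' \<in> residues" and eq: "y b = y b'"
  define x where "x b = \<omega> * translate z b" for b
  have "cexp (x b) = cexp (x b')"
    using eq by (simp add: u_param_eq x_def)
  moreover have "cexp (x b) = cexp (x b - x b') + cexp (x b')" by (simp flip: cexp_add)
  ultimately have "cexp (x b - x b') = 0" by simp
  then obtain a where "x b - x b' = \<omega> * emb_A \<iota> a"
    by (auto simp: cexp_eq_0_iff scaled_lattice_def)
  moreover have "x b - x b' = \<omega> * ((emb_A \<iota> b - emb_A \<iota> b') / emb_A \<iota> \<pi>)"
    by (simp add: x_def flip: right_diff_distrib diff_divide_distrib)
  ultimately have "\<omega> * ((emb_A \<iota> b - emb_A \<iota> b') / emb_A \<iota> \<pi>) = \<omega> * emb_A \<iota> a"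
    by (simp only:)
  hence "(emb_A \<iota> b - emb_A \<iota> b') / emb_A \<iota> \<pi> = emb_A \<iota> a"
    by (simp only: mult_left_cancel[OF period_nonzero])
  hence "emb_A \<iota> (b - b') = emb_A \<iota> (a * \<pi>)"
    by (simp add: emb_A.hom_minus emb_A.hom_mult divide_eq_eq)
  hence "b - b' = a * \<pi>" by (simp only: emb_A_eq_iff)
  hence "red b = red b'" by (simp add: red_eq_iff)
  thus "b = b'" using inj_onD[OF inj_on_red] b by blast
qed

text \<open>Applying \<rho>_\<pi> to the exponential at \<omega>(z + b)/\<pi> gives the exponential
  at \<omega>(z + b), which is that at \<omega>z. Multiplication by \<open>u(z)\<close> and by the
  Q-th power of \<open>y b\<close> turns this into the root equation.\<close>

lemma u_translate_root: "poly (torsion_poly (\<iota> fls_X_inv) (u_param \<iota> \<omega> z)) (y b) = 0"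
proof -
  let ?x = "cexp (\<omega> * translate z b)" and ?c = "\<lambda>j. emb_A \<iota> (carlitz_coeff \<pi> j)"
  have "cexp (\<omega> * z) = cexp (\<omega> * (z + emb_A \<iota> b))" by (rule cexp_periodic[symmetric])
  also have "\<omega> * (z + emb_A \<iota> b) = emb_A \<iota> \<pi> * (\<omega> * translate z b)" by simp
  also have "cexp \<dots> = (\<Sum>j\<le>degree \<pi>. ?c j * ?x ^ (CARD('a) ^ j))"
    by (simp only: cexp_carlitz carlitz_eq)
  finally have e: "cexp (\<omega> * z) = (\<Sum>j\<le>degree \<pi>. ?c j * ?x ^ (CARD('a) ^ j))" .
  have x: "?x \<noteq> 0" using u_param_bounds(1)[OF im_abs_translate_pos[OF z], of b] by (simp add: u_param_eq)
  have e0: "cexp (\<omega> * z) \<noteq> 0" using u_param_bounds(1)[OF z] by (simp add: u_param_eq)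
  have "y b ^ (Q - CARD('a) ^ j) = y b ^ Q * ?x ^ (CARD('a) ^ j)" if "j \<le> degree \<pi>" for j
  proof -
    have "CARD('a) ^ j \<le> Q" using that q_gt_1 by (intro power_increasing) simp_all
    thus ?thesis using x by (simp add: u_param_eq power_diff power_one_over)
  qed
  hence "(\<Sum>j\<le>degree \<pi>. ?c j * y b ^ (Q - CARD('a) ^ j)) = y b ^ Q * cexp (\<omega> * z)"
    unfolding e sum_distrib_left by (intro sum.cong) simp_all
  hence "u_param \<iota> \<omega> z * (\<Sum>j\<le>degree \<pi>. ?c j * y b ^ (Q - CARD('a) ^ j)) = y b ^ Q"
    using e0 by (simp add: u_param_eq)
  thus ?thesis unfolding poly_torsion_poly by (simp only: emb_A_eq_eval_A diff_self)
qed

lemma torsion_poly_u: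
  "torsion_poly (\<iota> fls_X_inv) (u_param \<iota> \<omega> z) = (\<Prod>b\<in>residues. [:- y b, 1:])"
proof -
  have "torsion_poly (\<iota> fls_X_inv) (u_param \<iota> \<omega> z) = (\<Prod>s\<in>y ` residues. [:- s, 1:])"
  proof (rule monic_eq_prod_roots)
    show "card (y ` residues) = degree (torsion_poly (\<iota> fls_X_inv) (u_param \<iota> \<omega> z))"
      using degree_pos by (simp only: card_image[OF u_translate_inj] degree_torsion_poly card_poly_degree_less)
  qed (use u_translate_root finite_degree_less degree_torsion_poly in auto)
  thus ?thesis by (simp only: prod.reindex[OF u_translate_inj] o_def)
qed

text \<open>Up to sign, both sides are the constant term of the torsion polynomial. Because of this
  identity the product over b begins with the same power of u as f.\<close>

lemma prod_u_translate: "(\<Prod>b\<in>residues. y b) = u_param \<iota> \<omega> z"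
proof -
  let ?T = "torsion_poly (\<iota> fls_X_inv) (u_param \<iota> \<omega> z)"
  \<comment> \<open>Additivity of the Q-th power gives the sign in every characteristic, with no
    case distinction on the parity of Q.\<close>
  have "(-1 :: 'c) ^ Q + 1 ^ Q = (-1 + 1) ^ Q" by (simp only: power_card_power_add)
  hence m1: "(-1 :: 'c) ^ Q = - 1" using q_gt_1 by (simp add: eq_neg_iff_add_eq_0)
  \<comment> \<open>At Y = 0 only the exponent \<open>Q - Q\<close> survives, through
    \<open>0 ^ 0 = 1\<close>.\<close>
  have "(\<Sum>j\<le>degree \<pi>. emb_A \<iota> (carlitz_coeff \<pi> j) * 0 ^ (Q - CARD('a) ^ j)) =
      (\<Sum>j\<in>{degree \<pi>}. emb_A \<iota> (carlitz_coeff \<pi> j) * 0 ^ (Q - CARD('a) ^ j))"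
  proof (rule sum.mono_neutral_right)
    show "\<forall>j\<in>{..degree \<pi>} - {degree \<pi>}. emb_A \<iota> (carlitz_coeff \<pi> j) * 0 ^ (Q - CARD('a) ^ j) = 0"
    proof
      fix j assume "j \<in> {..degree \<pi>} - {degree \<pi>}"
      hence "CARD('a) ^ j < Q" using q_gt_1 by (intro power_strict_increasing) auto
      thus "emb_A \<iota> (carlitz_coeff \<pi> j) * 0 ^ (Q - CARD('a) ^ j) = 0" by simp
    qed
  qed auto
  also have "\<dots> = 1" by (simp add: carlitz_coeff_degree monic flip: one_pCons)
  finally have "poly ?T 0 = - u_param \<iota> \<omega> z"
    using q_gt_1 unfolding poly_torsion_poly emb_A_eq_eval_A by simp
  moreover have "poly ?T 0 = (\<Prod>b\<in>residues. (- 1) * y b)"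
    by (simp add: torsion_poly_u poly_prod)
  moreover have "\<dots> = (- 1) ^ card residues * (\<Prod>b\<in>residues. y b)"
    by (simp only: prod.distrib prod_constant)
  moreover have "card residues = Q" using degree_pos by (rule card_poly_degree_less)
  ultimately show ?thesis by (simp add: m1)
qed

end

text \<open>The factors are the values of \<open>F\<close> at the roots of the torsion polynomial at \<open>u(z)\<close>.\<close>

lemma ex_expansion_prod_translates:
  fixes F :: "'a poly fps" and f :: "'c \<Rightarrow> 'c"
  assumes F: "has_expansion \<iota> (u_param \<iota> \<omega>) f (Abs_fps (\<lambda>n. emb_A \<iota> (fps_nth F n)))"
    and lead: "fps_nth F (subdegree F) = 1"
  shows "\<exists>G. fps_nth G (subdegree G) = 1 \<and> (\<forall>m. \<pi> dvd fps_nth (G - F) m) \<and>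
    has_expansion \<iota> (u_param \<iota> \<omega>) (\<lambda>z. \<Prod>b\<in>residues. f (translate z b))
      (Abs_fps (\<lambda>n. emb_A \<iota> (fps_nth G n)))"
proof -
  let ?u = "u_param \<iota> \<omega>"
  define n where "n = subdegree F"
  \<comment> \<open>Division by \<open>u^n\<close> leaves a series with constant term 1, the form to
    which \<open>ex_norm_series\<close> applies.\<close>
  define a where "a m = fps_nth F (n + m)" for m
  obtain R where R: "\<And>z. z \<in> Omega \<iota> \<Longrightarrow> im_abs \<iota> z \<ge> R \<Longrightarrow>
      (\<lambda>m. emb_A \<iota> (fps_nth F m) * ?u z ^ m) sums f z"
    using F unfolding has_expansion_def by auto
  have shift: "(\<lambda>m. emb_A \<iota> (a m) * ?u z ^ m) sums (\<Sum>m. emb_A \<iota> (a m) * ?u z ^ m)"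
    "f z = ?u z ^ n * (\<Sum>m. emb_A \<iota> (a m) * ?u z ^ m)"
    if z: "z \<in> Omega \<iota>" "im_abs \<iota> z \<ge> R" "?u z \<noteq> 0" for z
  proof -
    have "(\<lambda>m. emb_A \<iota> (fps_nth F (m + n)) * ?u z ^ (m + n)) \<longlonglongrightarrow> 0"
      using sums_tendsto_zero[OF R[OF z(1,2)]] by (rule LIMSEQ_ignore_initial_segment)
    hence "(\<lambda>m. inverse (?u z ^ n) * (emb_A \<iota> (fps_nth F (m + n)) * ?u z ^ (m + n))) \<longlonglongrightarrow>
        inverse (?u z ^ n) * 0" by (intro tendsto_mult tendsto_const)
    moreover have "inverse (?u z ^ n) * (emb_A \<iota> (fps_nth F (m + n)) * ?u z ^ (m + n)) =
        emb_A \<iota> (a m) * ?u z ^ m" for m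
      using z(3) by (simp add: a_def power_add add.commute)
    ultimately have "(\<lambda>m. emb_A \<iota> (a m) * ?u z ^ m) \<longlonglongrightarrow> 0" by simp
    hence "summable (\<lambda>m. emb_A \<iota> (a m) * ?u z ^ m)" by (rule summable_ultrametric)
    thus s: "(\<lambda>m. emb_A \<iota> (a m) * ?u z ^ m) sums (\<Sum>m. emb_A \<iota> (a m) * ?u z ^ m)"
      by (rule summable_sums)
    have "(\<lambda>m. fps_nth (fps_X ^ n * Abs_fps (\<lambda>m. emb_A \<iota> (a m))) m * ?u z ^ m) sums
        (?u z ^ n * (\<Sum>m. emb_A \<iota> (a m) * ?u z ^ m))"
      by (rule fps_mult_sums[OF fps_X_power_sums]) (simp add: s)
    moreover have "fps_nth (fps_X ^ n * Abs_fps (\<lambda>m. emb_A \<iota> (a m))) m = emb_A \<iota> (fps_nth F m)" for m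
      by (auto simp: fps_X_power_mult_nth a_def n_def)
    ultimately show "f z = ?u z ^ n * (\<Sum>m. emb_A \<iota> (a m) * ?u z ^ m)"
      using R[OF z(1,2)] by (simp add: sums_unique2)
  qed
  obtain w :: "nat \<Rightarrow> 'c" where w: "\<And>i. im_abs \<iota> (w i) \<ge> R" "\<And>i. w i \<in> Omega \<iota>" "\<And>i. ?u (w i) \<noteq> 0"
    "(\<lambda>i. ?u (w i)) \<longlonglongrightarrow> 0"
    using ex_u_sequence[of R] by blast
  \<comment> \<open>A single point of the convergence region with |u| \<le> 1 serves as
    \<open>y0\<close> in \<open>ex_norm_series\<close>.\<close>
  have "eventually (\<lambda>i. absval (?u (w i)) < 1) sequentially"
    using order_tendstoD(2)[OF tendsto_absval[OF w(4)], of 1] by simp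
  then obtain i where i: "absval (?u (w i)) \<le> 1"
    using eventually_happens'[OF sequentially_bot] less_imp_le by blast
  have a0: "a 0 = 1" using lead by (simp add: a_def n_def)
  from ex_norm_series[of a "?u (w i)", OF a0 w(3) i sums_tendsto_zero[OF shift(1)[OF w(2,1,3)]]]
  obtain g and r :: 'c where g: "g 0 = 1" "\<forall>m. \<pi> dvd g m - a m" "r \<noteq> 0"
    "\<forall>v ys s. absval v \<le> absval r \<longrightarrow> torsion_poly (\<iota> fls_X_inv) v = (\<Prod>y\<leftarrow>ys. [:- y, 1:]) \<longrightarrow>
      (\<forall>y\<in>set ys. (\<lambda>n. emb_A \<iota> (a n) * y ^ n) sums s y) \<longrightarrow>
      (\<lambda>m. emb_A \<iota> (g m) * v ^ m) sums (\<Prod>y\<leftarrow>ys. s y)"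
    by (elim exE conjE)
  define G where "G = fps_X ^ n * Abs_fps g"
  have G_nth: "fps_nth G m = (if m < n then 0 else g (m - n))" for m
    by (simp add: G_def fps_X_power_mult_nth)
  have "subdegree G = n" using g(1) by (intro subdegreeI) (auto simp: G_nth)
  hence leadG: "fps_nth G (subdegree G) = 1" using g(1) by (simp add: G_nth)
  have cong: "\<pi> dvd fps_nth (G - F) m" for m
  proof (cases "m < n")
    case True
    thus ?thesis by (simp add: G_nth n_def nth_less_subdegree_zero)
  next
    case False
    hence "fps_nth (G - F) m = g (m - n) - a (m - n)" by (simp add: G_nth a_def)
    thus ?thesis using g(2) by simp
  qed
  define p where "p = absval (emb_A \<iota> \<pi>)"
  have p: "p > 0" by (simp add: p_def)
  \<comment> \<open>The three bounds make the distance to \<open>K\<^sub>\<infinity>\<close>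
    positive, keep all translates in the region where f has its expansion, and force |u(z)| \<le>
    |r|.\<close>
  define R' where "R' = max 1 (max (R * p) (1 / (absval \<omega> * absval r)))"
  have "(\<lambda>m. fps_nth (Abs_fps (\<lambda>n. emb_A \<iota> (fps_nth G n))) m * ?u z ^ m) sums
      (\<Prod>b\<in>residues. f (translate z b))" if z: "z \<in> Omega \<iota>" "im_abs \<iota> z \<ge> R'" for z
  proof -
    have pos: "im_abs \<iota> z > 0" using z(2) by (simp add: R'_def)
    have v: "absval (?u z) \<le> absval r"
    proof -
      have "1 / (absval \<omega> * absval r) \<le> im_abs \<iota> z" using z(2) by (simp add: R'_def)
      hence "1 \<le> im_abs \<iota> z * (absval \<omega> * absval r)" using g(3) by (simp add: pos_divide_le_eq)
      hence "1 / (absval \<omega> * im_abs \<iota> z) \<le> absval r"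
        using pos by (simp add: pos_divide_le_eq mult_ac)
      thus ?thesis using u_param_bounds(2)[OF pos] by linarith
    qed
    have y: "translate z b \<in> Omega \<iota>" "im_abs \<iota> (translate z b) \<ge> R" "?u (translate z b) \<noteq> 0" for b
    proof -
      show "translate z b \<in> Omega \<iota>" by (rule im_abs_pos_imp_Omega[OF im_abs_translate_pos[OF pos]])
      have "R * p \<le> im_abs \<iota> z" using z(2) by (simp add: R'_def)
      hence "R \<le> im_abs \<iota> z / p" using p by (simp add: pos_le_divide_eq)
      thus "im_abs \<iota> (translate z b) \<ge> R" using im_abs_translate[of z b] by (simp add: p_def)
      show "?u (translate z b) \<noteq> 0" by (rule u_param_bounds(1)[OF im_abs_translate_pos[OF pos]])
    qed
    let ?y = "\<lambda>b. ?u (translate z b)"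
    define s where "s y = (\<Sum>m. emb_A \<iota> (a m) * y ^ m)" for y
    obtain bs where bs: "set bs = residues" "distinct bs"
      using finite_distinct_list[OF finite_degree_less] by blast
    have prod_bs: "(\<Prod>b\<in>residues. h b) = (\<Prod>b\<leftarrow>bs. h b)" for h :: "'a poly \<Rightarrow> 'x::comm_monoid_mult"
      by (simp add: prod.distinct_set_conv_list[OF bs(2)] flip: bs(1))
    have T: "torsion_poly (\<iota> fls_X_inv) (?u z) = (\<Prod>y\<leftarrow>map ?y bs. [:- y, 1:])"
      by (simp add: torsion_poly_u[OF pos] prod_bs o_def)
    have sums: "\<forall>y\<in>set (map ?y bs). (\<lambda>n. emb_A \<iota> (a n) * y ^ n) sums s y"
      using shift(1)[OF y] by (auto simp: s_def)
    have "(\<lambda>m. emb_A \<iota> (g m) * ?u z ^ m) sums (\<Prod>y\<leftarrow>map ?y bs. s y)"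
      using g(4) v T sums by blast
    hence "(\<lambda>m. emb_A \<iota> (g m) * ?u z ^ m) sums (\<Prod>b\<in>residues. s (?y b))"
      by (simp add: prod_bs o_def)
    hence "(\<lambda>m. fps_nth (fps_X ^ n * Abs_fps (\<lambda>m. emb_A \<iota> (g m))) m * ?u z ^ m) sums
        (?u z ^ n * (\<Prod>b\<in>residues. s (?y b)))"
      by (intro fps_mult_sums[OF fps_X_power_sums]) simp
    moreover have "fps_X ^ n * Abs_fps (\<lambda>m. emb_A \<iota> (g m)) = Abs_fps (\<lambda>n. emb_A \<iota> (fps_nth G n))"
      by (rule fps_ext) (simp add: fps_X_power_mult_nth G_nth)
    \<comment> \<open>The factors \<open>u^n\<close> split off at the translates multiply to
      \<open>u(z)^n\<close>, by \<open>prod_u_translate\<close>.\<close>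
    moreover have "(\<Prod>b\<in>residues. f (translate z b)) = ?u z ^ n * (\<Prod>b\<in>residues. s (?y b))"
    proof -
      have "(\<Prod>b\<in>residues. f (translate z b)) = (\<Prod>b\<in>residues. ?y b ^ n * s (?y b))"
        by (rule prod.cong) (simp_all only: shift(2)[OF y] s_def)
      also have "\<dots> = (\<Prod>b\<in>residues. ?y b) ^ n * (\<Prod>b\<in>residues. s (?y b))"
        by (simp only: prod.distrib prod_power_distrib)
      finally show ?thesis by (simp only: prod_u_translate[OF pos])
    qed
    ultimately show ?thesis by simp
  qed
  hence "has_expansion \<iota> ?u (\<lambda>z. \<Prod>b\<in>residues. f (translate z b)) (Abs_fps (\<lambda>n. emb_A \<iota> (fps_nth G n)))"
    unfolding has_expansion_def by blast
  thus ?thesis using leadG cong by blast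
qed

end


section \<open>The action of matrices on the half plane\<close>

context C_infinity
begin

lemma Omega_affine:
  assumes "z \<in> Omega \<iota>" "a \<noteq> 0"
  shows "\<iota> a * z + \<iota> b \<in> Omega \<iota>"
proof -
  have False if "\<iota> a * z + \<iota> b = \<iota> x" for x
  proof -
    have "\<iota> a * z = \<iota> (x - b)" using that by (simp add: emb.hom_minus eq_diff_eq)
    hence "z = \<iota> ((x - b) / a)" using assms(2) by (simp add: emb_divide eq_divide_eq mult.commute)
    thus False using assms(1) by (simp add: Omega_def)
  qed
  thus ?thesis by (auto simp: Omega_def)
qed

lemma Omega_minus_inverse:
  assumes "z \<in> Omega \<iota>"
  shows "- 1 / z \<in> Omega \<iota>"
proof -
  have "z = \<iota> (- 1 / x)" if "- 1 / z = \<iota> x" for x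
  proof -
    have "z = - 1 / (- 1 / z)" by simp
    also have "\<dots> = \<iota> (- 1 / x)" by (simp only: that emb_divide emb.hom_uminus emb_one)
    finally show ?thesis .
  qed
  thus ?thesis using assms by (auto simp: Omega_def)
qed

lemma Omega_nonzero: "z \<in> Omega \<iota> \<Longrightarrow> z \<noteq> 0"
  using emb.hom_zero rangeI[of \<iota> 0] by (auto simp: Omega_def)

lemma half_powi_nonzero:
  assumes "x \<noteq> (0 :: 'c)"
  shows "half_powi x k \<noteq> 0"
proof -
  obtain s where "s ^ 2 = x" using nth_root_exists[of 2 x] by auto
  hence "(SOME s. s ^ 2 = x) ^ 2 = x" by (rule someI)
  hence "(SOME s. s ^ 2 = x) \<noteq> 0" using assms by auto
  thus ?thesis by (simp add: half_powi_def power_int_not_zero)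
qed

lemma leading_const_nonzero: "x \<noteq> 0 \<Longrightarrow> leading_const x \<noteq> 0"
  by (simp add: leading_const_def)

text \<open>Isolates the part of the slash operator that does not depend on z. Only its nonvanishing
  is recorded, whichever square root is chosen.\<close>

lemma slash_eq:
  assumes "det \<gamma> \<noteq> 0"
  shows "\<exists>c. c \<noteq> 0 \<and> (\<forall>z. slash \<iota> k l f \<gamma> z = c * (automorphy \<iota> \<gamma> z powi (- k) * f (moebius_act \<iota> \<gamma> z)))"
proof (intro exI conjI allI)
  let ?c = "\<iota> (leading_const (det \<gamma>)) powi l *
     half_powi (\<iota> (det \<gamma> / leading_const (det \<gamma>))) k"
  show "slash \<iota> k l f \<gamma> z = ?c * (automorphy \<iota> \<gamma> z powi (- k) * f (moebius_act \<iota> \<gamma> z))" for z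
    by (simp add: slash_def mult.assoc)
  show "?c \<noteq> 0"
    using assms leading_const_nonzero[OF assms]
    by (intro no_zero_divisors half_powi_nonzero power_int_not_zero) simp_all
qed

lemma det_fls_mat_nonzero:
  assumes "invertible (M :: 'a poly ^ 2 ^ 2)"
  shows "det (fls_mat_of_A M) \<noteq> 0" "det M \<noteq> 0"
proof -
  interpret fls: comm_ring_hom "fls_of_A :: 'a poly \<Rightarrow> _" by (rule fls_of_A_hom)
  show "det M \<noteq> 0" using is_unit_det_GL2_A[OF assms] by auto
  moreover have "det (fls_mat_of_A M) = fls_of_A (det M)"
    by (simp add: det_2 fls.hom_minus fls.hom_mult)
  ultimately show "det (fls_mat_of_A M) \<noteq> 0" by simp
qed

lemma automorphy_nonzero:
  assumes "z \<in> Omega \<iota>" "det \<gamma> \<noteq> 0"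
  shows "automorphy \<iota> \<gamma> z \<noteq> 0"
proof (cases "\<gamma> $ 2 $ 1 = 0")
  case True
  thus ?thesis using assms(2) by (auto simp: automorphy_def det_2)
next
  case False
  thus ?thesis unfolding automorphy_def using Omega_affine[OF assms(1) False] by (intro Omega_nonzero)
qed

lemma fls_mat_mult: "fls_mat_of_A (M ** M') = fls_mat_of_A M ** fls_mat_of_A (M' :: 'a poly ^ 2 ^ 2)"
proof -
  interpret fls: comm_ring_hom "fls_of_A :: 'a poly \<Rightarrow> _" by (rule fls_of_A_hom)
  show ?thesis by (rule matrix_2_eqI) (simp_all add: matrix_mult_2_nth fls.hom_add fls.hom_mult)
qed

lemma automorphy_mult:
  assumes "automorphy \<iota> \<delta> z \<noteq> 0"
  shows "automorphy \<iota> (\<gamma> ** \<delta>) z = automorphy \<iota> \<gamma> (moebius_act \<iota> \<delta> z) * automorphy \<iota> \<delta> z"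
proof -
  have "automorphy \<iota> \<gamma> (moebius_act \<iota> \<delta> z) * automorphy \<iota> \<delta> z =
      \<iota> (\<gamma> $ 2 $ 1) * (moebius_act \<iota> \<delta> z * automorphy \<iota> \<delta> z) + \<iota> (\<gamma> $ 2 $ 2) * automorphy \<iota> \<delta> z"
    by (simp only: automorphy_def[of \<iota> \<gamma>] distrib_right mult.assoc)
  also have "moebius_act \<iota> \<delta> z * automorphy \<iota> \<delta> z = \<iota> (\<delta> $ 1 $ 1) * z + \<iota> (\<delta> $ 1 $ 2)"
    using assms by (simp add: moebius_act_def)
  finally show ?thesis
    by (simp add: automorphy_def matrix_mult_2_nth emb_add emb_mult algebra_simps)
qed

lemma moebius_act_mult:
  assumes "automorphy \<iota> \<delta> z \<noteq> 0"
  shows "moebius_act \<iota> (\<gamma> ** \<delta>) z = moebius_act \<iota> \<gamma> (moebius_act \<iota> \<delta> z)"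
proof -
  let ?j = "automorphy \<iota> \<delta> z" and ?w = "moebius_act \<iota> \<delta> z"
  have w: "?w * ?j = \<iota> (\<delta> $ 1 $ 1) * z + \<iota> (\<delta> $ 1 $ 2)"
    using assms by (simp add: moebius_act_def)
  have "(\<iota> (\<gamma> $ 1 $ 1) * ?w + \<iota> (\<gamma> $ 1 $ 2)) * ?j =
      \<iota> (\<gamma> $ 1 $ 1) * (?w * ?j) + \<iota> (\<gamma> $ 1 $ 2) * ?j"
    by (simp only: distrib_right mult.assoc)
  also have "\<dots> = \<iota> ((\<gamma> ** \<delta>) $ 1 $ 1) * z + \<iota> ((\<gamma> ** \<delta>) $ 1 $ 2)"
    unfolding w by (simp add: automorphy_def matrix_mult_2_nth emb_add emb_mult algebra_simps)
  finally have "\<iota> ((\<gamma> ** \<delta>) $ 1 $ 1) * z + \<iota> ((\<gamma> ** \<delta>) $ 1 $ 2) =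
      (\<iota> (\<gamma> $ 1 $ 1) * ?w + \<iota> (\<gamma> $ 1 $ 2)) * ?j" ..
  hence "moebius_act \<iota> (\<gamma> ** \<delta>) z =
      ((\<iota> (\<gamma> $ 1 $ 1) * ?w + \<iota> (\<gamma> $ 1 $ 2)) * ?j) / (automorphy \<iota> \<gamma> ?w * ?j)"
    unfolding moebius_act_def[of \<iota> "\<gamma> ** \<delta>"] automorphy_mult[OF assms] by simp
  also have "\<dots> = moebius_act \<iota> \<gamma> ?w"
    unfolding moebius_act_def[of \<iota> \<gamma>] using assms by simp
  finally show ?thesis .
qed

end

section \<open>The norm of a Fricke eigenform\<close>

locale fricke_form = carlitz_prime \<iota> \<omega> \<pi>
  for \<iota> :: "'a::{field,finite} fls \<Rightarrow> 'c::{ultrametric_field,complete_space,alg_closed_field}"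
    and \<omega> :: 'c and \<pi> :: "'a poly" +
  fixes k l :: int and f :: "'c \<Rightarrow> 'c"
  assumes modular: "drinfeld_modular_form \<iota> \<omega> (Gamma0 \<pi>) k l f"
    and fricke: "fricke_eigenform \<iota> \<pi> k l f"
begin

text \<open>The cusp condition at the identity matrix: the cusp ideal is all of A, so the
  uniformiser is u, and the slash operator contributes a nonzero constant.\<close>

lemma ex_expansion: "\<exists>F. has_expansion \<iota> (u_param \<iota> \<omega>) f F"
proof -
  interpret group "GL2_A :: ('a poly ^ 2 ^ 2) monoid" by (rule group_GL2_A)
  interpret fls: comm_ring_hom "fls_of_A :: 'a poly \<Rightarrow> _" by (rule fls_of_A_hom)
  let ?I = "mat 1 :: 'a poly ^ 2 ^ 2"
  have I: "?I \<in> carrier GL2_A" using one_closed by simp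
  have "matrix_inv ?I = mat 1"
    unfolding matrix_inv_def by (rule some_equality) (auto simp: matrix_mul_lid matrix_mul_rid)
  moreover have "invertible (mat2 1 b 0 1 :: 'a poly ^ 2 ^ 2)" for b
    unfolding invertible_def
    by (rule exI[of _ "mat2 1 (- b) 0 1"]) (auto simp: matrix_mult_2_nth intro!: matrix_2_eqI)
  ultimately have "cusp_ideal (Gamma0 \<pi>) ?I = UNIV"
    by (auto simp: cusp_ideal_def Gamma0_def matrix_mul_lid matrix_mul_rid)
  then obtain F where F: "has_expansion \<iota> (u_param \<iota> \<omega>) (slash \<iota> k l f (fls_mat_of_A ?I)) F"
    using modular I by (auto simp: drinfeld_modular_form_def analytic_at_cusps_def)
  obtain c where c: "c \<noteq> 0" "\<And>z. slash \<iota> k l f (fls_mat_of_A ?I) z =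
      c * (automorphy \<iota> (fls_mat_of_A ?I) z powi (- k) * f (moebius_act \<iota> (fls_mat_of_A ?I) z))"
    using slash_eq[OF det_fls_mat_nonzero(1), of ?I k l f] I unfolding carrier_GL2_A mem_Collect_eq by blast
  have "slash \<iota> k l f (fls_mat_of_A ?I) z = c * f z" for z
    unfolding c(2) by (simp add: automorphy_def moebius_act_def)
  hence "f z = inverse c * slash \<iota> k l f (fls_mat_of_A ?I) z" for z using c(1) by simp
  hence "has_expansion \<iota> (u_param \<iota> \<omega>) f (fps_const (inverse c) * F)"
    by (intro has_expansion_cong[OF has_expansion_scale[OF F]])
  thus ?thesis by blast
qed

lemma has_expansion_u_series: "has_expansion \<iota> (u_param \<iota> \<omega>) f (u_series \<iota> \<omega> f)"
  using ex_expansion u_series_eq by metis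

text \<open>The eigenvalue cannot be 0, because the Fricke matrix permutes the half plane and f is
  not identically 0 there.\<close>

lemma fricke_functional_eq:
  "\<exists>c. c \<noteq> 0 \<and> (\<forall>w\<in>Omega \<iota>. (emb_A \<iota> \<pi> * w) powi (- k) * f (- 1 / (emb_A \<iota> \<pi> * w)) = c * f w)"
proof -
  let ?W = "fricke_matrix \<pi>" and ?p = "emb_A \<iota> \<pi>"
  note \<pi> = prime_nonzero
  have det: "det ?W \<noteq> 0" using \<pi> by (simp add: fricke_matrix_def det_2)
  have aut: "automorphy \<iota> ?W w = ?p * w" "moebius_act \<iota> ?W w = - 1 / (?p * w)" for w
    by (simp_all add: automorphy_def moebius_act_def fricke_matrix_def emb.hom_uminus emb_one)
  obtain K where K: "K \<noteq> 0" "\<And>w. slash \<iota> k l f ?W w = K * ((?p * w) powi (- k) * f (- 1 / (?p * w)))"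
    using slash_eq[OF det, of k l f] unfolding aut by blast
  obtain z0 \<mu> where z0: "z0 \<in> Omega \<iota>" "f z0 \<noteq> 0"
    and \<mu>: "\<And>w. w \<in> Omega \<iota> \<Longrightarrow> slash \<iota> k l f ?W w = \<mu> * f w"
    using fricke unfolding fricke_eigenform_def by blast
  have "\<mu> \<noteq> 0"
  proof
    assume "\<mu> = 0"
    \<comment> \<open>The point that the Fricke matrix sends to \<open>z0\<close>.\<close>
    define w where "w = - 1 / (?p * z0)"
    have "?p * z0 \<in> Omega \<iota>" using Omega_affine[OF z0(1), of "fls_of_A \<pi>" 0] \<pi> by simp
    hence w: "w \<in> Omega \<iota>" unfolding w_def by (rule Omega_minus_inverse)
    have w0: "?p * w \<noteq> 0" using Omega_nonzero[OF w] \<pi> by simp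
    have "- 1 / (?p * w) = z0" using \<pi> Omega_nonzero[OF z0(1)] by (simp add: w_def)
    hence "K * ((?p * w) powi (- k) * f z0) = 0" using K(2)[of w] \<mu>[OF w] \<open>\<mu> = 0\<close> by simp
    thus False using K(1) w0 z0(2) by (simp add: power_int_not_zero)
  qed
  show ?thesis
  proof (intro exI[of _ "\<mu> / K"] conjI ballI)
    show "\<mu> / K \<noteq> 0" using \<open>\<mu> \<noteq> 0\<close> K(1) by simp
    show "(?p * w) powi (- k) * f (- 1 / (?p * w)) = \<mu> / K * f w" if "w \<in> Omega \<iota>" for w
      using K(1) K(2)[of w] \<mu>[OF that] by (simp add: field_simps)
  qed
qed

text \<open>\<open>norm_form\<close> takes an unspecified element of each coset. By modularity, any
  choice differs from the representative r by a constant factor: the automorphy factors cancel and a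
  power of the determinant remains.\<close>

lemma slash_coset:
  assumes r: "invertible r" and \<gamma>: "\<gamma> \<in> Gamma0 \<pi> #>\<^bsub>GL2_A\<^esub> r"
    and moeb: "\<And>z. z \<in> Omega \<iota> \<Longrightarrow> moebius_act \<iota> (fls_mat_of_A r) z \<in> Omega \<iota>"
  shows "\<exists>c. c \<noteq> 0 \<and> (\<forall>z\<in>Omega \<iota>. slash \<iota> k l f (fls_mat_of_A \<gamma>) z =
    c * (automorphy \<iota> (fls_mat_of_A r) z powi (- k) * f (moebius_act \<iota> (fls_mat_of_A r) z)))"
proof -
  obtain g where g: "g \<in> Gamma0 \<pi>" "\<gamma> = g ** r" using \<gamma> by (auto simp: r_coset_def)
  have gi: "invertible g" using g(1) by (simp add: Gamma0_def)
  let ?R = "fls_mat_of_A r" and ?G = "fls_mat_of_A g" and ?d = "emb_A \<iota> (det g) powi (- l)"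
  have d: "?d \<noteq> 0" using det_fls_mat_nonzero(2)[OF gi] by (simp add: power_int_not_zero)
  obtain c where c: "c \<noteq> 0" "\<And>z. slash \<iota> k l f (fls_mat_of_A \<gamma>) z =
      c * (automorphy \<iota> (fls_mat_of_A \<gamma>) z powi (- k) * f (moebius_act \<iota> (fls_mat_of_A \<gamma>) z))"
    using slash_eq[OF det_fls_mat_nonzero(1), of \<gamma> k l f] gi r g(2) by (auto simp: invertible_mult)
  have "slash \<iota> k l f (fls_mat_of_A \<gamma>) z = (c * ?d) * (automorphy \<iota> ?R z powi (- k) * f (moebius_act \<iota> ?R z))"
    if z: "z \<in> Omega \<iota>" for z
  proof -
    let ?w = "moebius_act \<iota> ?R z"
    have jr: "automorphy \<iota> ?R z \<noteq> 0" by (rule automorphy_nonzero[OF z det_fls_mat_nonzero(1)[OF r]])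
    have jg: "automorphy \<iota> ?G ?w \<noteq> 0"
      by (rule automorphy_nonzero[OF moeb[OF z] det_fls_mat_nonzero(1)[OF gi]])
    have fg: "f (moebius_act \<iota> ?G ?w) = ?d * automorphy \<iota> ?G ?w powi k * f ?w"
      using modular g(1) moeb[OF z] by (auto simp: drinfeld_modular_form_def)
    have pw: "automorphy \<iota> ?G ?w powi (- k) * automorphy \<iota> ?G ?w powi k = 1"
      using jg by (simp flip: power_int_add)
    have "slash \<iota> k l f (fls_mat_of_A \<gamma>) z =
        c * ((automorphy \<iota> ?G ?w * automorphy \<iota> ?R z) powi (- k) * (?d * automorphy \<iota> ?G ?w powi k * f ?w))"
      unfolding c(2) by (simp only: g(2) fls_mat_mult automorphy_mult[OF jr] moebius_act_mult[OF jr] fg)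
    also have "\<dots> = (c * ?d) * (automorphy \<iota> ?R z powi (- k) * f ?w) *
        (automorphy \<iota> ?G ?w powi (- k) * automorphy \<iota> ?G ?w powi k)"
      by (simp only: power_int_mult_distrib mult_ac)
    finally show ?thesis unfolding pw by simp
  qed
  moreover have "c * ?d \<noteq> 0" using c(1) d by simp
  ultimately show ?thesis by blast
qed

text \<open>The Fricke involution turns the non-trivial cosets into the functions \<open>f((z + b) / \<pi>)\<close>.\<close>

lemma norm_form_eq:
  "\<exists>C. C \<noteq> 0 \<and> (\<forall>z\<in>Omega \<iota>. norm_form \<iota> \<pi> k l f z =
     C * (f z * (\<Prod>b\<in>residues. f (translate z b))))"
proof -
  interpret group "GL2_A :: ('a poly ^ 2 ^ 2) monoid" by (rule group_GL2_A)
  interpret fls: comm_ring_hom "fls_of_A :: 'a poly \<Rightarrow> _" by (rule fls_of_A_hom)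
  have sub: "subgroup (Gamma0 \<pi>) GL2_A" by (rule subgroup_Gamma0[OF prime])
  note \<pi> = prime_nonzero
  let ?B = residues
  define \<sigma> where "\<sigma> r = (SOME \<gamma>. \<gamma> \<in> Gamma0 \<pi> #>\<^bsub>GL2_A\<^esub> r)" for r
  have \<sigma>: "\<sigma> r \<in> Gamma0 \<pi> #>\<^bsub>GL2_A\<^esub> r" if "invertible r" for r
    unfolding \<sigma>_def by (rule someI[of _ r]) (use rcos_self[OF _ sub] that in simp)
  let ?S = "\<lambda>r. slash \<iota> k l f (fls_mat_of_A (\<sigma> r))"
  have one: "\<exists>c. c \<noteq> 0 \<and> (\<forall>z\<in>Omega \<iota>. ?S (mat 1) z = c * f z)"
  proof -
    have I: "invertible (mat 1 :: 'a poly ^ 2 ^ 2)" using one_closed by simp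
    have m: "moebius_act \<iota> (fls_mat_of_A (mat 1)) z = z" "automorphy \<iota> (fls_mat_of_A (mat 1)) z = 1" for z
      by (simp_all add: automorphy_def moebius_act_def)
    show ?thesis using slash_coset[OF I \<sigma>[OF I]] unfolding m by simp
  qed
  obtain c0 where c0: "c0 \<noteq> 0" "\<And>w. w \<in> Omega \<iota> \<Longrightarrow>
      (emb_A \<iota> \<pi> * w) powi (- k) * f (- 1 / (emb_A \<iota> \<pi> * w)) = c0 * f w"
    using fricke_functional_eq by blast
  have rep: "\<exists>c. c \<noteq> 0 \<and> (\<forall>z\<in>Omega \<iota>. ?S (coset_rep b) z = c * f (translate z b))" for b
  proof -
    have m: "moebius_act \<iota> (fls_mat_of_A (coset_rep b)) z = - 1 / (z + emb_A \<iota> b)"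
      "automorphy \<iota> (fls_mat_of_A (coset_rep b)) z = z + emb_A \<iota> b" for z
      by (simp_all add: automorphy_def moebius_act_def coset_rep_def fls.hom_uminus emb.hom_uminus emb_one)
    have "- 1 / (z + emb_A \<iota> b) \<in> Omega \<iota>" if "z \<in> Omega \<iota>" for z
      using Omega_affine[OF that, of 1 "fls_of_A b"] by (intro Omega_minus_inverse) (simp add: emb_one)
    then obtain c where c: "c \<noteq> 0" "\<And>z. z \<in> Omega \<iota> \<Longrightarrow> ?S (coset_rep b) z =
        c * ((z + emb_A \<iota> b) powi (- k) * f (- 1 / (z + emb_A \<iota> b)))"
      using slash_coset[OF invertible_coset_rep \<sigma>[OF invertible_coset_rep], of b] unfolding m by blast
    have "?S (coset_rep b) z = (c * c0) * f (translate z b)" if z: "z \<in> Omega \<iota>" for z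
    proof -
      \<comment> \<open>Since \<open>\<pi> * ?w = z + b\<close>, the Fricke equation at
        \<open>?w\<close> turns \<open>f(-1 / (z + b))\<close> with its automorphy factor into a
        multiple of \<open>f ?w\<close>.\<close>
      let ?w = "translate z b"
      have "?w = \<iota> (inverse (fls_of_A \<pi>)) * z + \<iota> (fls_of_A b / fls_of_A \<pi>)" by (rule translate_eq)
      hence "?w \<in> Omega \<iota>" using Omega_affine[OF z, of "inverse (fls_of_A \<pi>)"] \<pi> by simp
      moreover have "emb_A \<iota> \<pi> * ?w = z + emb_A \<iota> b" using \<pi> by simp
      ultimately show ?thesis using c0(2)[of ?w] c(2)[OF z] by (simp only: mult.assoc)
    qed
    moreover have "c * c0 \<noteq> 0" using c(1) c0(1) by simp
    ultimately show ?thesis by blast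
  qed
  obtain c1 where c1: "c1 \<noteq> 0" "\<And>z. z \<in> Omega \<iota> \<Longrightarrow> ?S (mat 1) z = c1 * f z" using one by blast
  obtain c where c: "\<And>b. c b \<noteq> 0" "\<And>b z. z \<in> Omega \<iota> \<Longrightarrow>
      ?S (coset_rep b) z = c b * f (translate z b)" using rep by metis
  have fin: "finite ?B" by (rule finite_degree_less)
  show ?thesis
  proof (intro exI[of _ "c1 * (\<Prod>b\<in>?B. c b)"] conjI ballI)
    show "c1 * (\<Prod>b\<in>?B. c b) \<noteq> 0" using c1(1) c(1) fin by simp
    fix z assume z: "z \<in> Omega \<iota>"
    have "norm_form \<iota> \<pi> k l f z = (\<Prod>r\<in>insert (mat 1) (coset_rep ` ?B). ?S r z)"
      unfolding norm_form_def rcosets_Gamma0(1) \<sigma>_def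
      by (subst prod.reindex[OF rcosets_Gamma0(2)]) (simp add: o_def)
    also have "\<dots> = ?S (mat 1) z * (\<Prod>r\<in>coset_rep ` ?B. ?S r z)"
      using fin mat_1_not_coset_rep by (intro prod.insert) auto
    also have "(\<Prod>r\<in>coset_rep ` ?B. ?S r z) = (\<Prod>b\<in>?B. ?S (coset_rep b) z)"
      by (subst prod.reindex) (auto intro: inj_on_subset[OF inj_coset_rep] simp: o_def)
    finally show "norm_form \<iota> \<pi> k l f z = c1 * (\<Prod>b\<in>?B. c b) *
        (f z * (\<Prod>b\<in>?B. f (translate z b)))"
      by (simp only: c1(2)[OF z] c(2)[OF z] prod.distrib mult_ac)
  qed
qed

text \<open>The norm expands as C F G with F and G of leading coefficient 1, so C is exactly what
  the normalisation divides by. The first conclusion ensures that \<open>u_series\<close> of g is a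
  genuine expansion and not an arbitrary value of the definite description.\<close>

lemma normalized_norm_form_expansion:
  assumes coeffs: "coeffs_in_A \<iota> (u_series \<iota> \<omega> f)"
    and lead: "leading_coefficient (u_series \<iota> \<omega> f) = 1"
  defines "g \<equiv> normalize_form \<iota> \<omega> (norm_form \<iota> \<pi> k l f)"
  shows "has_expansion \<iota> (u_param \<iota> \<omega>) g (u_series \<iota> \<omega> g)"
    and "leading_coefficient (u_series \<iota> \<omega> g) = 1"
    and "coeffs_in_A \<iota> (u_series \<iota> \<omega> g)"
    and "fps_cong_mod \<iota> \<pi> (u_series \<iota> \<omega> g) (u_series \<iota> \<omega> (\<lambda>z. f z ^ 2))"
proof -
  let ?u = "u_param \<iota> \<omega>"
  define emb_fps where "emb_fps F = Abs_fps (\<lambda>n. emb_A \<iota> (fps_nth F n))" for F :: "'a poly fps"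
  have emb_nth: "fps_nth (emb_fps F) n = emb_A \<iota> (fps_nth F n)" for F n by (simp add: emb_fps_def)
  have emb_mult: "emb_fps (F * G) = emb_fps F * emb_fps G" for F G
    by (rule fps_ext) (simp only: emb_nth fps_mult_nth emb_A.hom_sum emb_A.hom_mult)
  have emb_lead: "leading_coefficient (emb_fps F) = emb_A \<iota> (fps_nth F (subdegree F))" for F
  proof -
    have "subdegree (emb_fps F) = subdegree F"
    proof (cases "F = 0")
      case True
      hence "emb_fps F = 0" by (intro fps_ext) (simp add: emb_nth)
      thus ?thesis using True by simp
    next
      case False
      thus ?thesis by (intro subdegreeI) (simp_all add: emb_nth nth_less_subdegree_zero)
    qed
    thus ?thesis by (simp add: leading_coefficient_def emb_nth)
  qed
  have lead_mult: "leading_coefficient (A * B) = leading_coefficient A * leading_coefficient B"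
    for A B :: "'c fps"
    by (cases "A = 0 \<or> B = 0") (auto simp: leading_coefficient_def)
  have "\<forall>n. \<exists>a. fps_nth (u_series \<iota> \<omega> f) n = emb_A \<iota> a"
    using coeffs unfolding coeffs_in_A_def by (auto simp: image_iff)
  then obtain a where a: "\<And>n. fps_nth (u_series \<iota> \<omega> f) n = emb_A \<iota> (a n)" by metis
  define F where "F = Abs_fps a"
  have u_f: "u_series \<iota> \<omega> f = emb_fps F" by (rule fps_ext) (simp add: emb_nth F_def a)
  have f: "has_expansion \<iota> ?u f (emb_fps F)" using has_expansion_u_series by (simp add: u_f)
  have "emb_A \<iota> (fps_nth F (subdegree F)) = emb_A \<iota> 1" using lead by (simp add: u_f emb_lead emb_one)
  hence leadF: "fps_nth F (subdegree F) = 1" by (simp only: emb_A_eq_iff)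
  from ex_expansion_prod_translates[OF f[unfolded emb_fps_def] leadF] obtain G where
    leadG: "fps_nth G (subdegree G) = 1" and cong: "\<And>m. \<pi> dvd fps_nth (G - F) m" and
    prod: "has_expansion \<iota> ?u (\<lambda>z. \<Prod>b\<in>residues. f (translate z b)) (emb_fps G)"
    unfolding emb_fps_def by blast
  obtain C where C: "C \<noteq> 0" "\<And>z. z \<in> Omega \<iota> \<Longrightarrow> norm_form \<iota> \<pi> k l f z =
      C * (f z * (\<Prod>b\<in>residues. f (translate z b)))"
    using norm_form_eq by blast
  have "has_expansion \<iota> ?u (norm_form \<iota> \<pi> k l f) (fps_const C * (emb_fps F * emb_fps G))"
    by (rule has_expansion_cong[OF has_expansion_scale[OF has_expansion_mult[OF f prod]]]) (rule C(2))
  hence N: "u_series \<iota> \<omega> (norm_form \<iota> \<pi> k l f) = fps_const C * (emb_fps F * emb_fps G)"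
    by (rule u_series_eq)
  have "leading_coefficient (fps_const C) = C" by (simp add: leading_coefficient_def)
  hence leadN: "leading_coefficient (u_series \<iota> \<omega> (norm_form \<iota> \<pi> k l f)) = C"
    by (simp add: N lead_mult emb_lead leadF leadG emb_one)
  have "g z = f z * (\<Prod>b\<in>residues. f (translate z b))" if "z \<in> Omega \<iota>" for z
    unfolding g_def normalize_form_def leadN using C that by simp
  hence g: "has_expansion \<iota> ?u g (emb_fps (F * G))"
    unfolding emb_mult by (rule has_expansion_cong[OF has_expansion_mult[OF f prod]])
  hence u_g: "u_series \<iota> \<omega> g = emb_fps (F * G)" by (rule u_series_eq)
  show "has_expansion \<iota> ?u g (u_series \<iota> \<omega> g)" using g by (simp only: u_g)
  show "leading_coefficient (u_series \<iota> \<omega> g) = 1"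
    by (simp add: u_g emb_mult lead_mult emb_lead leadF leadG emb_one)
  show "coeffs_in_A \<iota> (u_series \<iota> \<omega> g)"
    unfolding coeffs_in_A_def u_g emb_nth by blast
  have "has_expansion \<iota> ?u (\<lambda>z. f z ^ 2) (emb_fps (F * F))"
    unfolding power2_eq_square emb_mult by (rule has_expansion_mult[OF f f])
  hence u_f2: "u_series \<iota> \<omega> (\<lambda>z. f z ^ 2) = emb_fps (F * F)" by (rule u_series_eq)
  show "fps_cong_mod \<iota> \<pi> (u_series \<iota> \<omega> g) (u_series \<iota> \<omega> (\<lambda>z. f z ^ 2))"
    unfolding fps_cong_mod_def
  proof
    fix n
    \<comment> \<open>The difference is F (G - F), and \<pi> divides every coefficient of the second
      factor.\<close>
    have "fps_nth (emb_fps (F * G) - emb_fps (F * F)) n = emb_A \<iota> (fps_nth (F * (G - F)) n)"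
      by (simp add: emb_nth right_diff_distrib emb_A.hom_minus)
    moreover have "\<pi> dvd fps_nth (F * (G - F)) n"
      unfolding fps_mult_nth by (intro dvd_sum dvd_mult cong)
    ultimately show "fps_nth (u_series \<iota> \<omega> g - u_series \<iota> \<omega> (\<lambda>z. f z ^ 2)) n \<in> emb_A \<iota> ` {a. \<pi> dvd a}"
      unfolding u_g u_f2 by blast
  qed
qed

end

theorem theorem1p2:
  fixes \<iota> :: "'a::{field,finite} fls \<Rightarrow> 'c::{ultrametric_field,complete_space,alg_closed_field}"
    and \<omega> :: 'c and \<pi> :: "'a poly" and k l :: int and f :: "'c \<Rightarrow> 'c"
  assumes "C_infinity \<iota>"
    and "carlitz_period \<iota> \<omega>"
    and "lead_coeff \<pi> = 1" and "prime_elem \<pi>"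
    and "drinfeld_modular_form \<iota> \<omega> (Gamma0 \<pi>) k l f"
    and "coeffs_in_A \<iota> (u_series \<iota> \<omega> f)"
    and "leading_coefficient (u_series \<iota> \<omega> f) = 1"
    and "fricke_eigenform \<iota> \<pi> k l f"
  shows "let g = normalize_form \<iota> \<omega> (norm_form \<iota> \<pi> k l f) in
      has_expansion \<iota> (u_param \<iota> \<omega>) g (u_series \<iota> \<omega> g) \<and>
      leading_coefficient (u_series \<iota> \<omega> g) = 1 \<and>
      coeffs_in_A \<iota> (u_series \<iota> \<omega> g) \<and>
      fps_cong_mod \<iota> \<pi> (u_series \<iota> \<omega> g) (u_series \<iota> \<omega> (\<lambda>z. f z ^ 2))"
proof -
  interpret C_infinity \<iota> by fact
  interpret fricke_form \<iota> \<omega> \<pi> k l f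
    by unfold_locales (use assms in auto)
  show ?thesis
    unfolding Let_def using normalized_norm_form_expansion assms(6,7) by blast
qed

end
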